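(* Let $n\ge 1$, $t>0$, $1<p<\infty$, and let $\mathcal J$ be a translation invariant closed subalgebra of $\mathrm{BUC}(\mathbb C^n)$. Then, for Toeplitz operators acting on the $p$-Fock space $F_t^p$, $$\mathcal T(\mathcal J)=\mathcal T_{lin}(\mathcal J).$$ Moreover, if $\mathcal J_1$ is a translation invariant closed ideal of $\mathcal J$, then $\mathcal T(\mathcal J_1)$ is a two-sided ideal in $\mathcal T(\mathcal J)$.
   Context: For $s>0$ let $d\mu_s(z)=\frac{1}{(\pi s)^n}e^{-|z|^2/s}dV(z)$ on $\mathbb C^n$, with $dV$ Lebesgue measure. For $1\le p<\infty$, $F_t^p$ is the Banach space of entire functions $f$ on $\mathbb C^n$ with $\|f\|_{F_t^p}=\big[\int_{\mathbb C^n}|f|^p\,d\mu_{2t/p}\big]^{1/p}<\infty$. Let $K_z^t(w)=e^{w\cdot\overline z/t}$, where $w\cdot\overline z=\sum_j w_j\overline{z_j}$. For $\varphi\in L^\infty(\mathbb C^n,dV)$ the Toeplitz operator $T_\varphi$ on $F_t^p$ is the bounded operator $T_\varphi f(z)=\int_{\mathbb C^n}\varphi(w)f(w)\overline{K_z^t(w)}\,d\mu_t(w)$. $\mathrm{BUC}(\mathbb C^n)$ is the algebra (with sup norm) of bounded complex functions on $\mathbb C^n$ that are uniformly continuous for the Euclidean metric. A subset $\mathcal J\subset\mathrm{BUC}(\mathbb C^n)$ is translation invariant if $\alpha_z f\in\mathcal J$ for all $f\in\mathcal J$, $z\in\mathbb C^n$, where $(\alpha_z f)(w)=f(w+z)$.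 Closedness is with respect to the sup norm; subalgebras are not assumed self-adjoint or unital. $\mathcal T(\mathcal J)$ is the Banach algebra (norm-closed subalgebra of the bounded operators on $F_t^p$) generated by $\{T_\varphi:\varphi\in\mathcal J\}$, and $\mathcal T_{lin}(\mathcal J)$ is the norm-closed linear span of $\{T_\varphi:\varphi\in\mathcal J\}$. *)

theory Defs
  imports "HOL-Analysis.Analysis" "HOL-Library.Function_Algebras"
begin

text \<open>
  Complex n-space is the type \<open>complex ^ 'n\<close> with \<open>n = CARD('n) \<ge> 1\<close>; its norm is Euclidean and
  \<open>lborel\<close> is Lebesgue measure on it.
  Scalar multiplication by complex numbers is made explicit below because the library's
  vector space type classes for functions are real.
\<close>

definition fun_scale :: "complex \<Rightarrow> ('a \<Rightarrow> complex) \<Rightarrow> 'a \<Rightarrow> complex" where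
  "fun_scale c f = (\<lambda>x. c * f x)"

definition op_scale :: "complex \<Rightarrow> ('b \<Rightarrow> 'a \<Rightarrow> complex) \<Rightarrow> 'b \<Rightarrow> 'a \<Rightarrow> complex" where
  "op_scale c A = (\<lambda>f. fun_scale c (A f))"

interpretation cfun: vector_space fun_scale
  by unfold_locales (auto simp: fun_scale_def fun_eq_iff algebra_simps)

interpretation cop: vector_space op_scale
  by unfold_locales (auto simp: op_scale_def fun_scale_def fun_eq_iff algebra_simps)

text \<open>Closure, and closedness, of \<open>S\<close> relative to a space \<open>V\<close> normed by \<open>N\<close>.\<close>

definition norm_closure :: "'a::minus set \<Rightarrow> ('a \<Rightarrow> real) \<Rightarrow> 'a set \<Rightarrow> 'a set" where
  "norm_closure V N S = {x \<in> V. \<forall>e>0. \<exists>y\<in>S. N (x - y) < e}"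

definition norm_closed :: "'a::minus set \<Rightarrow> ('a \<Rightarrow> real) \<Rightarrow> 'a set \<Rightarrow> bool" where
  "norm_closed V N S \<longleftrightarrow> S \<subseteq> V \<and> norm_closure V N S \<subseteq> S"


subsection \<open>Bounded uniformly continuous functions\<close>

definition BUC :: "((complex ^ 'n::finite) \<Rightarrow> complex) set" where
  "BUC = {f. bounded (range f) \<and> uniformly_continuous_on UNIV f}"

definition sup_norm :: "('a \<Rightarrow> complex) \<Rightarrow> real" where
  "sup_norm f = (SUP z. norm (f z))"

definition translation_invariant :: "((complex ^ 'n::finite) \<Rightarrow> complex) set \<Rightarrow> bool" where
  "translation_invariant J \<longleftrightarrow> (\<forall>f\<in>J. \<forall>z. (\<lambda>w. f (w + z)) \<in> J)"

text \<open>Products of functions are pointwise; subalgebras need be neither unital nor self-adjoint.\<close>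

definition closed_subalgebra_BUC :: "((complex ^ 'n::finite) \<Rightarrow> complex) set \<Rightarrow> bool" where
  "closed_subalgebra_BUC J \<longleftrightarrow>
     norm_closed BUC sup_norm J \<and> cfun.subspace J \<and> (\<forall>f\<in>J. \<forall>g\<in>J. f * g \<in> J)"

definition closed_ideal_of ::
  "((complex ^ 'n::finite) \<Rightarrow> complex) set \<Rightarrow> ((complex ^ 'n) \<Rightarrow> complex) set \<Rightarrow> bool" where
  "closed_ideal_of I J \<longleftrightarrow>
     norm_closed J sup_norm I \<and> cfun.subspace I \<and> (\<forall>f\<in>J. \<forall>g\<in>I. f * g \<in> I)"


subsection \<open>Fock spaces\<close>

definition gauss_measure :: "real \<Rightarrow> (complex ^ 'n::finite) measure" where
  "gauss_measure s =
     density lborel (\<lambda>z. ennreal (exp (- (norm z)\<^sup>2 / s) / (pi * s) ^ CARD('n)))"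

text \<open>Holomorphy in several variables: the Frechet derivative exists everywhere and is
  complex linear.\<close>

definition entire :: "((complex ^ 'n::finite) \<Rightarrow> complex) \<Rightarrow> bool" where
  "entire f \<longleftrightarrow> (\<forall>z. \<exists>D. (f has_derivative D) (at z) \<and> (\<forall>c v. D (c *s v) = c * D v))"

definition fock :: "real \<Rightarrow> real \<Rightarrow> ((complex ^ 'n::finite) \<Rightarrow> complex) set" where
  "fock t p = {f. entire f \<and> integrable (gauss_measure (2 * t / p)) (\<lambda>z. norm (f z) powr p)}"

definition fock_norm :: "real \<Rightarrow> real \<Rightarrow> ((complex ^ 'n::finite) \<Rightarrow> complex) \<Rightarrow> real" where
  "fock_norm t p f = (LINT z|gauss_measure (2 * t / p). norm (f z) powr p) powr (1 / p)"


subsection \<open>Bounded operators on a Fock space\<close>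

type_synonym 'n fock_op = "((complex ^ 'n) \<Rightarrow> complex) \<Rightarrow> (complex ^ 'n) \<Rightarrow> complex"

text \<open>An operator on \<open>fock t p\<close> is represented by a function on all of \<open>(complex ^ 'n) \<Rightarrow> complex\<close>
  that vanishes outside \<open>fock t p\<close>. Equality of operators is then equality of functions, and
  the representatives are closed under pointwise linear combinations and composition.\<close>

definition bounded_ops :: "real \<Rightarrow> real \<Rightarrow> ('n::finite) fock_op set" where
  "bounded_ops t p = {A.
     (\<forall>f\<in>fock t p. A f \<in> fock t p) \<and>
     (\<forall>f\<in>fock t p. \<forall>g\<in>fock t p. A (f + g) = A f + A g) \<and>
     (\<forall>c. \<forall>f\<in>fock t p. A (fun_scale c f) = fun_scale c (A f)) \<and>
     (\<exists>C. \<forall>f\<in>fock t p. fock_norm t p (A f) \<le> C * fock_norm t p f) \<and>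
     (\<forall>f. f \<notin> fock t p \<longrightarrow> A f = 0)}"

definition op_norm :: "real \<Rightarrow> real \<Rightarrow> ('n::finite) fock_op \<Rightarrow> real" where
  "op_norm t p A = (SUP f\<in>{f \<in> fock t p. fock_norm t p f \<le> 1}. fock_norm t p (A f))"

definition closed_op_subalgebra :: "real \<Rightarrow> real \<Rightarrow> ('n::finite) fock_op set \<Rightarrow> bool" where
  "closed_op_subalgebra t p S \<longleftrightarrow>
     norm_closed (bounded_ops t p) (op_norm t p) S \<and> cop.subspace S \<and>
     (\<forall>A\<in>S. \<forall>B\<in>S. A \<circ> B \<in> S)"

definition two_sided_op_ideal :: "('n::finite) fock_op set \<Rightarrow> 'n fock_op set \<Rightarrow> bool" where
  "two_sided_op_ideal I S \<longleftrightarrow>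
     I \<subseteq> S \<and> cop.subspace I \<and> (\<forall>A\<in>S. \<forall>B\<in>I. A \<circ> B \<in> I \<and> B \<circ> A \<in> I)"


subsection \<open>Toeplitz operators\<close>

definition fock_kernel :: "real \<Rightarrow> (complex ^ 'n::finite) \<Rightarrow> (complex ^ 'n) \<Rightarrow> complex" where
  "fock_kernel t z w = exp ((\<Sum>j\<in>UNIV. w $ j * cnj (z $ j)) / of_real t)"

definition toeplitz ::
  "real \<Rightarrow> real \<Rightarrow> ((complex ^ 'n::finite) \<Rightarrow> complex) \<Rightarrow> 'n fock_op" where
  "toeplitz t p \<phi> f =
     (if f \<in> fock t p
      then (\<lambda>z. LINT w|gauss_measure t. \<phi> w * f w * cnj (fock_kernel t z w))
      else 0)"

definition toeplitz_algebra ::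
  "real \<Rightarrow> real \<Rightarrow> ((complex ^ 'n::finite) \<Rightarrow> complex) set \<Rightarrow> 'n fock_op set" where
  "toeplitz_algebra t p J = closed_op_subalgebra t p hull (toeplitz t p ` J)"

definition toeplitz_lin ::
  "real \<Rightarrow> real \<Rightarrow> ((complex ^ 'n::finite) \<Rightarrow> complex) set \<Rightarrow> 'n fock_op set" where
  "toeplitz_lin t p J =
     norm_closure (bounded_ops t p) (op_norm t p) (cop.span (toeplitz t p ` J))"

end

theory Submission
  imports Defs "HOL-Probability.Distributions" "HOL-Complex_Analysis.Cauchy_Integral_Formula"
begin

text \<open>
  The point is that a product of two Toeplitz operators is a norm limit of single Toeplitz
  operators. Write \<open>E z x = exp ((z - x) \<cdot> x\<^sup>* / t)\<close> for the reproducing kernel times the Gaussian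
  density, where \<open>z \<cdot> w\<^sup>*\<close> is the Hermitian product. With \<open>w = x + u\<close> in the double integral,
  \<open>T\<^sub>\<phi> T\<^sub>\<psi> f z\<close> is a constant times the integral over \<open>x\<close> and \<open>u\<close> of
  \<open>f x * E z x * \<psi> x * \<phi> (x + u) * exp (((z - x) \<cdot> u\<^sup>* - u \<cdot> u\<^sup>*) / t)\<close>.
  The factor \<open>exp ((z - x) \<cdot> u\<^sup>* / t)\<close> can be produced by averaging the translates of the symbol
  \<open>\<psi> x * \<phi> (x + u)\<close> with a complex Gaussian weight of small width \<open>s\<close>: because \<open>f\<close> is entire, the
  Gaussian reproducing formula evaluates the average in closed form, up to errors that tend to \<open>0\<close>
  with \<open>s\<close>. Restricting \<open>u\<close> to a large ball makes the weights integrable, so the averaged symbol is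
  an absolutely convergent integral of the functions \<open>\<psi> (x + h) * \<phi> (x + k)\<close> and stays in any
  closed space of symbols that contains them. The difference of the two operators is dominated by
  a convolution operator, whose norm is controlled by Young's inequality and tends to \<open>0\<close> by
  uniform continuity of the symbols and dominated convergence.
\<close>

section \<open>Lebesgue measure, Minkowski and Young inequalities\<close>

text \<open>The cutoff in \<open>u\<close> is forced. The modulus of
  \<open>shift_weight t s u\<close> has an integral over \<open>h\<close> proportional to
  \<open>exp ((norm u)^2 / (4 * s * (1 - s / t)))\<close>, and
  \<open>4 * (s / t) * (1 - s / t)\<close> is at most 1, so the factor
  \<open>exp (- (norm u)^2 / t)\<close> never compensates this growth. Hence the
  \<open>h\<close>-integral must be evaluated exactly before anything is estimated; the kernel that
  results decays in \<open>u\<close> uniformly in the cutoff radius, and radius and width can go to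
  their limits together.

  The evaluation returns \<open>f\<close> at a point moved towards \<open>z\<close> by the ratio
  \<open>s / t\<close>. An affine change of variables puts \<open>f\<close> back at \<open>x\<close>
  and moves the displacement onto the symbols, where uniform continuity controls it; no modulus of
  continuity of \<open>f\<close> enters.

  Norms are handled by attaching half of the Gaussian to the function:
  \<open>gauss_weighted t f\<close> lies in \<open>L^p\<close> of Lebesgue measure with a weight
  that does not depend on \<open>p\<close>, and the modulus of the kernel turns into a function of
  \<open>z - x\<close>. Young's inequality with an \<open>L^1\<close> kernel then treats every
  \<open>p\<close> alike, without duality.\<close>

lemma
  fixes f :: "'a::euclidean_space \<Rightarrow> 'b::{banach, second_countable_topology}"
  assumes c: "c \<noteq> 0" and f[measurable]: "f \<in> borel_measurable borel"
  shows lborel_integral_affine: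
      "integral\<^sup>L lborel f = \<bar>c\<bar> ^ DIM('a) *\<^sub>R (LINT x|lborel. f (a + c *\<^sub>R x))"
    and lborel_integrable_affine_iff:
      "integrable lborel (\<lambda>x. f (a + c *\<^sub>R x)) \<longleftrightarrow> integrable lborel f"
proof -
  have m: "(\<lambda>x. a + c *\<^sub>R x) \<in> borel \<rightarrow>\<^sub>M borel" by measurable
  have f': "f \<in> borel_measurable (distr lborel borel (\<lambda>x. a + c *\<^sub>R x))" by simp
  note e = lborel_affine[OF c, of a]
  show "integral\<^sup>L lborel f = \<bar>c\<bar> ^ DIM('a) *\<^sub>R (LINT x|lborel. f (a + c *\<^sub>R x))"
    by (subst e, subst integral_density) (auto simp: integral_distr)
  have "integrable lborel f \<longleftrightarrow>
      integrable (distr lborel borel (\<lambda>x. a + c *\<^sub>R x)) (\<lambda>x. \<bar>c\<bar> ^ DIM('a) *\<^sub>R f x)"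
    by (subst e, subst integrable_density) auto
  also have "\<dots> \<longleftrightarrow> integrable lborel (\<lambda>x. f (a + c *\<^sub>R x))"
  proof (subst integrable_distr_eq)
    let ?k = "\<bar>c\<bar> ^ DIM('a)" and ?g = "\<lambda>x. f (a + c *\<^sub>R x)"
    have "?g = (\<lambda>x. inverse ?k *\<^sub>R (?k *\<^sub>R ?g x))" using c by simp
    then show "integrable lborel (\<lambda>x. ?k *\<^sub>R ?g x) \<longleftrightarrow> integrable lborel ?g"
      using integrable_scaleR_right[of "inverse ?k" lborel "\<lambda>x. ?k *\<^sub>R ?g x"]
        integrable_scaleR_right[of ?k lborel ?g] by metis
  qed auto
  finally show "integrable lborel (\<lambda>x. f (a + c *\<^sub>R x)) \<longleftrightarrow> integrable lborel f" ..
qed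

lemma
  fixes f :: "'a::euclidean_space \<Rightarrow> 'b::{banach, second_countable_topology}"
  assumes f: "f \<in> borel_measurable borel"
  shows lborel_integral_translate: "(LINT x|lborel. f (x + a)) = integral\<^sup>L lborel f"
    and lborel_integrable_translate: "integrable lborel (\<lambda>x. f (x + a)) \<longleftrightarrow> integrable lborel f"
    and lborel_integral_reflect: "(LINT x|lborel. f (a - x)) = integral\<^sup>L lborel f"
    and lborel_integrable_reflect: "integrable lborel (\<lambda>x. f (a - x)) \<longleftrightarrow> integrable lborel f"
  using lborel_integral_affine[of 1 f a] lborel_integral_affine[of "-1" f a]
    lborel_integrable_affine_iff[of 1 f a] lborel_integrable_affine_iff[of "-1" f a] f
  by (simp_all add: add.commute)

lemma
  fixes f :: "'a::euclidean_space \<Rightarrow> ennreal"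
  assumes f[measurable]: "f \<in> borel_measurable borel"
  shows lborel_nn_integral_translate: "(\<integral>\<^sup>+x. f (x + a) \<partial>lborel) = integral\<^sup>N lborel f"
    and lborel_nn_integral_reflect: "(\<integral>\<^sup>+x. f (a - x) \<partial>lborel) = integral\<^sup>N lborel f"
proof -
  have *: "(\<integral>\<^sup>+x. f (a + c *\<^sub>R x) \<partial>lborel) = integral\<^sup>N lborel f" if c: "\<bar>c\<bar> = 1" for c :: real
  proof -
    have "c \<noteq> 0" using c by auto
    note e = lborel_affine[OF this, of a]
    have "integral\<^sup>N lborel f = integral\<^sup>N (density (distr lborel borel (\<lambda>x. a + c *\<^sub>R x)) (\<lambda>_. \<bar>c\<bar>^DIM('a))) f"
      using e by simp
    also have "\<dots> = (\<integral>\<^sup>+x. f (a + c *\<^sub>R x) \<partial>lborel)"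
      using c by (simp add: nn_integral_density nn_integral_distr)
    finally show ?thesis ..
  qed
  show "(\<integral>\<^sup>+x. f (x + a) \<partial>lborel) = integral\<^sup>N lborel f"
    "(\<integral>\<^sup>+x. f (a - x) \<partial>lborel) = integral\<^sup>N lborel f"
    using *[of 1] *[of "-1"] by (simp_all add: add.commute)
qed

text \<open>The function factors over \<open>Basis\<close> into one-dimensional Gaussians, each a
  multiple of the normal density of variance \<open>1 / (2 * d)\<close>.\<close>

lemma integrable_exp_neg_norm_square:
  fixes d :: real assumes d: "d > 0"
  shows "integrable lborel (\<lambda>x::'a::euclidean_space. exp (- d * (norm x)\<^sup>2))"
proof -
  have 1: "(\<lambda>x::real. exp (- d * x\<^sup>2)) = (\<lambda>x. sqrt (pi / d) * normal_density 0 (sqrt (1 / (2*d))) x)"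
    using d by (auto simp: normal_density_def real_sqrt_divide fun_eq_iff field_simps)
  have "integrable lborel (\<lambda>x::real. exp (- d * x\<^sup>2))"
    unfolding 1 using d by (intro integrable_mult_right integrable_normal_density) auto
  then have f: "(\<integral>\<^sup>+x. ennreal (exp (- d * x\<^sup>2)) \<partial>lborel) < \<infinity>"
    by (simp add: integrable_iff_bounded)
  have 2: "exp (- d * (norm x)\<^sup>2) = (\<Prod>b\<in>Basis. exp (- d * (x \<bullet> b)\<^sup>2))" for x :: 'a
    by (simp add: exp_sum[symmetric] sum_distrib_left[symmetric] power2_norm_eq_inner euclidean_inner[of x x]
       sum_negf) (simp add: power2_eq_square)
  have "(\<integral>\<^sup>+x. ennreal (exp (- d * (norm (x::'a))\<^sup>2)) \<partial>lborel)
      = (\<integral>\<^sup>+x. (\<Prod>b\<in>Basis. ennreal (exp (- d * ((x::'a) \<bullet> b)\<^sup>2))) \<partial>lborel)"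
    unfolding 2 by (simp add: prod_ennreal)
  also have "\<dots> = (\<Prod>b\<in>(Basis::'a set). (\<integral>\<^sup>+x. ennreal (exp (- d * x\<^sup>2)) \<partial>lborel))"
    by (rule nn_integral_lborel_prod[where f="\<lambda>_ x. ennreal (exp (- d * x\<^sup>2))"]) auto
  also have "\<dots> < \<infinity>" using f by (simp add: power_less_top_ennreal)
  finally show ?thesis by (simp add: integrable_iff_bounded)
qed

text \<open>Completing the square: half of the quadratic decay absorbs the linear term at the price
  of a constant, and the other half is left for integrability.\<close>

lemma exp_linear_le_gauss:
  fixes a d r :: real assumes "d > 0"
  shows "exp (a * r - d * r\<^sup>2) \<le> exp (a\<^sup>2 / (2 * d)) * exp (- (d / 2) * r\<^sup>2)"
proof -
  have "0 \<le> (a - d * r)\<^sup>2 / (2 * d)" using assms by simp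
  also have "(a - d * r)\<^sup>2 / (2 * d) = a\<^sup>2 / (2*d) + (d/2) * r\<^sup>2 - a * r"
    using assms by (simp add: field_simps power2_eq_square)
  finally show ?thesis using assms by (simp add: exp_add[symmetric])
qed

lemma exp_linear_gauss_le:
  fixes a d r :: real assumes "d > 0"
  shows "exp (a * r - d * r\<^sup>2) \<le> exp (a\<^sup>2 / (2 * d))"
  by (rule order_trans[OF exp_linear_le_gauss[OF assms]]) (use assms in simp)

lemma integrable_exp_linear_gauss:
  fixes a d :: real assumes "d > 0"
  shows "integrable lborel (\<lambda>x::'a::euclidean_space. exp (a * norm x - d * (norm x)\<^sup>2))"
  by (rule Bochner_Integration.integrable_bound[where f="\<lambda>x. exp (a\<^sup>2 / (2 * d)) * exp (- (d / 2) * (norm x)\<^sup>2)"])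
    (use assms exp_linear_le_gauss[OF assms] integrable_exp_neg_norm_square[of "d / 2"] in \<open>auto simp del: times_divide_eq_left\<close>)

text \<open>
  The uniqueness argument for Haar measure: both the image measure and \<open>lborel\<close> are translation
  invariant, so computing \<open>g y * f (x + y)\<close> in both orders of integration shows that they are
  proportional; the unit ball, which \<open>L\<close> preserves, fixes the constant.
\<close>

lemma lborel_distr_isometry:
  fixes L L' :: "'a::euclidean_space \<Rightarrow> 'a"
  assumes L: "linear L" and n: "\<And>x. norm (L x) = norm x" and inv: "\<And>x. L (L' x) = x" "\<And>x. L' (L x) = x"
  shows "distr lborel borel L = lborel"
proof -
  have lL: "linear L'"
    using L inv by (metis (no_types, lifting) linear_iff)
  have [measurable]: "L \<in> borel_measurable borel" "L' \<in> borel_measurable borel"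
    using L lL by (auto intro!: borel_measurable_continuous_onI linear_continuous_on simp: linear_conv_bounded_linear)
  have n': "norm (L' x) = norm x" for x using n[of "L' x"] inv by simp
  let ?M = "distr lborel borel L"
  \<comment> \<open>Tonelli needs this for the image measure. As \<open>L\<close> preserves norms,
    centred balls have the same finite measure under both measures.\<close>
  have sM: "sigma_finite_measure ?M"
  proof
    let ?F = "range (\<lambda>k::nat. ball (0::'a) (real k))"
    have e: "emeasure ?M (ball 0 r) = emeasure lborel (ball (0::'a) r)" for r
      by (subst emeasure_distr) (auto simp: n vimage_def ball_def intro!: arg_cong[where f="emeasure lborel"])
    show "\<exists>A. countable A \<and> A \<subseteq> sets ?M \<and> \<Union> A = space ?M \<and> (\<forall>a\<in>A. emeasure ?M a \<noteq> \<infinity>)"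
      using emeasure_lborel_ball_finite
      by (intro exI[of _ ?F]) (auto simp: e less_top[symmetric] intro: real_arch_simple reals_Archimedean2)
  qed
  interpret M: sigma_finite_measure ?M by fact
  interpret P: pair_sigma_finite ?M "lborel :: 'a measure"
    by (intro pair_sigma_finite.intro sM) (rule sigma_finite_lborel)
  have trM: "(\<integral>\<^sup>+x. g (x + y) \<partial>?M) = (\<integral>\<^sup>+x. g x \<partial>?M)" if [measurable]: "g \<in> borel_measurable borel"
    for g :: "'a \<Rightarrow> ennreal" and y
  proof -
    have "(\<integral>\<^sup>+x. g (x + y) \<partial>?M) = (\<integral>\<^sup>+x. g (L (x + L' y)) \<partial>lborel)"
      by (simp add: nn_integral_distr linear_add[OF L] inv)
    also have "\<dots> = (\<integral>\<^sup>+x. g (L x) \<partial>lborel)"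
      by (rule lborel_nn_integral_translate[where f="\<lambda>x. g (L x)"]) measurable
    finally show ?thesis by (simp add: nn_integral_distr)
  qed
  let ?B = "ball (0::'a) 1"
  have B: "emeasure lborel ?B \<noteq> 0" "emeasure lborel ?B \<noteq> \<infinity>"
    using emeasure_lborel_ball_finite[of "0::'a" 1] open_not_negligible[of ?B] by (auto simp: less_top[symmetric] null_sets_def negligible_iff_null_sets dest!: null_sets_completionI)
  have "emeasure ?M A = emeasure lborel A" if A: "A \<in> sets borel" for A
  proof -
    have [measurable]: "A \<in> sets borel" by fact
    define f g :: "'a \<Rightarrow> ennreal" where "f = indicator A" and "g = indicator ?B"
    have [measurable]: "f \<in> borel_measurable borel" "g \<in> borel_measurable borel"
      unfolding f_def g_def by (intro borel_measurable_indicator; simp)+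
    have fi: "(\<integral>\<^sup>+x. f x \<partial>?M) = emeasure ?M A" "(\<integral>\<^sup>+x. f x \<partial>lborel) = emeasure lborel A"
      and gi: "(\<integral>\<^sup>+x. g x \<partial>lborel) = emeasure lborel ?B"
      by (simp_all add: f_def g_def)
    have "emeasure lborel ?B * emeasure ?M A = (\<integral>\<^sup>+y. g y * (\<integral>\<^sup>+x. f x \<partial>?M) \<partial>lborel)"
      by (simp add: nn_integral_multc fi gi)
    also have "\<dots> = (\<integral>\<^sup>+y. \<integral>\<^sup>+x. g y * f (x + y) \<partial>?M \<partial>lborel)"
      by (simp add: trM nn_integral_cmult)
    also have "\<dots> = (\<integral>\<^sup>+x. \<integral>\<^sup>+y. g y * f (x + y) \<partial>lborel \<partial>?M)"
      by (rule P.Fubini') measurable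
    also have "\<dots> = (\<integral>\<^sup>+x. \<integral>\<^sup>+y. g (y - x) * f y \<partial>lborel \<partial>?M)"
    proof (rule nn_integral_cong)
      fix x
      show "(\<integral>\<^sup>+y. g y * f (x + y) \<partial>lborel) = (\<integral>\<^sup>+y. g (y - x) * f y \<partial>lborel)"
        using lborel_nn_integral_translate[of "\<lambda>y. g y * f (x + y)" "- x"] by simp
    qed
    also have "\<dots> = (\<integral>\<^sup>+y. \<integral>\<^sup>+x. g (y - x) * f y \<partial>?M \<partial>lborel)"
      by (rule P.Fubini'[symmetric]) measurable
    also have "\<dots> = (\<integral>\<^sup>+y. emeasure lborel ?B * f y \<partial>lborel)"
    proof (rule nn_integral_cong)
      fix y :: 'a
      have "(\<integral>\<^sup>+x. g (y - x) * f y \<partial>?M) = (\<integral>\<^sup>+x. g (y - x) \<partial>?M) * f y"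
        by (rule nn_integral_multc) measurable
      also have "(\<integral>\<^sup>+x. g (y - x) \<partial>?M) = (\<integral>\<^sup>+x. g (y - L x) \<partial>lborel)"
        by (simp add: nn_integral_distr)
      also have "\<dots> = (\<integral>\<^sup>+x. g (L' y - x) \<partial>lborel)"
      proof -
        \<comment> \<open>Indeed \<open>y - L x = L (L' y - x)\<close>; since the ball is invariant
          under \<open>L\<close>, the inner integral is one over \<open>lborel\<close>
          again.\<close>
        have "norm (y - L x) = norm (L' y - x)" for x
          using n[of "L' y - x"] by (simp add: linear_diff[OF L] inv)
        then have "g (y - L x) = g (L' y - x)" for x by (simp add: g_def indicator_def)
        then show ?thesis by simp
      qed
      also have "\<dots> = (\<integral>\<^sup>+x. g x \<partial>lborel)" by (rule lborel_nn_integral_reflect) measurable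
      finally show "(\<integral>\<^sup>+x. g (y - x) * f y \<partial>?M) = emeasure lborel ?B * f y" by (simp add: gi)
    qed
    also have "\<dots> = emeasure lborel ?B * emeasure lborel A"
      by (simp add: nn_integral_cmult fi)
    finally show ?thesis using B by (simp add: ennreal_mult_cancel_left)
  qed
  then show ?thesis by (intro measure_eqI) auto
qed

lemma integrable_pair_dominated:
  fixes k :: "'a::euclidean_space \<times> 'b::euclidean_space \<Rightarrow> 'c::{banach, second_countable_topology}"
  assumes k: "k \<in> borel_measurable (lborel \<Otimes>\<^sub>M lborel)"
    and a: "integrable lborel a" and b: "integrable lborel b"
    and le: "\<And>x y. norm (k (x, y)) \<le> a x * b y"
  shows "integrable (lborel \<Otimes>\<^sub>M lborel) k"
proof -
  have "integrable (lborel \<Otimes>\<^sub>M lborel) (\<lambda>(x, y). a x * b y)"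
    by (rule lborel_pair.Fubini_integrable)
      (use a b in \<open>auto simp: abs_mult intro!: integrable_mult_left integrable_mult_right\<close>)
  then show ?thesis
    by (rule Bochner_Integration.integrable_bound) (use k le in \<open>auto intro!: order_trans[OF le abs_ge_self]\<close>)
qed

section \<open>Convexity of powers and the inequalities of Minkowski and Young\<close>

text \<open>Convexity in the form that integrates directly to Jensen's inequality. The tangent
  argument runs on the open half-line, so \<open>a = 0\<close> and \<open>x = 0\<close> are separate
  cases.\<close>

lemma powr_above_tangent:
  fixes p a x :: real assumes "1 < p" "0 \<le> a" "0 \<le> x"
  shows "a powr p + p * a powr (p - 1) * (x - a) \<le> x powr p"
proof -
  consider "a = 0" | "a > 0" "x = 0" | "a > 0" "x > 0" using assms by linarith
  then show ?thesis
  proof cases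
    case 2
    then have "a powr (p - 1) * a = a powr p"
      by (simp add: powr_mult_base mult.commute[of _ a])
    then show ?thesis using 2 assms by (simp add: mult.assoc)
  next
    case 3
    have "x powr p - a powr p \<ge> (p * a powr (p - 1)) * (x - a)"
      by (rule convex_on_imp_above_tangent[where A="{0<..}"])
        (use 3 assms in \<open>auto intro!: powr_convex derivative_eq_intros simp: interior_open\<close>)
    then show ?thesis by (simp add: algebra_simps)
  qed simp
qed

text \<open>Add the two tangent inequalities at the weighted mean; the linear terms cancel.\<close>

lemma powr_weighted_le:
  fixes p x y l m :: real assumes "1 < p" "0 \<le> x" "0 \<le> y" "0 \<le> l" "0 \<le> m" "l + m = 1"
  shows "(l * x + m * y) powr p \<le> l * x powr p + m * y powr p"
proof -
  let ?a = "l * x + m * y"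
  let ?b = "p * ?a powr (p - 1)"
  have a: "0 \<le> ?a" using assms by simp
  have "l * (?a powr p + ?b * (x - ?a)) + m * (?a powr p + ?b * (y - ?a)) \<le> l * x powr p + m * y powr p"
    using assms a by (intro add_mono mult_left_mono powr_above_tangent) auto
  moreover have "l * (?a powr p + ?b * (x - ?a)) + m * (?a powr p + ?b * (y - ?a))
     = (l + m) * ?a powr p + ?b * (?a - (l + m) * ?a)" by (simp add: algebra_simps)
  ultimately show ?thesis using assms by simp
qed

text \<open>Lets \<open>H * F\<close> be dominated by \<open>H + H * F powr p\<close>, so that
  convolutions converge without Hoelder's inequality.\<close>

lemma le_one_plus_powr:
  fixes x p :: real assumes "0 \<le> x" "1 < p" shows "x \<le> 1 + x powr p"
proof (cases "x \<le> 1")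
  case False
  then have "x powr 1 \<le> x powr p" using assms by (intro powr_mono) auto
  then show ?thesis using assms by (simp add: False)
qed (simp add: add_increasing2)

text \<open>Convexity is applied to the normalised functions \<open>F x / a\<close> and
  \<open>G x / b\<close> with weights \<open>a / (a + b)\<close> and \<open>b / (a + b)\<close>. For
  \<open>a\<close> and \<open>b\<close> above the two norms, the integrated right-hand side is at
  most \<open>(a + b) powr p\<close>; \<open>a = b = 1\<close> already gives integrability.\<close>

lemma
  fixes F G :: "'a \<Rightarrow> real"
  assumes p: "1 < p" and F[measurable]: "F \<in> borel_measurable M" and G[measurable]: "G \<in> borel_measurable M"
    and pos: "\<And>x. 0 \<le> F x" "\<And>x. 0 \<le> G x"
    and i: "integrable M (\<lambda>x. F x powr p)" "integrable M (\<lambda>x. G x powr p)"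
  shows Minkowski_integrable: "integrable M (\<lambda>x. (F x + G x) powr p)"
    and Minkowski_inequality: "(LINT x|M. (F x + G x) powr p) powr (1/p)
      \<le> (LINT x|M. F x powr p) powr (1/p) + (LINT x|M. G x powr p) powr (1/p)"
proof -
  have b: "(F x + G x) powr p \<le> (a + b) powr p * ((a/(a+b)) * (F x powr p / a powr p) + (b/(a+b)) * (G x powr p / b powr p))"
    if ab: "a > 0" "b > 0" for a b x
  proof -
    have "((a/(a+b)) * (F x / a) + (b/(a+b)) * (G x / b)) powr p
       \<le> (a/(a+b)) * (F x / a) powr p + (b/(a+b)) * (G x / b) powr p"
      using ab pos p by (intro powr_weighted_le) (auto simp: add_divide_distrib[symmetric])
    moreover have "(a/(a+b)) * (F x / a) + (b/(a+b)) * (G x / b) = (F x + G x) / (a + b)"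
      using ab by (simp add: add_divide_distrib)
    ultimately have "((F x + G x) / (a + b)) powr p \<le> (a/(a+b)) * (F x powr p / a powr p) + (b/(a+b)) * (G x powr p / b powr p)"
      using ab pos by (simp add: powr_divide)
    moreover have "((F x + G x) / (a + b)) powr p = (F x + G x) powr p / (a + b) powr p"
      using ab pos by (simp add: powr_divide)
    ultimately show ?thesis using ab by (simp add: pos_divide_le_eq mult.commute)
  qed
  show I: "integrable M (\<lambda>x. (F x + G x) powr p)"
    by (rule Bochner_Integration.integrable_bound[OF _ _ AE_I2, where
       f="\<lambda>x. (1 + 1) powr p * ((1/(1+1)) * (F x powr p / 1 powr p) + (1/(1+1)) * (G x powr p / 1 powr p))"])
      (use i b[of 1 1] in \<open>auto \<close>)
  let ?A = "(LINT x|M. F x powr p)" and ?B = "(LINT x|M. G x powr p)"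
  have A: "?A \<ge> 0" "?B \<ge> 0" by auto
  have rt: "(x powr (1/p)) powr p = x" "(x powr p) powr (1/p) = x" if "x \<ge> 0" for x :: real
    using that p by (auto simp: powr_powr)
  show "(LINT x|M. (F x + G x) powr p) powr (1/p) \<le> ?A powr (1/p) + ?B powr (1/p)"
  proof (rule field_le_epsilon)
    fix e :: real assume e: "e > 0"
    \<comment> \<open>The summand \<open>e/2\<close> keeps the normalisers positive even when a norm
      is zero.\<close>
    define a b where ab: "a = ?A powr (1/p) + e/2" "b = ?B powr (1/p) + e/2"
    have abp: "a > 0" "b > 0" using e by (auto simp: ab add_nonneg_pos)
    have le: "?A / a powr p \<le> 1" "?B / b powr p \<le> 1"
      using rt[OF A(1)] rt[OF A(2)] powr_mono2[of p "?A powr (1/p)" a] powr_mono2[of p "?B powr (1/p)" b] abp e p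
      by (auto simp: ab pos_divide_le_eq)
    have "(LINT x|M. (F x + G x) powr p) \<le> (LINT x|M. (a + b) powr p * ((a/(a+b)) * (F x powr p / a powr p) + (b/(a+b)) * (G x powr p / b powr p)))"
      using i I b[OF abp] by (intro integral_mono) auto
    also have "\<dots> = (a + b) powr p * ((a/(a+b)) * (?A / a powr p) + (b/(a+b)) * (?B / b powr p))"
      using i by simp
    also have "\<dots> \<le> (a + b) powr p * ((a/(a+b)) * 1 + (b/(a+b)) * 1)"
      using le abp by (intro mult_left_mono add_mono) auto
    also have "\<dots> = (a + b) powr p" using abp by (simp add: add_divide_distrib[symmetric])
    finally have "(LINT x|M. (F x + G x) powr p) powr (1/p) \<le> ((a + b) powr p) powr (1/p)"
      using p by (intro powr_mono2) auto
    also have "\<dots> = a + b" using abp by (intro rt) auto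
    finally show "(LINT x|M. (F x + G x) powr p) powr (1/p) \<le> ?A powr (1/p) + ?B powr (1/p) + e"
      by (simp add: ab)
  qed
qed

text \<open>Jensen's inequality for the measure with density \<open>H (z - w)\<close>, whose mass
  does not depend on \<open>z\<close>, followed by Fubini. The bound \<open>B\<close> makes
  \<open>H (z - w) * F w powr p\<close> integrable for every \<open>z\<close> and not merely almost
  every \<open>z\<close>. The function \<open>G\<close> stands for anything dominated by the
  convolution, such as the weighted modulus of an operator's output.\<close>

lemma
  fixes H F :: "'a::euclidean_space \<Rightarrow> real"
  assumes p: "1 < p" and H: "integrable lborel H" "\<And>x. 0 \<le> H x" "\<And>x. H x \<le> B"
    and F[measurable]: "F \<in> borel_measurable borel" and F0: "\<And>x. 0 \<le> F x"
    and Fp: "integrable lborel (\<lambda>x. F x powr p)"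
  shows convolution_integrable: "integrable lborel (\<lambda>w. H (z - w) * F w)"
    and Young_convolution_integrable: "G \<in> borel_measurable borel \<Longrightarrow> (\<And>z. 0 \<le> G z)
      \<Longrightarrow> (\<And>z. G z \<le> (LINT w|lborel. H (z - w) * F w)) \<Longrightarrow> integrable lborel (\<lambda>z. G z powr p)"
    and Young_convolution_le: "G \<in> borel_measurable borel \<Longrightarrow> (\<And>z. 0 \<le> G z)
      \<Longrightarrow> (\<And>z. G z \<le> (LINT w|lborel. H (z - w) * F w)) \<Longrightarrow>
      (LINT z|lborel. G z powr p) powr (1/p) \<le> integral\<^sup>L lborel H * (LINT z|lborel. F z powr p) powr (1/p)"
proof -
  have Hm[measurable]: "H \<in> borel_measurable borel" using H(1) by auto
  have iH: "integrable lborel (\<lambda>w. H (z - w))" "(LINT w|lborel. H (z - w)) = integral\<^sup>L lborel H" for z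
    using H(1) by (simp_all add: lborel_integrable_reflect lborel_integral_reflect)
  have iHp: "integrable lborel (\<lambda>w. H (z - w) * F w powr p)" for z
    by (rule Bochner_Integration.integrable_bound[OF _ _ AE_I2, where f="\<lambda>w. B * F w powr p"])
      (use H Fp order_trans[OF H(2) H(3)] in \<open>auto simp: abs_mult intro!: mult_right_mono\<close>)
  show iHF: "integrable lborel (\<lambda>w. H (z - w) * F w)" for z
  proof (rule Bochner_Integration.integrable_bound[OF Bochner_Integration.integrable_add[OF iH(1) iHp] _ AE_I2])
    show "norm (H (z - w) * F w) \<le> norm (H (z - w) + H (z - w) * F w powr p)" for w
      using mult_left_mono[OF le_one_plus_powr[OF F0 p], OF H(2), of "z - w" w] H(2)[of "z - w"] F0[of w]
      by (simp add: algebra_simps abs_mult)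
  qed measurable
  let ?h = "integral\<^sup>L lborel H"
  have h0: "?h \<ge> 0" using H by simp
  have J: "(LINT w|lborel. H (z - w) * F w) powr p \<le> ?h powr (p - 1) * (LINT w|lborel. H (z - w) * F w powr p)" for z
  proof (cases "?h = 0")
    case True
    have "AE w in lborel. H (z - w) = 0"
      using iH[of z] True H by (subst integral_nonneg_eq_0_iff_AE[symmetric]) auto
    then have "(LINT w|lborel. H (z - w) * F w) = 0" by (intro integral_eq_zero_AE) auto
    then show ?thesis using True by simp
  next
    case False
    then have h: "?h > 0" using h0 by simp
    let ?I = "LINT w|lborel. H (z - w) * F w"
    \<comment> \<open>The mean of \<open>F\<close> under the normalised kernel: the tangent at this
      point integrates to Jensen's inequality.\<close>
    define a where "a = ?I / ?h"
    have I0: "?I \<ge> 0" using H F0 by simp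
    have a0: "a \<ge> 0" using I0 h by (simp add: a_def)
    let ?T = "\<lambda>w. H (z - w) * (a powr p - p * a powr (p - 1) * a) + p * a powr (p - 1) * (H (z - w) * F w)"
    have "(LINT w|lborel. ?T w) \<le> (LINT w|lborel. H (z - w) * F w powr p)"
    proof (rule integral_mono[OF _ iHp])
      show "integrable lborel ?T" using iH(1) iHF by simp
      show "?T w \<le> H (z - w) * F w powr p" for w
        using mult_left_mono[OF powr_above_tangent[OF p a0 F0], OF H(2), of "z - w" w] by (simp add: algebra_simps)
    qed
    also have "(LINT w|lborel. ?T w) = ?h * (a powr p - p * a powr (p - 1) * a) + p * a powr (p - 1) * ?I"
      using iH(1) iHF by (subst Bochner_Integration.integral_add) (auto simp: iH(2))
    also have "?I = ?h * a" using h by (simp add: a_def)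
    finally have *: "?h * a powr p \<le> (LINT w|lborel. H (z - w) * F w powr p)" by (simp add: algebra_simps)
    have "?I powr p = ?h powr p * a powr p" using h I0 by (simp add: a_def powr_divide)
    also have "\<dots> = ?h powr (p - 1) * (?h * a powr p)" using h by (simp add: powr_mult_base powr_diff)
    also have "\<dots> \<le> ?h powr (p - 1) * (LINT w|lborel. H (z - w) * F w powr p)"
      using * by (intro mult_left_mono) auto
    finally show ?thesis .
  qed
  assume G[measurable]: "G \<in> borel_measurable borel" and G0: "\<And>z. 0 \<le> G z"
    and GH: "\<And>z. G z \<le> (LINT w|lborel. H (z - w) * F w)"
  let ?k = "\<lambda>(w, z). H (z - w) * F w powr p"
  have ik: "integrable (lborel \<Otimes>\<^sub>M lborel) ?k"
  proof (rule lborel_pair.Fubini_integrable)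
    have "(LINT z|lborel. H (z - w)) = ?h" for w
      using lborel_integral_translate[of H "- w"] by simp
    then show "integrable lborel (\<lambda>w. LINT z|lborel. norm (?k (w, z)))"
      using Fp H by (simp add: abs_mult)
    show "AE w in lborel. integrable lborel (\<lambda>z. ?k (w, z))"
      using H(1) lborel_integrable_translate[of H "- _"] by auto
  qed (simp add: case_prod_beta')
  have i2: "integrable lborel (\<lambda>z. LINT w|lborel. H (z - w) * F w powr p)"
    using lborel_pair.integrable_snd[OF ik] by simp
  have e2: "(LINT z|lborel. LINT w|lborel. H (z - w) * F w powr p) = ?h * (LINT w|lborel. F w powr p)"
    using lborel_pair.Fubini_integral[OF ik] lborel_integral_translate[of H "- _"] by simp
  have le: "G z powr p \<le> ?h powr (p - 1) * (LINT w|lborel. H (z - w) * F w powr p)" for z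
    using J[of z] powr_mono2[OF _ G0 GH, of p z] p by simp
  show i3: "integrable lborel (\<lambda>z. G z powr p)"
    by (rule Bochner_Integration.integrable_bound[OF integrable_mult_right[OF i2, of "?h powr (p - 1)"] _ AE_I2])
      (use le in \<open>auto intro: order_trans[OF _ abs_ge_self]\<close>)
  have "(LINT z|lborel. G z powr p) \<le> (LINT z|lborel. ?h powr (p - 1) * (LINT w|lborel. H (z - w) * F w powr p))"
    using i2 i3 le by (intro integral_mono) auto
  also have "\<dots> = ?h powr p * (LINT w|lborel. F w powr p)"
    using h0 by (simp add: e2 powr_diff)
  finally have "(LINT z|lborel. G z powr p) powr (1/p) \<le> (?h powr p * (LINT w|lborel. F w powr p)) powr (1/p)"
    using p by (intro powr_mono2) auto
  also have "\<dots> = ?h * (LINT w|lborel. F w powr p) powr (1/p)"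
    using h0 p by (simp add: powr_mult powr_powr)
  finally show "(LINT z|lborel. G z powr p) powr (1/p) \<le> ?h * (LINT z|lborel. F z powr p) powr (1/p)" .
qed

section \<open>Entire functions\<close>

definition hdot :: "complex ^ 'n::finite \<Rightarrow> complex ^ 'n \<Rightarrow> complex" where
  "hdot z w = (\<Sum>j\<in>UNIV. z $ j * cnj (w $ j))"

lemma hdot_simps:
  "hdot (x + y) w = hdot x w + hdot y w" "hdot (x - y) w = hdot x w - hdot y w"
  "hdot z (x + y) = hdot z x + hdot z y" "hdot z (x - y) = hdot z x - hdot z y"
  "hdot (- x) w = - hdot x w" "hdot z (- x) = - hdot z x"
  "hdot (c *s z) w = c * hdot z w" "hdot z (c *s w) = cnj c * hdot z w"
  "hdot (r *\<^sub>R z) w = of_real r * hdot z w" "hdot z (r *\<^sub>R w) = of_real r * hdot z w"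
  "hdot 0 w = 0" "hdot z 0 = 0"
  by (simp_all add: hdot_def sum.distrib sum_subtractf sum_negf sum_distrib_left scaleR_sum_right algebra_simps)
    (simp_all add: scaleR_conv_of_real mult_ac)

lemma hdot_self: "hdot z z = of_real ((norm z)\<^sup>2)"
proof -
  have "(norm z)\<^sup>2 = (\<Sum>j\<in>UNIV. (cmod (z $ j))\<^sup>2)"
    by (simp add: norm_vec_def L2_set_def sum_nonneg)
  then show ?thesis by (simp add: hdot_def complex_norm_square del: of_real_power)
qed

lemma cnj_hdot: "cnj (hdot z w) = hdot w z"
  by (simp add: hdot_def mult.commute)

lemma norm_hdot_le: "norm (hdot z w) \<le> norm z * norm w"
proof -
  have "norm (hdot z w) \<le> (\<Sum>j\<in>UNIV. \<bar>norm (z $ j)\<bar> * \<bar>norm (w $ j)\<bar>)"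
    unfolding hdot_def by (rule order_trans[OF norm_sum]) (simp add: norm_mult)
  also have "\<dots> \<le> norm z * norm w" unfolding norm_vec_def by (rule L2_set_mult_ineq)
  finally show ?thesis .
qed

lemma continuous_on_hdot [continuous_intros]:
  "continuous_on S f \<Longrightarrow> continuous_on S g \<Longrightarrow> continuous_on S (\<lambda>x. hdot (f x) (g x))"
  unfolding hdot_def by (intro continuous_intros)

lemma norm_diff_square: "(norm (z - w))\<^sup>2 = (norm z)\<^sup>2 + (norm w)\<^sup>2 - 2 * Re (hdot z w)"
proof -
  have "complex_of_real ((norm (z - w))\<^sup>2) = of_real ((norm z)\<^sup>2) + of_real ((norm w)\<^sup>2) - (hdot z w + cnj (hdot z w))"
    unfolding hdot_self[symmetric] cnj_hdot by (simp add: hdot_simps)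
  also have "\<dots> = of_real ((norm z)\<^sup>2 + (norm w)\<^sup>2 - 2 * Re (hdot z w))"
    by (simp add: complex_add_cnj)
  finally show ?thesis using of_real_eq_iff by blast
qed

lemma has_derivative_hdot_left: "((\<lambda>h. hdot h b) has_derivative (\<lambda>h. hdot h b)) F"
proof (rule bounded_linear_imp_has_derivative)
  show "bounded_linear (\<lambda>h. hdot h b)"
    by (rule bounded_linear_intro[where K="norm b"]) (auto simp: hdot_simps scaleR_conv_of_real[where 'a=complex] norm_hdot_le)
qed

lemma entire_continuous_on: "entire f \<Longrightarrow> continuous_on S f"
  unfolding entire_def by (meson continuous_at_imp_continuous_on has_derivative_continuous)

lemma entire_borel: "entire f \<Longrightarrow> f \<in> borel_measurable borel"
  by (intro borel_measurable_continuous_onI entire_continuous_on)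

lemma entire_const: "entire (\<lambda>_. c)"
  unfolding entire_def by (auto intro!: exI[of _ "\<lambda>_. 0"])

lemma entire_add: "entire f \<Longrightarrow> entire g \<Longrightarrow> entire (\<lambda>z. f z + g z)"
  unfolding entire_def
proof
  fix z assume a: "\<forall>z. \<exists>D. (f has_derivative D) (at z) \<and> (\<forall>c v. D (c *s v) = c * D v)"
    "\<forall>z. \<exists>D. (g has_derivative D) (at z) \<and> (\<forall>c v. D (c *s v) = c * D v)"
  obtain D E where "(f has_derivative D) (at z)" "\<forall>c v. D (c *s v) = c * D v"
    "(g has_derivative E) (at z)" "\<forall>c v. E (c *s v) = c * E v" using a by meson
  then show "\<exists>D. ((\<lambda>z. f z + g z) has_derivative D) (at z) \<and> (\<forall>c v. D (c *s v) = c * D v)"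
    by (intro exI[of _ "\<lambda>v. D v + E v"]) (auto intro: has_derivative_add simp: algebra_simps)
qed

lemma entire_mult: "entire f \<Longrightarrow> entire g \<Longrightarrow> entire (\<lambda>z. f z * g z)"
  unfolding entire_def
proof
  fix z assume a: "\<forall>z. \<exists>D. (f has_derivative D) (at z) \<and> (\<forall>c v. D (c *s v) = c * D v)"
    "\<forall>z. \<exists>D. (g has_derivative D) (at z) \<and> (\<forall>c v. D (c *s v) = c * D v)"
  obtain D E where "(f has_derivative D) (at z)" "\<forall>c v. D (c *s v) = c * D v"
    "(g has_derivative E) (at z)" "\<forall>c v. E (c *s v) = c * E v" using a by meson
  then show "\<exists>D. ((\<lambda>z. f z * g z) has_derivative D) (at z) \<and> (\<forall>c v. D (c *s v) = c * D v)"
    by (intro exI[of _ "\<lambda>v. f z * E v + D v * g z"] conjI has_derivative_mult) (auto simp: algebra_simps)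
qed

lemma entire_exp_hdot: "entire (\<lambda>h. exp (k * hdot h b))"
  unfolding entire_def
proof
  fix z
  have "((\<lambda>h. exp (k * hdot h b)) has_derivative (\<lambda>h. exp (k * hdot z b) * (k * hdot h b))) (at z)"
    using has_derivative_compose[OF has_derivative_mult_right[OF has_derivative_hdot_left[of b "at z"], of k]
      DERIV_exp[of "k * hdot z b", unfolded has_field_derivative_def]] by simp
  then show "\<exists>D. ((\<lambda>h. exp (k * hdot h b)) has_derivative D) (at z) \<and> (\<forall>c v. D (c *s v) = c * D v)"
    by (auto simp: hdot_simps intro!: exI[of _ "\<lambda>h. exp (k * hdot z b) * (k * hdot h b)"])
qed

lemma entire_affine:
  assumes "entire f" shows "entire (\<lambda>h. f (a + r *\<^sub>R h))"
  unfolding entire_def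
proof
  fix z
  obtain D where D: "(f has_derivative D) (at (a + r *\<^sub>R z))" "\<forall>c v. D (c *s v) = c * D v"
    using assms unfolding entire_def by meson
  have "((\<lambda>h. a + r *\<^sub>R h) has_derivative (\<lambda>h. r *\<^sub>R h)) (at z)"
    by (auto intro!: derivative_eq_intros)
  from has_derivative_compose[OF this D(1)]
  have "((\<lambda>h. f (a + r *\<^sub>R h)) has_derivative (\<lambda>h. D (r *\<^sub>R h))) (at z)" .
  moreover have "r *\<^sub>R (c *s v) = c *s (r *\<^sub>R v)" for c and v :: "complex ^ 'a"
    by (simp add: vec_eq_iff)
  ultimately show "\<exists>D. ((\<lambda>h. f (a + r *\<^sub>R h)) has_derivative D) (at z) \<and> (\<forall>c v. D (c *s v) = c * D v)"
    using D(2) by (intro exI[of _ "\<lambda>h. D (r *\<^sub>R h)"]) simp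
qed

lemma bounded_linear_smult_left: "bounded_linear (\<lambda>l. l *s (k :: complex ^ 'n::finite))"
  by (rule bounded_linear_intro[where K="norm k"])
    (auto simp: vec_eq_iff algebra_simps norm_vec_def norm_mult L2_set_right_distrib scaleR_conv_of_real[where 'a=complex])

lemma norm_smult: "norm (c *s (k :: complex ^ 'n::finite)) = norm c * norm k"
  by (simp add: norm_vec_def norm_mult L2_set_right_distrib)

section \<open>Mean values over the circle action and the Gaussian reproducing formula\<close>

text \<open>Complex linearity of the Frechet derivative makes the derivative along the line through
  \<open>k\<close> multiplication by \<open>D k\<close>. This reduces several variables to Cauchy's
  formula in one.\<close>

lemma entire_slice_holomorphic:
  assumes "entire f" shows "(\<lambda>l. f (l *s k)) holomorphic_on S"
proof -
  have "\<exists>E. ((\<lambda>l. f (l *s k)) has_field_derivative E) (at l)" for l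
  proof -
    obtain D where D: "(f has_derivative D) (at (l *s k))" "\<forall>c v. D (c *s v) = c * D v"
      using assms unfolding entire_def by meson
    have "((\<lambda>l. f (l *s k)) has_derivative (\<lambda>m. D (m *s k))) (at l)"
      by (rule has_derivative_compose[OF bounded_linear_imp_has_derivative[OF bounded_linear_smult_left] D(1)])
    moreover have "(\<lambda>m. D (m *s k)) = (*) (D k)" using D(2) by (auto simp: mult.commute)
    ultimately show ?thesis unfolding has_field_derivative_def by metis
  qed
  then show ?thesis
    unfolding holomorphic_on_def field_differentiable_def using has_field_derivative_at_within by blast
qed

lemma circle_mean_value:
  assumes "g holomorphic_on UNIV"
  shows "(LINT x:{0..1}|lborel. g (exp (2 * of_real pi * \<i> * of_real x))) = g 0"
proof -
  have h: "g holomorphic_on cball 0 1" using assms holomorphic_on_subset by blast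
  have "((\<lambda>u. g u / (u - 0)) has_contour_integral (2 * of_real pi * \<i> * g 0)) (circlepath 0 1)"
    by (rule Cauchy_integral_circlepath_simple[OF h]) simp
  then have "((\<lambda>x. g (exp (2 * of_real pi * \<i> * of_real x)) * (2 * of_real pi * \<i>)) has_integral (2 * of_real pi * \<i> * g 0)) {0..1}"
    unfolding has_contour_integral_def
    by (rule has_integral_eq[rotated]) (auto simp: vector_derivative_circlepath01, simp add: circlepath)
  then have "((\<lambda>x. g (exp (2 * of_real pi * \<i> * of_real x)) * (2 * of_real pi * \<i>) / (2 * of_real pi * \<i>)) has_integral (2 * of_real pi * \<i> * g 0) / (2 * of_real pi * \<i>)) {0..1}"
    by (rule has_integral_divide)
  then have "((\<lambda>x. g (exp (2 * of_real pi * \<i> * of_real x))) has_integral g 0) {0..1}" by simp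
  moreover have "set_integrable lborel {0..1::real} (\<lambda>x. g (exp (2 * of_real pi * \<i> * of_real x)))"
    using holomorphic_on_imp_continuous_on[OF assms]
    by (intro borel_integrable_atLeastAtMost') (auto intro!: continuous_intros continuous_on_compose2[of UNIV g])
  ultimately show ?thesis
    by (subst set_borel_integral_eq_integral(2)) (auto simp: integral_unique)
qed

text \<open>A unimodular scalar acts as a real linear isometry, so
  \<open>lborel_distr_isometry\<close> applies.\<close>

lemma
  fixes f :: "complex ^ 'n::finite \<Rightarrow> 'b::{banach, second_countable_topology}"
  assumes c: "norm c = 1" and f[measurable]: "f \<in> borel_measurable borel"
  shows lborel_integral_rotate: "(LINT x|lborel. f (c *s x)) = integral\<^sup>L lborel f"
    and lborel_integrable_rotate: "integrable lborel (\<lambda>x. f (c *s x)) \<longleftrightarrow> integrable lborel f"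
proof -
  have l: "linear ((*s) c :: complex ^ 'n \<Rightarrow> _)"
    by (auto simp: linear_iff vec_eq_iff algebra_simps)
  have c0: "c \<noteq> 0" using c by auto
  have d: "distr lborel borel ((*s) c :: complex ^ 'n \<Rightarrow> _) = lborel"
    by (rule lborel_distr_isometry[where L'="(*s) (inverse c)"])
      (use c0 c l in \<open>auto simp: vector_smult_assoc norm_smult\<close>)
  have m: "((*s) c :: complex ^ 'n \<Rightarrow> _) \<in> lborel \<rightarrow>\<^sub>M borel"
    using l by (simp add: borel_measurable_continuous_onI linear_continuous_on linear_conv_bounded_linear)
  show "(LINT x|lborel. f (c *s x)) = integral\<^sup>L lborel f"
    using integral_distr[OF m f] by (simp add: d)
  show "integrable lborel (\<lambda>x. f (c *s x)) \<longleftrightarrow> integrable lborel f"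
    using integrable_distr_eq[OF m f] by (simp add: d)
qed

text \<open>Average over the circle action \<open>h\<close> to \<open>c *s h\<close>. Rotation
  preserves \<open>lborel\<close> and \<open>w\<close>, so all rotated integrals agree, while for
  fixed \<open>h\<close> the mean over the circle replaces \<open>G\<close> by \<open>G 0\<close>.
  The absolute integrals of the rotated integrands agree too, which justifies Fubini.\<close>

lemma entire_radial_mean_value:
  fixes G :: "complex ^ 'n::finite \<Rightarrow> complex" and w :: "complex ^ 'n \<Rightarrow> complex"
  assumes G: "entire G" and w: "continuous_on UNIV w" "\<And>c h. norm c = 1 \<Longrightarrow> w (c *s h) = w h"
    and i: "integrable lborel (\<lambda>h. w h * G h)"
  shows "(LINT h|lborel. w h * G h) = integral\<^sup>L lborel w * G 0"
proof -
  let ?e = "\<lambda>x::real. exp (2 * of_real pi * \<i> * of_real x)"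
  have ne: "norm (?e x) = 1" for x by simp
  let ?k = "\<lambda>(x, h). indicator {0..1} x *\<^sub>R (w h * G (?e x *s h))"
  have Gc: "continuous_on UNIV G" by (rule entire_continuous_on[OF G])
  have cs: "continuous_on UNIV (\<lambda>q :: real \<times> (complex ^ 'n). ?e (fst q) *s snd q)"
    unfolding vector_scalar_mult_def by (intro continuous_intros continuous_on_vec_lambda)
  have [measurable]: "(\<lambda>q :: real \<times> (complex ^ 'n). w (snd q) * G (?e (fst q) *s snd q)) \<in> borel_measurable (lborel \<Otimes>\<^sub>M lborel)"
    unfolding lborel_prod using cs
    by (auto intro!: borel_measurable_continuous_onI continuous_intros continuous_on_compose2[OF Gc] continuous_on_compose2[OF w(1)])
  have m: "(\<lambda>h. w h * G h) \<in> borel_measurable borel"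
    using Gc w by (auto intro!: borel_measurable_continuous_onI continuous_intros)
  have rot: "(LINT h|lborel. w h * G (?e x *s h)) = (LINT h|lborel. w h * G h)"
      "integrable lborel (\<lambda>h. w h * G (?e x *s h))"
      "(LINT h|lborel. norm (w h * G (?e x *s h))) = (LINT h|lborel. norm (w h * G h))" for x
    using lborel_integral_rotate[OF ne m, of x] lborel_integrable_rotate[OF ne m, of x] i
      lborel_integral_rotate[OF ne, of "\<lambda>h. norm (w h * G h)" x] m by (auto simp: w(2)[OF ne])
  have ik: "integrable (lborel \<Otimes>\<^sub>M lborel) ?k"
  proof (rule lborel_pair.Fubini_integrable)
    show "?k \<in> borel_measurable (lborel \<Otimes>\<^sub>M lborel)" by (simp add: case_prod_beta')
    show "integrable lborel (\<lambda>x. LINT h|lborel. norm (?k (x, h)))"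
      using rot(3) by simp
    show "AE x in lborel. integrable lborel (\<lambda>h. ?k (x, h))"
      using rot(2) by simp
  qed
  have "(LINT x|lborel. LINT h|lborel. ?k (x, h)) = (LINT h|lborel. LINT x|lborel. ?k (x, h))"
    using lborel_pair.Fubini_integral[OF ik] by simp
  moreover have "(LINT h|lborel. ?k (x, h)) = indicator {0..1} x *\<^sub>R (LINT h|lborel. w h * G h)" for x
    using rot(1) by simp
  moreover have "(LINT x|lborel. ?k (x, h)) = w h * G 0" for h
  proof -
    have "(LINT x|lborel. ?k (x, h)) = w h * (LINT x:{0..1}|lborel. G (?e x *s h))"
      unfolding set_lebesgue_integral_def by (subst integral_mult_right_zero[symmetric]) (auto simp: mult_ac)
    also have "(LINT x:{0..1}|lborel. G (?e x *s h)) = G (0 *s h)"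
      by (rule circle_mean_value[OF entire_slice_holomorphic[OF G]])
    finally show ?thesis by simp
  qed
  ultimately have "(LINT x|lborel. indicator {0..1::real} x *\<^sub>R (LINT h|lborel. w h * G h)) = (LINT h|lborel. w h * G 0)"
    by (simp only:)
  then show ?thesis by simp
qed

text \<open>Translate by \<open>a\<close>. With \<open>h = k + a\<close> the exponent
  \<open>hdot a h - hdot h h\<close> becomes \<open>- hdot k k - hdot k a\<close>: the part
  antiholomorphic in \<open>h\<close> has been absorbed by the Gaussian, what remains besides it is
  entire in \<open>k\<close>, and the mean value is taken at \<open>k = 0\<close>.\<close>

lemma gauss_reproducing:
  fixes G :: "complex ^ 'n::finite \<Rightarrow> complex"
  assumes G: "entire G" and s: "s > 0"
    and i: "integrable lborel (\<lambda>h. G h * exp (hdot a h / of_real s) * of_real (exp (- (norm h)\<^sup>2 / s)))"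
  shows "(LINT h|lborel. G h * exp (hdot a h / of_real s) * of_real (exp (- (norm h)\<^sup>2 / s)))
    = G a * of_real (LINT h|lborel. exp (- (norm (h :: complex ^ 'n))\<^sup>2 / s))"
proof -
  let ?g = "\<lambda>h. G h * exp (hdot a h / of_real s) * of_real (exp (- (norm h)\<^sup>2 / s))"
  let ?w = "\<lambda>h :: complex ^ 'n. complex_of_real (exp (- (norm h)\<^sup>2 / s))"
  let ?H = "\<lambda>k. exp ((- 1 / of_real s) * hdot k a) * G (a + 1 *\<^sub>R k)"
  have H: "entire ?H" by (intro entire_mult entire_exp_hdot entire_affine G)
  have e: "?g (k + a) = ?w k * ?H k" for k
  proof -
    have ew: "?w h = exp (- hdot h h / of_real s)" for h
      by (simp add: hdot_self flip: exp_of_real)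
    have "hdot a (k + a) / of_real s + - hdot (k + a) (k + a) / of_real s = - hdot k k / of_real s + (- 1 / of_real s) * hdot k a"
      using s by (simp add: hdot_simps field_simps)
    then have "exp (hdot a (k + a) / of_real s) * exp (- hdot (k + a) (k + a) / of_real s)
        = exp (- hdot k k / of_real s) * exp ((- 1 / of_real s) * hdot k a)"
      by (simp only: exp_add[symmetric])
    then show ?thesis unfolding ew by (simp add: mult.assoc add.commute mult.left_commute)
  qed
  have m: "?g \<in> borel_measurable borel"
    by (intro borel_measurable_continuous_onI continuous_intros entire_continuous_on G) (use s in auto)
  have "integrable lborel (\<lambda>k. ?w k * ?H k)"
    using lborel_integrable_translate[OF m, of a] i by (simp only: e)
  then have "(LINT k|lborel. ?w k * ?H k) = integral\<^sup>L lborel ?w * ?H 0"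
    by (intro entire_radial_mean_value H) (use s in \<open>auto simp: norm_smult intro!: continuous_intros\<close>)
  moreover have "integral\<^sup>L lborel ?g = (LINT k|lborel. ?w k * ?H k)"
    using lborel_integral_translate[OF m, of a] by (simp only: e)
  ultimately show ?thesis by (simp add: hdot_simps)
qed

section \<open>Fock spaces and their bounded operators\<close>

text \<open>The Gaussian of width \<open>2 * t / p\<close> is the \<open>p\<close>-th power of this
  weight up to normalisation. Thus \<open>fock_norm\<close> is \<open>fock_const\<close> times an
  unweighted \<open>L^p\<close> norm, to which Minkowski and Young apply.\<close>

definition gauss_weighted :: "real \<Rightarrow> (complex ^ 'n::finite \<Rightarrow> complex) \<Rightarrow> complex ^ 'n \<Rightarrow> real" where
  "gauss_weighted t f z = norm (f z) * exp (- (norm z)\<^sup>2 / (2 * t))"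

definition fock_const :: "real \<Rightarrow> real \<Rightarrow> 'n::finite itself \<Rightarrow> real" where
  "fock_const t p _ = (1 / (pi * (2 * t / p)) ^ CARD('n)) powr (1 / p)"

lemma gauss_weighted_nonneg: "0 \<le> gauss_weighted t f z"
  by (simp add: gauss_weighted_def)

lemma gauss_weighted_borel: "entire f \<Longrightarrow> gauss_weighted t f \<in> borel_measurable borel"
  unfolding gauss_weighted_def[abs_def] using entire_borel[of f] by simp

lemma fock_const_pos: "t > 0 \<Longrightarrow> p > 1 \<Longrightarrow> fock_const t p TYPE('n::finite) > 0"
  by (simp add: fock_const_def)

lemma gauss_density_powr:
  assumes "t > 0" "p > 1"
  shows "(exp (- (norm z)\<^sup>2 / (2 * t / p)) / (pi * (2 * t / p)) ^ CARD('n)) *\<^sub>R (norm (f z) powr p)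
     = 1 / (pi * (2 * t / p)) ^ CARD('n) * gauss_weighted t f (z :: complex ^ 'n::finite) powr p"
proof -
  have "exp (- (norm z)\<^sup>2 / (2 * t)) powr p = exp (- (norm z)\<^sup>2 / (2 * t / p))"
    using assms by (simp add: exp_powr_real)
  then show ?thesis
    by (simp add: gauss_weighted_def powr_mult)
qed

lemma fock_iff:
  assumes "t > 0" "p > 1"
  shows "f \<in> fock t p \<longleftrightarrow> entire f \<and> integrable lborel (\<lambda>z. gauss_weighted t f (z :: complex ^ 'n::finite) powr p)"
proof (cases "entire f")
  case True
  note m = entire_borel[OF True]
  have "integrable (gauss_measure (2 * t / p)) (\<lambda>z :: complex ^ 'n. norm (f z) powr p) \<longleftrightarrow>
     integrable lborel (\<lambda>z. 1 / (pi * (2 * t / p)) ^ CARD('n) * gauss_weighted t f (z :: complex ^ 'n) powr p)"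
    unfolding gauss_measure_def gauss_density_powr[OF assms, of _ f, symmetric]
  proof (rule integrable_density)
    show "AE z in lborel. 0 \<le> exp (- (norm (z :: complex ^ 'n))\<^sup>2 / (2 * t / p)) / (pi * (2 * t / p)) ^ CARD('n)"
      using assms by (intro AE_I2) simp
  qed (use m in measurable)
  also have "\<dots> \<longleftrightarrow> integrable lborel (\<lambda>z. gauss_weighted t f (z :: complex ^ 'n) powr p)"
  proof
    assume "integrable lborel (\<lambda>z. 1 / (pi * (2 * t / p)) ^ CARD('n) * gauss_weighted t f (z :: complex ^ 'n) powr p)"
    from integrable_mult_right[OF this, of "(pi * (2 * t / p)) ^ CARD('n)"]
    show "integrable lborel (\<lambda>z. gauss_weighted t f (z :: complex ^ 'n) powr p)" using assms by simp
  qed (rule integrable_mult_right)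
  finally show ?thesis using True by (simp add: fock_def)
qed (simp add: fock_def)

lemma fock_entire: "f \<in> fock t p \<Longrightarrow> entire f" by (simp add: fock_def)

lemma fock_norm_eq:
  assumes "t > 0" "p > 1" "entire f"
  shows "fock_norm t p f = fock_const t p TYPE('n) *
    (LINT z|lborel. gauss_weighted t f (z :: complex ^ 'n::finite) powr p) powr (1 / p)"
proof -
  note m = entire_borel[OF assms(3)]
  have "(LINT z|gauss_measure (2 * t / p). norm (f (z :: complex ^ 'n)) powr p)
     = (LINT z|lborel. 1 / (pi * (2 * t / p)) ^ CARD('n) * gauss_weighted t f (z :: complex ^ 'n) powr p)"
    unfolding gauss_measure_def gauss_density_powr[OF assms(1,2), of _ f, symmetric]
  proof (rule integral_density)
    show "AE z in lborel. 0 \<le> exp (- (norm (z :: complex ^ 'n))\<^sup>2 / (2 * t / p)) / (pi * (2 * t / p)) ^ CARD('n)"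
      using assms by (intro AE_I2) simp
  qed (use m in measurable)
  also have "\<dots> = 1 / (pi * (2 * t / p)) ^ CARD('n) * (LINT z|lborel. gauss_weighted t f (z :: complex ^ 'n) powr p)"
    by (rule integral_mult_right_zero)
  finally show ?thesis
    unfolding fock_norm_def fock_const_def using assms by (simp add: powr_mult powr_divide)
qed

lemma fock_norm_nonneg: "0 \<le> fock_norm t p f"
  by (simp add: fock_norm_def)

lemma fock_zero: "0 \<in> fock t p"
  using entire_const[of 0] by (simp add: fock_def zero_fun_def)

lemma fock_norm_zero: "fock_norm t p 0 = 0"
  by (simp add: fock_norm_def)

lemma fock_scale:
  assumes "f \<in> fock t p" shows "fun_scale c f \<in> fock t p"
  using assms entire_mult[OF entire_const[of c], of f]
  by (simp add: fock_def fun_scale_def norm_mult powr_mult)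

lemma fock_norm_scale:
  assumes "p > 1" shows "fock_norm t p (fun_scale c f) = norm c * fock_norm t p f"
  using assms by (simp add: fock_norm_def fun_scale_def norm_mult powr_mult powr_powr)

lemma
  assumes t: "t > 0" and p: "p > 1" and f: "f \<in> fock t p" and g: "g \<in> fock t p"
  shows fock_add: "f + g \<in> fock t p"
    and fock_norm_triangle: "fock_norm t p (f + g) \<le> fock_norm t p f + fock_norm t p g"
proof -
  have e: "entire f" "entire g" "entire (f + g)"
    using f g entire_add[of f g] by (auto simp: fock_entire plus_fun_def)
  note fm = gauss_weighted_borel[OF e(1), of t] gauss_weighted_borel[OF e(2), of t]
     gauss_weighted_borel[OF e(3), of t]
  have le: "gauss_weighted t (f + g) z \<le> gauss_weighted t f z + gauss_weighted t g z" for z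
    unfolding gauss_weighted_def distrib_right[symmetric]
    by (intro mult_right_mono) (auto simp: norm_triangle_ineq)
  have i: "integrable lborel (\<lambda>z. gauss_weighted t f z powr p)" "integrable lborel (\<lambda>z. gauss_weighted t g z powr p)"
    using f g by (auto simp: fock_iff[OF t p])
  have I: "integrable lborel (\<lambda>z. (gauss_weighted t f z + gauss_weighted t g z) powr p)"
    and M: "(LINT x|lborel. (gauss_weighted t f x + gauss_weighted t g x) powr p) powr (1/p)
      \<le> (LINT x|lborel. gauss_weighted t f x powr p) powr (1/p) + (LINT x|lborel. gauss_weighted t g x powr p) powr (1/p)"
    using fm by (auto intro!: Minkowski_integrable Minkowski_inequality p i gauss_weighted_nonneg)
  have lep: "gauss_weighted t (f + g) z powr p \<le> (gauss_weighted t f z + gauss_weighted t g z) powr p" for z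
    using le p by (intro powr_mono2) (auto simp: gauss_weighted_nonneg)
  have I2: "integrable lborel (\<lambda>z. gauss_weighted t (f + g) z powr p)"
    by (rule Bochner_Integration.integrable_bound[OF I _ AE_I2]) (use fm lep in auto)
  then show "f + g \<in> fock t p" using e by (simp add: fock_iff[OF t p])
  have "(LINT x|lborel. gauss_weighted t (f + g) x powr p) powr (1/p) \<le>
     (LINT x|lborel. (gauss_weighted t f x + gauss_weighted t g x) powr p) powr (1/p)"
    using p integral_mono[OF I2 I lep] by (intro powr_mono2) auto
  also note M
  finally show "fock_norm t p (f + g) \<le> fock_norm t p f + fock_norm t p g"
    using fock_const_pos[OF t p, where 'n='a] e
    by (simp add: fock_norm_eq[OF t p] flip: distrib_left)
qed

lemma bounded_opsD:
  fixes A :: "'n::finite fock_op"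
  assumes "A \<in> bounded_ops t p"
  shows "f \<in> fock t p \<Longrightarrow> A f \<in> fock t p"
    and "f \<in> fock t p \<Longrightarrow> g \<in> fock t p \<Longrightarrow> A (f + g) = A f + A g"
    and "f \<in> fock t p \<Longrightarrow> A (fun_scale c f) = fun_scale c (A f)"
    and "\<exists>C. \<forall>f\<in>fock t p. fock_norm t p (A f) \<le> C * fock_norm t p f"
    and "f \<notin> fock t p \<Longrightarrow> A f = 0"
    and "A 0 = 0"
proof -
  show "A 0 = 0"
    using assms fock_zero[of t p] unfolding bounded_ops_def
    by (metis (mono_tags, lifting) cfun.scale_zero_left mem_Collect_eq)
qed (use assms in \<open>auto simp: bounded_ops_def\<close>)

lemma bounded_opsI:
  fixes A :: "'n::finite fock_op"
  assumes "\<And>f. f \<in> fock t p \<Longrightarrow> A f \<in> fock t p"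
    and "\<And>f g. f \<in> fock t p \<Longrightarrow> g \<in> fock t p \<Longrightarrow> A (f + g) = A f + A g"
    and "\<And>f c. f \<in> fock t p \<Longrightarrow> A (fun_scale c f) = fun_scale c (A f)"
    and "\<And>f. f \<in> fock t p \<Longrightarrow> fock_norm t p (A f) \<le> C * fock_norm t p f"
    and "\<And>f. f \<notin> fock t p \<Longrightarrow> A f = 0"
  shows "A \<in> bounded_ops t p"
  unfolding bounded_ops_def using assms by blast

lemma
  assumes p: "p > 1" and A: "A \<in> bounded_ops t p"
  shows op_norm_bound: "f \<in> fock t p \<Longrightarrow> fock_norm t p (A f) \<le> op_norm t p A * fock_norm t p f"
    and op_norm_nonneg: "0 \<le> op_norm t p A"
proof -
  obtain C where C: "\<And>f. f \<in> fock t p \<Longrightarrow> fock_norm t p (A f) \<le> C * fock_norm t p f"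
    using bounded_opsD(4)[OF A] by blast
  have "fock_norm t p (A f) \<le> \<bar>C\<bar>" if "f \<in> fock t p" "fock_norm t p f \<le> 1" for f
  proof -
    have "C * fock_norm t p f \<le> \<bar>C\<bar> * 1"
      using that fock_norm_nonneg[of t p f] by (intro mult_mono) auto
    then show ?thesis using C[OF that(1)] by simp
  qed
  then have bdd: "bdd_above ((\<lambda>f. fock_norm t p (A f)) ` {f \<in> fock t p. fock_norm t p f \<le> 1})"
    by (intro bdd_aboveI[of _ "\<bar>C\<bar>"]) auto
  have le: "fock_norm t p (A f) \<le> op_norm t p A" if "f \<in> fock t p" "fock_norm t p f \<le> 1" for f
    unfolding op_norm_def by (rule cSUP_upper[OF _ bdd]) (use that in simp)
  show "0 \<le> op_norm t p A"
    using le[OF fock_zero] by (simp add: fock_norm_zero bounded_opsD[OF A])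
  assume f: "f \<in> fock t p"
  show "fock_norm t p (A f) \<le> op_norm t p A * fock_norm t p f"
  proof (cases "fock_norm t p f = 0")
    case True
    then show ?thesis using C[OF f] by simp
  next
    case False
    then have pos: "fock_norm t p f > 0" using fock_norm_nonneg[of t p f] by simp
    let ?c = "complex_of_real (inverse (fock_norm t p f))"
    have "fock_norm t p (A (fun_scale ?c f)) \<le> op_norm t p A"
      using pos by (intro le fock_scale f) (simp add: fock_norm_scale[OF p] norm_inverse)
    then show ?thesis
      using pos by (simp add: bounded_opsD(3)[OF A f] fock_norm_scale[OF p] norm_inverse pos_le_divide_eq divide_inverse[symmetric] mult.commute)
        (simp add: field_simps)
  qed
qed

lemma op_norm_le:
  fixes A :: "'n::finite fock_op"
  assumes "\<And>f. f \<in> fock t p \<Longrightarrow> fock_norm t p (A f) \<le> C * fock_norm t p f" "0 \<le> C"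
  shows "op_norm t p A \<le> C"
  unfolding op_norm_def
proof (rule cSUP_least)
  show "{f :: complex ^ 'n \<Rightarrow> complex. f \<in> fock t p \<and> fock_norm t p f \<le> 1} \<noteq> {}"
    using fock_zero[of t p] fock_norm_zero[of t p] by (metis (mono_tags, lifting) empty_iff mem_Collect_eq zero_le_one)
  fix f :: "complex ^ 'n \<Rightarrow> complex"
  assume "f \<in> {f \<in> fock t p. fock_norm t p f \<le> 1}"
  then show "fock_norm t p (A f) \<le> C"
    using assms(1)[of f] mult_left_mono[of "fock_norm t p f" 1 C] assms(2) by simp
qed

lemma
  assumes p: "p > 1" and A: "A \<in> bounded_ops t p"
  shows bounded_ops_scale: "op_scale c A \<in> bounded_ops t p"
    and op_norm_scale: "op_norm t p (op_scale c A) \<le> norm c * op_norm t p A"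
proof -
  have *: "fock_norm t p (op_scale c A f) \<le> norm c * op_norm t p A * fock_norm t p f" if "f \<in> fock t p" for f
    using mult_left_mono[OF op_norm_bound[OF p A that], of "norm c"] by (simp add: op_scale_def fock_norm_scale[OF p] mult.assoc)
  then show "op_norm t p (op_scale c A) \<le> norm c * op_norm t p A"
    using op_norm_nonneg[OF p A] by (intro op_norm_le) auto
  have "fun_scale c 0 = 0" by (simp add: fun_scale_def zero_fun_def)
  then show "op_scale c A \<in> bounded_ops t p"
    by (intro bounded_opsI[where C="norm c * op_norm t p A"] *)
      (simp_all add: bounded_opsD[OF A] op_scale_def fock_scale cfun.scale_right_distrib cfun.scale_left_commute)
qed

lemma
  assumes t: "t > 0" and p: "p > 1" and A: "A \<in> bounded_ops t p" and B: "B \<in> bounded_ops t p"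
  shows bounded_ops_add: "A + B \<in> bounded_ops t p"
    and op_norm_triangle: "op_norm t p (A + B) \<le> op_norm t p A + op_norm t p B"
proof -
  have *: "fock_norm t p ((A + B) f) \<le> (op_norm t p A + op_norm t p B) * fock_norm t p f" if f: "f \<in> fock t p" for f
    using fock_norm_triangle[OF t p bounded_opsD(1)[OF A f] bounded_opsD(1)[OF B f]]
      op_norm_bound[OF p A f] op_norm_bound[OF p B f] by (simp add: distrib_right)
  then show "op_norm t p (A + B) \<le> op_norm t p A + op_norm t p B"
    using op_norm_nonneg[OF p A] op_norm_nonneg[OF p B] by (intro op_norm_le) auto
  show "A + B \<in> bounded_ops t p"
    by (intro bounded_opsI[where C="op_norm t p A + op_norm t p B"] *)
      (simp_all add: bounded_opsD[OF A] bounded_opsD[OF B] fock_add[OF t p] cfun.scale_right_distrib)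
qed

lemma
  assumes p: "p > 1" and A: "A \<in> bounded_ops t p" and B: "B \<in> bounded_ops t p"
  shows bounded_ops_comp: "A \<circ> B \<in> bounded_ops t p"
    and op_norm_comp: "op_norm t p (A \<circ> B) \<le> op_norm t p A * op_norm t p B"
proof -
  have *: "fock_norm t p ((A \<circ> B) f) \<le> (op_norm t p A * op_norm t p B) * fock_norm t p f" if f: "f \<in> fock t p" for f
    using op_norm_bound[OF p A bounded_opsD(1)[OF B f]]
      mult_left_mono[OF op_norm_bound[OF p B f] op_norm_nonneg[OF p A]] by (simp add: mult.assoc)
  then show "op_norm t p (A \<circ> B) \<le> op_norm t p A * op_norm t p B"
    using op_norm_nonneg[OF p A] op_norm_nonneg[OF p B] by (intro op_norm_le) auto
  show "A \<circ> B \<in> bounded_ops t p"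
    by (intro bounded_opsI[where C="op_norm t p A * op_norm t p B"] *)
      (simp_all add: bounded_opsD[OF A] bounded_opsD[OF B])
qed

lemma op_diff_conv: "A - B = A + op_scale (- 1) B"
  by (auto simp: op_scale_def fun_scale_def fun_eq_iff)

lemma bounded_ops_diff:
  assumes t: "t > 0" and p: "p > 1" and A: "A \<in> bounded_ops t p" and B: "B \<in> bounded_ops t p"
  shows "A - B \<in> bounded_ops t p"
  unfolding op_diff_conv using assms by (intro bounded_ops_add bounded_ops_scale)

lemma bounded_ops_zero: "0 \<in> bounded_ops t p"
  by (rule bounded_opsI[where C=0]) (simp_all add: fock_zero fock_norm_zero)

lemma bounded_ops_subspace: "t > 0 \<Longrightarrow> p > 1 \<Longrightarrow> cop.subspace (bounded_ops t p)"
  by (auto simp: cop.subspace_def bounded_ops_zero bounded_ops_add bounded_ops_scale)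

text \<open>Additivity of \<open>A\<close> is available only on \<open>fock t p\<close>. For
  \<open>f\<close> outside it the inner operators return 0, and \<open>A 0 = 0\<close>.\<close>

lemma op_comp_right_linear:
  assumes "A \<in> bounded_ops t p" "B \<in> bounded_ops t p" "C \<in> bounded_ops t p"
  shows "A \<circ> (B + C) = (A \<circ> B) + (A \<circ> C)" "A \<circ> op_scale c B = op_scale c (A \<circ> B)"
proof -
  show "A \<circ> (B + C) = (A \<circ> B) + (A \<circ> C)"
  proof
    fix f
    have "A (B f + C f) = A (B f) + A (C f)"
    proof (cases "f \<in> fock t p")
      case False
      then have "B f = 0" "C f = 0" using assms(2,3) bounded_opsD(5) by blast+
      then show ?thesis using bounded_opsD(6)[OF assms(1)] by simp
    qed (use assms bounded_opsD(1,2) in blast)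
    then show "(A \<circ> (B + C)) f = ((A \<circ> B) + (A \<circ> C)) f"
      by (simp only: o_apply plus_fun_apply)
  qed
  show "A \<circ> op_scale c B = op_scale c (A \<circ> B)"
  proof
    fix f
    have "A (fun_scale c (B f)) = fun_scale c (A (B f))"
    proof (cases "f \<in> fock t p")
      case False
      then have "B f = 0" using assms(2) bounded_opsD(5) by blast
      moreover have "fun_scale c 0 = 0" by (rule cfun.scale_zero_right)
      ultimately show ?thesis using bounded_opsD(6)[OF assms(1)] by simp
    qed (use assms bounded_opsD(1,3) in blast)
    then show "(A \<circ> op_scale c B) f = op_scale c (A \<circ> B) f"
      by (simp only: o_apply op_scale_def)
  qed
qed

lemma op_comp_left_linear:
  "(A + B) \<circ> C = (A \<circ> C) + (B \<circ> C)" "op_scale c A \<circ> C = op_scale c (A \<circ> C)" "(A - B) \<circ> C = (A \<circ> C) - (B \<circ> C)" "0 \<circ> C = 0"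
  by (auto simp: op_scale_def fun_eq_iff)

section \<open>Closures in the operator norm\<close>

lemma norm_closureD: "x \<in> norm_closure V N S \<Longrightarrow> e > 0 \<Longrightarrow> \<exists>y\<in>S. N (x - y) < e"
  by (simp add: norm_closure_def)

lemma norm_closureI: "x \<in> V \<Longrightarrow> (\<And>e. e > 0 \<Longrightarrow> \<exists>y\<in>S. N (x - y) < e) \<Longrightarrow> x \<in> norm_closure V N S"
  by (simp add: norm_closure_def)

lemma norm_closure_bounded: "norm_closure V N S \<subseteq> V"
  by (auto simp: norm_closure_def)

lemma op_closure_superset:
  fixes S :: "'n::finite fock_op set"
  assumes "S \<subseteq> bounded_ops t p" shows "S \<subseteq> norm_closure (bounded_ops t p) (op_norm t p) S"
proof -
  have "op_norm t p (0 :: 'n fock_op) \<le> 0" by (rule op_norm_le) (auto simp: fock_norm_zero)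
  show ?thesis
  proof
    fix A assume A: "A \<in> S"
    have "\<exists>y\<in>S. op_norm t p (A - y) < e" if "e > 0" for e
      using A that \<open>op_norm t p (0 :: 'n fock_op) \<le> 0\<close> by (intro bexI[of _ A]) auto
    then show "A \<in> norm_closure (bounded_ops t p) (op_norm t p) S"
      using A assms by (intro norm_closureI) auto
  qed
qed

lemma op_closure_closed:
  assumes t: "t > 0" and p: "p > 1" and S: "S \<subseteq> bounded_ops t p"
  shows "norm_closed (bounded_ops t p) (op_norm t p) (norm_closure (bounded_ops t p) (op_norm t p) S)"
  unfolding norm_closed_def
proof (intro conjI norm_closure_bounded subsetI)
  fix A assume A: "A \<in> norm_closure (bounded_ops t p) (op_norm t p) (norm_closure (bounded_ops t p) (op_norm t p) S)"
  have "\<exists>C\<in>S. op_norm t p (A - C) < e" if e: "e > 0" for e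
  proof -
    obtain B where B: "B \<in> norm_closure (bounded_ops t p) (op_norm t p) S" "op_norm t p (A - B) < e / 2"
      using norm_closureD[OF A half_gt_zero[OF e]] by blast
    obtain C where C: "C \<in> S" "op_norm t p (B - C) < e / 2"
      using norm_closureD[OF B(1) half_gt_zero[OF e]] by blast
    have b: "A \<in> bounded_ops t p" "B \<in> bounded_ops t p" "C \<in> bounded_ops t p"
      using A B C S norm_closure_bounded by blast+
    have "A - C = (A - B) + (B - C)" by simp
    then have "op_norm t p (A - C) \<le> op_norm t p (A - B) + op_norm t p (B - C)"
      using op_norm_triangle[OF t p bounded_ops_diff[OF t p b(1,2)] bounded_ops_diff[OF t p b(2,3)]] by metis
    then have "op_norm t p (A - C) < e" using B C by linarith
    then show ?thesis using C(1) by blast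
  qed
  moreover have "A \<in> bounded_ops t p" using A norm_closure_bounded by blast
  ultimately show "A \<in> norm_closure (bounded_ops t p) (op_norm t p) S" by (intro norm_closureI)
qed

lemma op_closure_subspace:
  assumes t: "t > 0" and p: "p > 1" and S: "S \<subseteq> bounded_ops t p" "cop.subspace S"
  shows "cop.subspace (norm_closure (bounded_ops t p) (op_norm t p) S)"
  unfolding cop.subspace_def
proof (intro conjI ballI allI)
  show "0 \<in> norm_closure (bounded_ops t p) (op_norm t p) S"
    using op_closure_superset[OF S(1)] cop.subspace_0[OF S(2)] by blast
next
  fix A B assume A: "A \<in> norm_closure (bounded_ops t p) (op_norm t p) S" and B: "B \<in> norm_closure (bounded_ops t p) (op_norm t p) S"
  have "\<exists>C\<in>S. op_norm t p (A + B - C) < e" if e: "e > 0" for e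
  proof -
    obtain A' where A': "A' \<in> S" "op_norm t p (A - A') < e / 2"
      using norm_closureD[OF A half_gt_zero[OF e]] by blast
    obtain B' where B': "B' \<in> S" "op_norm t p (B - B') < e / 2"
      using norm_closureD[OF B half_gt_zero[OF e]] by blast
    have b: "A \<in> bounded_ops t p" "B \<in> bounded_ops t p" "A' \<in> bounded_ops t p" "B' \<in> bounded_ops t p"
      using A B A' B' S norm_closure_bounded by blast+
    have "A + B - (A' + B') = (A - A') + (B - B')" by simp
    then have "op_norm t p (A + B - (A' + B')) \<le> op_norm t p (A - A') + op_norm t p (B - B')"
      using op_norm_triangle[OF t p bounded_ops_diff[OF t p b(1,3)] bounded_ops_diff[OF t p b(2,4)]] by metis
    then have "op_norm t p (A + B - (A' + B')) < e" using A' B' by linarith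
    then show ?thesis using cop.subspace_add[OF S(2) A'(1) B'(1)] by blast
  qed
  moreover have "A + B \<in> bounded_ops t p"
    using A B norm_closure_bounded by (blast intro: bounded_ops_add[OF t p])
  ultimately show "A + B \<in> norm_closure (bounded_ops t p) (op_norm t p) S"
    by (intro norm_closureI)
next
  fix c A assume A: "A \<in> norm_closure (bounded_ops t p) (op_norm t p) S"
  have Ab: "A \<in> bounded_ops t p" using A norm_closure_bounded by blast
  have "\<exists>C\<in>S. op_norm t p (op_scale c A - C) < e" if e: "e > 0" for e
  proof -
    have "e / (norm c + 1) > 0" using e by (simp add: add_nonneg_pos)
    then obtain A' where A': "A' \<in> S" "op_norm t p (A - A') < e / (norm c + 1)"
      using norm_closureD[OF A] by blast
    have d: "A - A' \<in> bounded_ops t p"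
      using A' S Ab by (blast intro: bounded_ops_diff[OF t p])
    have "op_scale c A - op_scale c A' = op_scale c (A - A')" by (simp add: cop.scale_right_diff_distrib)
    then have "op_norm t p (op_scale c A - op_scale c A') \<le> norm c * op_norm t p (A - A')"
      using op_norm_scale[OF p d] by simp
    also have "\<dots> \<le> (norm c + 1) * op_norm t p (A - A')"
      using op_norm_nonneg[OF p d] by (intro mult_right_mono) auto
    also have "\<dots> < e" using A'(2) by (simp add: pos_less_divide_eq add_nonneg_pos mult.commute)
    finally show ?thesis using cop.subspace_scale[OF S(2) A'(1)] by blast
  qed
  then show "op_scale c A \<in> norm_closure (bounded_ops t p) (op_norm t p) S"
    using bounded_ops_scale[OF p Ab] by (intro norm_closureI)
qed

text \<open>Composition is bilinear and submultiplicative in norm, so membership in a closed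
  subspace spreads from generators to closed spans: linearly in the left factor, linearly in the
  right one, then by limits in each factor in turn.\<close>

lemma op_closure_comp:
  assumes t: "t > 0" and p: "p > 1"
    and S: "S \<subseteq> bounded_ops t p" "S' \<subseteq> bounded_ops t p"
    and C: "norm_closed (bounded_ops t p) (op_norm t p) C" "cop.subspace C"
    and comp: "\<And>A B. A \<in> S \<Longrightarrow> B \<in> S' \<Longrightarrow> A \<circ> B \<in> C"
    and A: "A \<in> norm_closure (bounded_ops t p) (op_norm t p) (cop.span S)"
    and B: "B \<in> norm_closure (bounded_ops t p) (op_norm t p) (cop.span S')"
  shows "A \<circ> B \<in> C"
proof -
  let ?V = "bounded_ops t p"
  have sp: "cop.span S \<subseteq> ?V" "cop.span S' \<subseteq> ?V"
    using cop.span_minimal[OF S(1) bounded_ops_subspace[OF t p]] cop.span_minimal[OF S(2) bounded_ops_subspace[OF t p]] by auto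
  have closedC: "X \<in> C" if "X \<in> ?V" "\<And>e. e > 0 \<Longrightarrow> \<exists>Y\<in>C. op_norm t p (X - Y) < e" for X
    using C(1) norm_closureI[OF that] unfolding norm_closed_def by blast
  have 1: "A \<circ> B \<in> C" if A: "A \<in> cop.span S" and B: "B \<in> S'" for A B
    using A
  proof (induction rule: cop.span_induct_alt)
    case base
    then show ?case unfolding op_comp_left_linear by (rule cop.subspace_0[OF C(2)])
  next
    case (step c x y)
    then show ?case using comp[of x B] B unfolding op_comp_left_linear
      by (intro cop.subspace_add[OF C(2)] cop.subspace_scale[OF C(2)])
  qed
  have 2: "A \<circ> B \<in> C" if A: "A \<in> cop.span S" and B: "B \<in> cop.span S'" for A B
  proof -
    have AV: "A \<in> ?V" using A sp by blast
    \<comment> \<open>The induction carries boundedness of \<open>B\<close> because linearity of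
      composition in the right factor is stated for bounded operators.\<close>
    have "B \<in> ?V \<and> A \<circ> B \<in> C"
      using B
    proof (induction rule: cop.span_induct_alt)
      case base
      have "A \<circ> 0 = 0" using bounded_opsD(6)[OF AV] by (auto simp: fun_eq_iff)
      then show ?case using cop.subspace_0[OF C(2)] bounded_ops_zero[of t p] by metis
    next
      case (step c x y)
      have V: "x \<in> ?V" "y \<in> ?V" using step S by auto
      have "A \<circ> (op_scale c x + y) = op_scale c (A \<circ> x) + (A \<circ> y)"
        using op_comp_right_linear(1)[OF AV bounded_ops_scale[OF p V(1)] V(2)]
          op_comp_right_linear(2)[OF AV V(1) V(1)] by simp
      moreover have "A \<circ> x \<in> C" using 1 A step by blast
      ultimately show ?case using step V
        by (metis cop.subspace_add[OF C(2)] cop.subspace_scale[OF C(2)] bounded_ops_add[OF t p] bounded_ops_scale[OF p])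
    qed
    then show ?thesis ..
  qed
  have 3: "A \<circ> B \<in> C" if A: "A \<in> norm_closure ?V (op_norm t p) (cop.span S)" and B: "B \<in> cop.span S'" for A B
  proof (rule closedC)
    have AV: "A \<in> ?V" and BV: "B \<in> ?V" using A B sp norm_closure_bounded by blast+
    show "A \<circ> B \<in> ?V" by (rule bounded_ops_comp[OF p AV BV])
    fix e :: real assume "e > 0"
    then have "e / (op_norm t p B + 1) > 0" using op_norm_nonneg[OF p BV] by simp
    then obtain A' where A': "A' \<in> cop.span S" "op_norm t p (A - A') < e / (op_norm t p B + 1)"
      using norm_closureD[OF A] by blast
    have d: "A - A' \<in> ?V" using A' sp AV by (blast intro: bounded_ops_diff[OF t p])
    have "op_norm t p ((A \<circ> B) - (A' \<circ> B)) \<le> op_norm t p (A - A') * op_norm t p B"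
      using op_norm_comp[OF p d BV] by (simp add: op_comp_left_linear)
    also have "\<dots> \<le> op_norm t p (A - A') * (op_norm t p B + 1)"
      using op_norm_nonneg[OF p d] by (intro mult_left_mono) auto
    also have "\<dots> < e" using A'(2) op_norm_nonneg[OF p BV] by (simp add: pos_less_divide_eq)
    finally show "\<exists>Y\<in>C. op_norm t p ((A \<circ> B) - Y) < e" using 2[OF A'(1) B] by blast
  qed
  show ?thesis
  proof (rule closedC)
    have AV: "A \<in> ?V" and BV: "B \<in> ?V" using A B norm_closure_bounded by blast+
    show "A \<circ> B \<in> ?V" by (rule bounded_ops_comp[OF p AV BV])
    fix e :: real assume "e > 0"
    then have "e / (op_norm t p A + 1) > 0" using op_norm_nonneg[OF p AV] by simp
    then obtain B' where B': "B' \<in> cop.span S'" "op_norm t p (B - B') < e / (op_norm t p A + 1)"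
      using norm_closureD[OF B] by blast
    have BV': "B' \<in> ?V" and d: "B - B' \<in> ?V" using B' sp BV by (blast intro: bounded_ops_diff[OF t p])+
    have "(A \<circ> B) - (A \<circ> B') = A \<circ> (B - B')"
      unfolding op_diff_conv using op_comp_right_linear(1)[OF AV BV bounded_ops_scale[OF p BV', of "- 1"]]
        op_comp_right_linear(2)[OF AV BV' BV', of "- 1"] by metis
    then have "op_norm t p ((A \<circ> B) - (A \<circ> B')) \<le> op_norm t p A * op_norm t p (B - B')"
      using op_norm_comp[OF p AV d] by simp
    also have "\<dots> \<le> (op_norm t p A + 1) * op_norm t p (B - B')"
      using op_norm_nonneg[OF p d] by (intro mult_right_mono) auto
    also have "\<dots> < e" using B'(2) op_norm_nonneg[OF p AV] by (simp add: pos_less_divide_eq mult.commute)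
    finally show "\<exists>Y\<in>C. op_norm t p ((A \<circ> B) - Y) < e" using 3[OF A B'(1)] by blast
  qed
qed

section \<open>Toeplitz operators are bounded\<close>

definition fock_exp :: "real \<Rightarrow> complex ^ 'n::finite \<Rightarrow> complex ^ 'n \<Rightarrow> complex" where
  "fock_exp t z x = exp (hdot (z - x) x / of_real t)"

lemma fock_exp_split:
  assumes "t > 0"
  shows "exp (hdot z w / of_real t) * of_real (exp (- (norm w)\<^sup>2 / t)) = fock_exp t z w"
proof -
  have "complex_of_real (exp (- (norm w)\<^sup>2 / t)) = exp (- hdot w w / of_real t)"
    by (simp add: hdot_self flip: exp_of_real)
  then have "exp (hdot z w / of_real t) * of_real (exp (- (norm w)\<^sup>2 / t)) = exp (hdot z w / of_real t + - hdot w w / of_real t)"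
    by (simp only: exp_add)
  also have "hdot z w / of_real t + - hdot w w / of_real t = hdot (z - w) w / of_real t"
    by (simp add: hdot_simps diff_divide_distrib)
  finally show ?thesis by (simp only: fock_exp_def)
qed

text \<open>Polarisation: \<open>2 * Re (hdot z x)\<close> equals
  \<open>(norm z)^2 + (norm x)^2 - (norm (z - x))^2\<close>. The first two factors are the weights
  of output and input, and the third is a convolution kernel.\<close>

lemma norm_fock_exp:
  assumes "t > 0"
  shows "norm (fock_exp t z x) = exp ((norm z)\<^sup>2 / (2 * t)) * exp (- (norm x)\<^sup>2 / (2 * t)) * exp (- (norm (z - x))\<^sup>2 / (2 * t))"
proof -
  have "Re (hdot (z - x) x / of_real t) = (Re (hdot z x) - (norm x)\<^sup>2) / t"
    by (simp add: hdot_simps hdot_self Re_divide_of_real del: of_real_power)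
  also have "\<dots> = (norm z)\<^sup>2 / (2 * t) + - (norm x)\<^sup>2 / (2 * t) + - (norm (z - x))\<^sup>2 / (2 * t)"
    using assms by (simp add: norm_diff_square field_simps)
  finally show ?thesis unfolding fock_exp_def norm_exp_eq_Re by (simp only: exp_add)
qed

lemma continuous_on_fock_exp [continuous_intros]:
  "t > 0 \<Longrightarrow> continuous_on S f \<Longrightarrow> continuous_on S g \<Longrightarrow> continuous_on S (\<lambda>x. fock_exp t (f x) (g x))"
  unfolding fock_exp_def by (intro continuous_intros) auto

lemma norm_mult_fock_exp:
  assumes "t > 0"
  shows "norm (f x * fock_exp t z x) = exp ((norm z)\<^sup>2 / (2 * t)) * (exp (- (norm (z - x))\<^sup>2 / (2 * t)) * gauss_weighted t f x)"
  by (simp add: norm_mult norm_fock_exp[OF assms] gauss_weighted_def)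

lemma BUC_continuous: "\<phi> \<in> BUC \<Longrightarrow> continuous_on S \<phi>"
  unfolding BUC_def by (auto intro: uniformly_continuous_imp_continuous continuous_on_subset)

lemma BUC_bounded: assumes "\<phi> \<in> BUC" obtains C where "0 \<le> C" "\<And>x. norm (\<phi> x) \<le> C"
  using assms unfolding BUC_def bounded_iff by (auto intro: order_trans[OF norm_ge_zero])

lemma fock_gauss_integrable:
  fixes f :: "complex ^ 'n::finite \<Rightarrow> complex"
  assumes t: "t > 0" and p: "p > 1" and f: "f \<in> fock t p" and d: "d > 0"
  shows "integrable lborel (\<lambda>w. exp (A * norm (z - w) - d * (norm (z - w))\<^sup>2) * gauss_weighted t f w)"
  by (rule convolution_integrable[OF p integrable_exp_linear_gauss[OF d] _ exp_linear_gauss_le[OF d]])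
    (use f in \<open>auto simp: fock_iff[OF t p] gauss_weighted_borel gauss_weighted_nonneg\<close>)

lemma fock_exp_integrable:
  assumes t: "t > 0" and p: "p > 1" and f: "f \<in> fock t p"
  shows "integrable lborel (\<lambda>w. f w * fock_exp t z w)"
proof (rule Bochner_Integration.integrable_bound[OF _ _ AE_I2])
  show "integrable lborel (\<lambda>w. exp ((norm z)\<^sup>2 / (2 * t)) * (exp (0 * norm (z - w) - 1 / (2 * t) * (norm (z - w))\<^sup>2) * gauss_weighted t f w))"
    using t by (intro integrable_mult_right fock_gauss_integrable[OF t p f]) simp
  show "(\<lambda>w. f w * fock_exp t z w) \<in> borel_measurable lborel"
    using t by (auto intro!: borel_measurable_continuous_onI continuous_intros entire_continuous_on[OF fock_entire[OF f]])
  show "norm (f w * fock_exp t z w) \<le> norm (exp ((norm z)\<^sup>2 / (2 * t)) * (exp (0 * norm (z - w) - 1 / (2 * t) * (norm (z - w))\<^sup>2) * gauss_weighted t f w))" for w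
    by (simp add: norm_mult_fock_exp[OF t] abs_mult gauss_weighted_nonneg)
qed

lemma toeplitz_integrable:
  assumes t: "t > 0" and p: "p > 1" and f: "f \<in> fock t p" and \<phi>: "\<phi> \<in> BUC"
  shows "integrable lborel (\<lambda>w. \<phi> w * f w * fock_exp t z w)"
proof -
  obtain C where C: "0 \<le> C" "\<And>x. norm (\<phi> x) \<le> C" using BUC_bounded[OF \<phi>] by metis
  show ?thesis
  proof (rule Bochner_Integration.integrable_bound[OF integrable_mult_right[OF integrable_norm[OF fock_exp_integrable[OF t p f, of z]], of C] _ AE_I2])
    show "(\<lambda>w. \<phi> w * f w * fock_exp t z w) \<in> borel_measurable lborel"
      using t by (auto intro!: borel_measurable_continuous_onI continuous_intros entire_continuous_on[OF fock_entire[OF f]] BUC_continuous[OF \<phi>])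
    show "norm (\<phi> w * f w * fock_exp t z w) \<le> norm (C * norm (f w * fock_exp t z w))" for w
      using C mult_right_mono[OF C(2)[of w], of "norm (f w * fock_exp t z w)"] by (simp add: norm_mult mult.assoc)
  qed
qed

lemma toeplitz_eq:
  fixes f :: "complex ^ 'n::finite \<Rightarrow> complex"
  assumes t: "t > 0" and f: "f \<in> fock t p" and \<phi>: "\<phi> \<in> BUC"
  shows "toeplitz t p \<phi> f z = of_real (1 / (pi * t) ^ CARD('n)) * (LINT w|lborel. \<phi> w * f w * fock_exp t z w)"
proof -
  have k: "cnj (fock_kernel t z w) = exp (hdot z w / of_real t)" for w
    unfolding fock_kernel_def by (simp add: exp_cnj hdot_def mult.commute)
  have cont: "continuous_on UNIV (\<lambda>w. \<phi> w * f w * exp (hdot z w / of_real t))"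
    by (intro continuous_intros BUC_continuous[OF \<phi>] entire_continuous_on fock_entire[OF f]) (use t in auto)
  note e = fock_exp_split[OF t, of z]
  have "toeplitz t p \<phi> f z = (LINT w|gauss_measure t. \<phi> w * f w * exp (hdot z w / of_real t))"
    using f by (simp add: toeplitz_def k)
  also have "\<dots> = (LINT w|lborel. (exp (- (norm w)\<^sup>2 / t) / (pi * t) ^ CARD('n)) *\<^sub>R (\<phi> w * f w * exp (hdot z w / of_real t)))"
    unfolding gauss_measure_def
  proof (rule integral_density)
    show "(\<lambda>w. \<phi> w * f w * exp (hdot z w / of_real t)) \<in> borel_measurable lborel"
      using cont by (simp add: borel_measurable_continuous_onI)
    show "AE w in lborel. 0 \<le> exp (- (norm (w :: complex ^ 'n))\<^sup>2 / t) / (pi * t) ^ CARD('n)"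
      using t by simp
  qed measurable
  also have "\<dots> = (LINT w|lborel. of_real (1 / (pi * t) ^ CARD('n)) * (\<phi> w * f w * fock_exp t z w))"
    unfolding e[symmetric] by (intro Bochner_Integration.integral_cong refl) (simp add: scaleR_conv_of_real)
  finally show ?thesis by (simp add: integral_mult_right_zero)
qed

lemma square_le_exp: "(x::real)\<^sup>2 \<le> 2 * exp x" if "x \<ge> 0"
  using exp_lower_Taylor_quadratic[OF that] that by simp

text \<open>Differentiation under the integral, with the second-order Taylor remainder of the
  exponential bounded explicitly. The exponential moments of \<open>a\<close> make both the
  derivative and the remainder converge.\<close>

lemma entire_integral_exp:
  fixes a :: "complex ^ 'n::finite \<Rightarrow> complex"
  assumes t: "t > 0" and a: "a \<in> borel_measurable borel"
    and i: "\<And>A. integrable lborel (\<lambda>w. norm (a w) * exp (A * norm w))"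
  shows "entire (\<lambda>z. LINT w|lborel. a w * exp (hdot z w / of_real t))"
  unfolding entire_def
proof
  fix z :: "complex ^ 'n"
  let ?E = "\<lambda>z w. exp (hdot z w / of_real t)"
  let ?F = "\<lambda>z. LINT w|lborel. a w * ?E z w"
  have hd: "norm (hdot h w / of_real t) \<le> norm h * (norm w / t)" for h w :: "complex ^ 'n"
    using norm_hdot_le[of h w] t by (simp add: norm_divide divide_right_mono)
  have nE: "norm (?E z w) \<le> exp (norm z / t * norm w)" for z w :: "complex ^ 'n"
  proof -
    have "norm (?E z w) \<le> exp (norm (hdot z w / of_real t))" by (rule norm_exp)
    also have "\<dots> \<le> exp (norm z / t * norm w)" using hd[of z w] by simp
    finally show ?thesis .
  qed
  have [measurable]: "(\<lambda>w. ?E z w) \<in> borel_measurable borel" "(\<lambda>w. hdot z w) \<in> borel_measurable borel" for z :: "complex ^ 'n"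
    using t by (auto intro!: borel_measurable_continuous_onI continuous_intros)
  have iE: "integrable lborel (\<lambda>w. a w * ?E z w)" for z
    by (rule Bochner_Integration.integrable_bound[OF i[of "norm z / t"] _ AE_I2])
      (use a nE mult_left_mono[OF nE norm_ge_zero] in \<open>auto simp: norm_mult\<close>)
  have nh: "norm (a w * ?E z w * (hdot h w / of_real t)) \<le> norm h * (norm (a w) * exp ((norm z + 1) / t * norm w))" for h w
  proof -
    have "norm w / t \<le> exp (norm w / t)" using exp_ge_add_one_self[of "norm w / t"] by linarith
    then have "norm (hdot h w / of_real t) \<le> norm h * exp (norm w / t)"
      using order_trans[OF hd mult_left_mono[OF _ norm_ge_zero]] by blast
    then have "norm (a w) * norm (?E z w) * norm (hdot h w / of_real t) \<le> norm (a w) * exp (norm z / t * norm w) * (norm h * exp (norm w / t))"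
      by (intro mult_mono nE) auto
    also have "\<dots> = norm h * (norm (a w) * (exp (norm z / t * norm w) * exp (norm w / t)))" by simp
    also have "exp (norm z / t * norm w) * exp (norm w / t) = exp ((norm z + 1) / t * norm w)"
      by (simp add: add_divide_distrib distrib_right flip: exp_add)
    finally show ?thesis by (simp only: norm_mult)
  qed
  have ih: "integrable lborel (\<lambda>w. a w * ?E z w * (hdot h w / of_real t))" for h
    by (rule Bochner_Integration.integrable_bound[OF integrable_mult_right[OF i[of "(norm z + 1) / t"], of "norm h"] _ AE_I2])
      (use a nh[of _ h] in auto)
  define D where "D h = (LINT w|lborel. a w * ?E z w * (hdot h w / of_real t))" for h
  have Dc: "D (c *s v) = c * D v" for c v
    unfolding D_def by (subst integral_mult_right_zero[symmetric]) (simp add: hdot_simps mult_ac)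
  have D: "bounded_linear D"
  proof (rule bounded_linear_intro)
    show "D (x + y) = D x + D y" for x y
      unfolding D_def by (subst Bochner_Integration.integral_add[symmetric, OF ih ih]) (simp add: hdot_simps add_divide_distrib distrib_left)
    show "D (r *\<^sub>R x) = r *\<^sub>R D x" for r x
      unfolding D_def by (subst integral_scaleR_right[symmetric]) (simp add: hdot_simps scaleR_conv_of_real[where 'a=complex] mult_ac)
    show "norm (D h) \<le> norm h * (LINT w|lborel. norm (a w) * exp ((norm z + 1) / t * norm w))" for h
      unfolding D_def integral_mult_right_zero[symmetric]
      by (rule Bochner_Integration.integral_norm_bound_integral[OF ih integrable_mult_right[OF i] nh])
  qed
  \<comment> \<open>The remainder contributes two extra factors \<open>exp (norm w / t)\<close>: one
    from Taylor's bound for \<open>norm (y - z) < 1\<close>, the other from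
    \<open>square_le_exp\<close>, which also gives the 2 in front.\<close>
  define K where "K = 2 * (LINT w|lborel. norm (a w) * exp ((norm z + 2) / t * norm w))"
  have rem: "norm (?F y - ?F z - D (y - z)) \<le> (norm (y - z))\<^sup>2 * K" if y: "norm (y - z) < 1" for y
  proof -
    let ?h = "y - z"
    let ?r = "\<lambda>w. exp (hdot ?h w / of_real t) - 1 - hdot ?h w / of_real t"
    have eq: "a w * ?E y w - a w * ?E z w - a w * ?E z w * (hdot ?h w / of_real t) = a w * ?E z w * ?r w" for w
    proof -
      have "?E y w = ?E z w * ?E ?h w" by (simp add: hdot_simps diff_divide_distrib flip: exp_add)
      then show ?thesis by (simp add: algebra_simps)
    qed
    have rb: "norm (?r w) \<le> (norm ?h)\<^sup>2 * (2 * exp (2 / t * norm w))" for w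
    proof -
      let ?b = "hdot ?h w / of_real t"
      have "norm (exp ?b - (\<Sum>i\<le>1. ?b ^ i / fact i)) \<le> exp \<bar>Re ?b\<bar> * norm ?b ^ Suc 1 / fact 1"
        by (rule Taylor_exp)
      then have "norm (?r w) \<le> exp \<bar>Re ?b\<bar> * (norm ?b)\<^sup>2" by (simp add: algebra_simps power2_eq_square)
      also have "\<dots> \<le> exp (norm w / t) * (norm ?h * (norm w / t))\<^sup>2"
      proof (intro mult_mono power_mono hd)
        have "norm ?h * (norm w / t) \<le> 1 * (norm w / t)" using y t by (intro mult_right_mono) auto
        then show "exp \<bar>Re ?b\<bar> \<le> exp (norm w / t)"
          using abs_Re_le_cmod[of ?b] hd[of ?h w] by simp
      qed auto
      also have "\<dots> \<le> exp (norm w / t) * ((norm ?h)\<^sup>2 * (2 * exp (norm w / t)))"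
        unfolding power_mult_distrib using t by (intro mult_left_mono square_le_exp) auto
      also have "\<dots> = (norm ?h)\<^sup>2 * (2 * exp (2 / t * norm w))" by (simp flip: exp_add)
      finally show ?thesis .
    qed
    have nb: "norm (a w * ?E z w * ?r w) \<le> (norm ?h)\<^sup>2 * (2 * (norm (a w) * exp ((norm z + 2) / t * norm w)))" for w
    proof -
      have "norm (a w) * norm (?E z w) * norm (?r w) \<le> norm (a w) * exp (norm z / t * norm w) * ((norm ?h)\<^sup>2 * (2 * exp (2 / t * norm w)))"
        by (intro mult_mono nE rb) auto
      also have "\<dots> = (norm ?h)\<^sup>2 * (2 * (norm (a w) * (exp (norm z / t * norm w) * exp (2 / t * norm w))))" by simp
      also have "exp (norm z / t * norm w) * exp (2 / t * norm w) = exp ((norm z + 2) / t * norm w)"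
        by (simp add: add_divide_distrib distrib_right flip: exp_add)
      finally show ?thesis by (simp only: norm_mult)
    qed
    have "?F y - ?F z - D ?h = (LINT w|lborel. a w * ?E y w - a w * ?E z w - a w * ?E z w * (hdot ?h w / of_real t))"
      unfolding D_def using iE ih by simp
    also have "\<dots> = (LINT w|lborel. a w * ?E z w * ?r w)" by (simp only: eq)
    also have "norm \<dots> \<le> (LINT w|lborel. (norm ?h)\<^sup>2 * (2 * (norm (a w) * exp ((norm z + 2) / t * norm w))))"
    proof (rule Bochner_Integration.integral_norm_bound_integral[OF _ _ nb])
      show "integrable lborel (\<lambda>w. a w * ?E z w * ?r w)"
        unfolding eq[symmetric] using iE ih by (intro Bochner_Integration.integrable_diff)
    qed (intro integrable_mult_right i)
    finally show ?thesis by (simp add: K_def)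
  qed
  have "(?F has_derivative D) (at z)"
  proof (rule has_derivativeI_sandwich[of 1 _ _ _ _ "\<lambda>y. norm (y - z) * K"])
    show "norm (?F y - ?F z - D (y - z)) / norm (y - z) \<le> norm (y - z) * K" if "y \<noteq> z" "dist y z < 1" for y
      using rem[of y] that by (simp add: dist_norm pos_divide_le_eq power2_eq_square mult_ac)
    show "((\<lambda>y. norm (y - z) * K) \<longlongrightarrow> 0) (at z)"
      by (auto intro!: tendsto_eq_intros)
  qed (use D in auto)
  then show "\<exists>D. (?F has_derivative D) (at z) \<and> (\<forall>c v. D (c *s v) = c * D v)" using Dc by blast
qed

text \<open>Dividing by the growth factor in \<open>z\<close> leaves
  \<open>gauss_weighted t g\<close> dominated by a convolution, and \<open>fock_const\<close>
  cancels. Every operator estimate below thus reduces to the \<open>L^1\<close> norm of a kernel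
  \<open>H\<close>.\<close>

lemma
  fixes f g :: "complex ^ 'n::finite \<Rightarrow> complex"
  assumes t: "t > 0" and p: "p > 1" and f: "f \<in> fock t p" and g: "entire g"
    and H: "integrable lborel H" "\<And>y. 0 \<le> H y" "\<And>y. H y \<le> B"
    and le: "\<And>z. norm (g z) \<le> exp ((norm z)\<^sup>2 / (2 * t)) * (LINT w|lborel. H (z - w) * gauss_weighted t f w)"
  shows fock_kernel_mem: "g \<in> fock t p"
    and fock_kernel_norm_le: "fock_norm t p g \<le> integral\<^sup>L lborel H * fock_norm t p f"
proof -
  have le': "gauss_weighted t g z \<le> (LINT w|lborel. H (z - w) * gauss_weighted t f w)" for z
    using mult_right_mono[OF le[of z], of "exp (- (norm z)\<^sup>2 / (2 * t))"] 
    by (simp add: gauss_weighted_def exp_minus field_simps)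
  have fi: "gauss_weighted t f \<in> borel_measurable borel" "integrable lborel (\<lambda>x. gauss_weighted t f x powr p)"
    using f by (auto simp: fock_iff[OF t p] gauss_weighted_borel)
  note Y = p H fi(1) gauss_weighted_nonneg fi(2) gauss_weighted_borel[OF g] gauss_weighted_nonneg le'
  show "g \<in> fock t p"
    using Young_convolution_integrable[OF Y] g by (simp add: fock_iff[OF t p])
  have "fock_const t p TYPE('n) * (LINT z|lborel. gauss_weighted t g z powr p) powr (1/p)
     \<le> fock_const t p TYPE('n) * (integral\<^sup>L lborel H * (LINT z|lborel. gauss_weighted t f z powr p) powr (1/p))"
    using Young_convolution_le[OF Y] fock_const_pos[OF t p, where 'n='n] by (intro mult_left_mono) auto
  then show "fock_norm t p g \<le> integral\<^sup>L lborel H * fock_norm t p f"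
    by (simp add: fock_norm_eq[OF t p g] fock_norm_eq[OF t p fock_entire[OF f]] mult.left_commute)
qed

lemma toeplitz_bounded:
  fixes \<phi> :: "complex ^ 'n::finite \<Rightarrow> complex"
  assumes t: "t > 0" and p: "p > 1" and \<phi>: "\<phi> \<in> BUC"
  shows "toeplitz t p \<phi> \<in> bounded_ops t p"
proof -
  let ?c = "1 / (pi * t) ^ CARD('n)"
  let ?e = "\<lambda>A (z :: complex ^ 'n) w. exp (A * norm (z - w) - 1 / (2 * t) * (norm (z - w))\<^sup>2)"
  have c: "?c > 0" using t by simp
  obtain C where C: "0 \<le> C" "\<And>x. norm (\<phi> x) \<le> C" using BUC_bounded[OF \<phi>] by metis
  define H where "H y = ?c * C * exp (- (1 / (2 * t)) * (norm (y :: complex ^ 'n))\<^sup>2)" for y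
  have iH: "integrable lborel H"
    unfolding H_def using t by (intro integrable_mult_right integrable_exp_neg_norm_square) simp
  have H0: "0 \<le> H y" "H y \<le> ?c * C" for y
    using t C c mult_left_mono[of "exp (- (1 / (2 * t)) * (norm y)\<^sup>2)" 1 "?c * C"] by (auto simp: H_def simp del: times_divide_eq_left)
  have ent: "entire (toeplitz t p \<phi> f)" if f: "f \<in> fock t p" for f
  proof -
    let ?a = "\<lambda>w. \<phi> w * f w * of_real (exp (- (norm w)\<^sup>2 / t))"
    have "entire (\<lambda>z. LINT w|lborel. ?a w * exp (hdot z w / of_real t))"
    proof (rule entire_integral_exp[OF t])
      have m: "?a \<in> borel_measurable borel"
        by (intro borel_measurable_continuous_onI continuous_intros BUC_continuous[OF \<phi>] entire_continuous_on fock_entire[OF f]) (use t in auto)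
      then show "?a \<in> borel_measurable borel" .
      fix A
      show "integrable lborel (\<lambda>w. norm (?a w) * exp (A * norm w))"
      proof (rule Bochner_Integration.integrable_bound[OF _ _ AE_I2])
        show "integrable lborel (\<lambda>w. C * (?e A 0 w * gauss_weighted t f w))"
          using t by (intro integrable_mult_right fock_gauss_integrable[OF t p f]) simp
        show "(\<lambda>w. norm (?a w) * exp (A * norm w)) \<in> borel_measurable lborel" using m by measurable
        have B: "norm (?a w) * exp (A * norm w) \<le> C * (?e A 0 w * gauss_weighted t f w)" for w
        proof -
          \<comment> \<open>Half of the Gaussian exponent goes to \<open>gauss_weighted t f\<close>,
            the other half beats the exponential moment.\<close>
          have "exp (- (norm w)\<^sup>2 / t) * exp (A * norm w) = ?e A 0 w * exp (- (norm w)\<^sup>2 / (2 * t))"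
            by (simp add: field_simps flip: exp_add)
          then have "norm (?a w) * exp (A * norm w) = norm (\<phi> w) * (?e A 0 w * gauss_weighted t f w)"
            by (simp add: norm_mult gauss_weighted_def mult_ac)
          also have "\<dots> \<le> C * (?e A 0 w * gauss_weighted t f w)"
            by (intro mult_right_mono C) (simp add: gauss_weighted_nonneg)
          finally show ?thesis .
        qed
        show "norm (norm (?a w) * exp (A * norm w)) \<le> norm (C * (?e A 0 w * gauss_weighted t f w))" for w
          unfolding real_norm_def by (subst abs_of_nonneg) (simp, rule order_trans[OF B abs_ge_self])
      qed
    qed
    moreover have "?a w * exp (hdot z w / of_real t) = \<phi> w * f w * fock_exp t z w" for z w
      using fock_exp_split[OF t, of z w] by (simp add: mult_ac)
    ultimately have "entire (\<lambda>z. of_real ?c * (LINT w|lborel. \<phi> w * f w * fock_exp t z w))"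
      by (intro entire_mult entire_const) (simp only:)
    then show ?thesis unfolding toeplitz_eq[OF t f \<phi>, symmetric] .
  qed
  have le: "norm (toeplitz t p \<phi> f z) \<le> exp ((norm z)\<^sup>2 / (2 * t)) * (LINT w|lborel. H (z - w) * gauss_weighted t f w)"
    if f: "f \<in> fock t p" for f z
  proof -
    have i: "integrable lborel (\<lambda>w. ?e 0 z w * gauss_weighted t f w)"
      by (rule fock_gauss_integrable[OF t p f]) (use t in simp)
    have "norm (LINT w|lborel. \<phi> w * f w * fock_exp t z w) \<le>
        (LINT w|lborel. C * exp ((norm z)\<^sup>2 / (2 * t)) * (?e 0 z w * gauss_weighted t f w))"
    proof (rule Bochner_Integration.integral_norm_bound_integral[OF toeplitz_integrable[OF t p f \<phi>] integrable_mult_right[OF i]])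
      fix w
      have "norm (\<phi> w * f w * fock_exp t z w) = norm (\<phi> w) * norm (f w * fock_exp t z w)" by (simp add: norm_mult)
      also have "\<dots> \<le> C * norm (f w * fock_exp t z w)" by (intro mult_right_mono C) auto
      finally show "norm (\<phi> w * f w * fock_exp t z w) \<le> C * exp ((norm z)\<^sup>2 / (2 * t)) * (?e 0 z w * gauss_weighted t f w)"
        by (simp add: norm_mult_fock_exp[OF t] mult.assoc)
    qed
    then have "norm (toeplitz t p \<phi> f z) \<le> ?c * (LINT w|lborel. C * exp ((norm z)\<^sup>2 / (2 * t)) * (?e 0 z w * gauss_weighted t f w))"
      using c unfolding toeplitz_eq[OF t f \<phi>] norm_mult norm_of_real by (intro mult_mono) auto
    also have "\<dots> = exp ((norm z)\<^sup>2 / (2 * t)) * (LINT w|lborel. H (z - w) * gauss_weighted t f w)"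
      unfolding integral_mult_right_zero[symmetric] by (simp add: H_def mult_ac)
    finally show ?thesis .
  qed
  show ?thesis
  proof (rule bounded_opsI[where C="integral\<^sup>L lborel H"])
    fix f g :: "complex ^ 'n \<Rightarrow> complex" and c assume f: "f \<in> fock t p"
    show "toeplitz t p \<phi> f \<in> fock t p" by (rule fock_kernel_mem[OF t p f ent[OF f] iH H0 le[OF f]])
    show "fock_norm t p (toeplitz t p \<phi> f) \<le> integral\<^sup>L lborel H * fock_norm t p f"
      by (rule fock_kernel_norm_le[OF t p f ent[OF f] iH H0 le[OF f]])
    show "toeplitz t p \<phi> (fun_scale c f) = fun_scale c (toeplitz t p \<phi> f)"
    proof
      fix z
      have "(LINT w|lborel. \<phi> w * fun_scale c f w * fock_exp t z w) = (LINT w|lborel. c * (\<phi> w * f w * fock_exp t z w))"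
        by (simp add: fun_scale_def mult_ac)
      also have "\<dots> = c * (LINT w|lborel. \<phi> w * f w * fock_exp t z w)" by (rule integral_mult_right_zero)
      finally show "toeplitz t p \<phi> (fun_scale c f) z = fun_scale c (toeplitz t p \<phi> f) z"
        unfolding toeplitz_eq[OF t fock_scale[OF f] \<phi>] by (simp add: fun_scale_def toeplitz_eq[OF t f \<phi>])
    qed
    assume g: "g \<in> fock t p"
    show "toeplitz t p \<phi> (f + g) = toeplitz t p \<phi> f + toeplitz t p \<phi> g"
    proof
      fix z
      have "(LINT w|lborel. \<phi> w * (f + g) w * fock_exp t z w) = (LINT w|lborel. \<phi> w * f w * fock_exp t z w + \<phi> w * g w * fock_exp t z w)"
        by (simp add: algebra_simps)
      also have "\<dots> = (LINT w|lborel. \<phi> w * f w * fock_exp t z w) + (LINT w|lborel. \<phi> w * g w * fock_exp t z w)"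
        by (intro Bochner_Integration.integral_add toeplitz_integrable[OF t p] f g \<phi>)
      finally show "toeplitz t p \<phi> (f + g) z = (toeplitz t p \<phi> f + toeplitz t p \<phi> g) z"
        unfolding toeplitz_eq[OF t fock_add[OF t p f g] \<phi>]
        by (simp only: plus_fun_apply toeplitz_eq[OF t f \<phi>] toeplitz_eq[OF t g \<phi>] distrib_left)
    qed
  next
    show "toeplitz t p \<phi> f = 0" if "f \<notin> fock t p" for f using that by (simp add: toeplitz_def)
  qed
qed

section \<open>Integrals in closed spaces of symbols\<close>

text \<open>Closedness is relative to \<open>BUC\<close>, so the limit must first be placed there,
  by the usual three-term estimate. The final approximation uses \<open>e / 2\<close> because a
  supremum keeps only the weak inequality.\<close>

lemma uniform_limit_mem:
  fixes K :: "(complex ^ 'n::finite \<Rightarrow> complex) set"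
  assumes K: "norm_closed BUC sup_norm K"
    and ap: "\<And>e. e > 0 \<Longrightarrow> \<exists>f\<in>K. \<forall>x. norm (\<Phi> x - f x) \<le> e"
  shows "\<Phi> \<in> K"
proof -
  have KB: "K \<subseteq> BUC" using K by (simp add: norm_closed_def)
  have "\<Phi> \<in> BUC"
  proof -
    obtain f where f: "f \<in> K" "\<And>x. norm (\<Phi> x - f x) \<le> 1" using ap[of 1] by auto
    obtain C where C: "\<And>x. norm (f x) \<le> C" using BUC_bounded[of f] KB f(1) by blast
    have "norm (\<Phi> x) \<le> C + 1" for x
      using norm_triangle_ineq2[of "\<Phi> x" "f x"] f(2)[of x] C[of x] by linarith
    then have "bounded (range \<Phi>)" by (auto simp: bounded_iff)
    moreover have "uniformly_continuous_on UNIV \<Phi>"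
      unfolding uniformly_continuous_on_def
    proof (intro allI impI)
      fix e :: real assume e: "e > 0"
      obtain f where f: "f \<in> K" "\<And>x. norm (\<Phi> x - f x) \<le> e / 3" using ap[of "e / 3"] e by auto
      have "uniformly_continuous_on UNIV f" using KB f(1) by (auto simp: BUC_def)
      then obtain d where d: "d > 0" "\<And>x y. dist y x < d \<Longrightarrow> dist (f y) (f x) < e / 3"
        unfolding uniformly_continuous_on_def using e by (metis UNIV_I divide_pos_pos zero_less_numeral)
      have "dist (\<Phi> y) (\<Phi> x) < e" if "dist y x < d" for x y
      proof -
        have "\<Phi> y - \<Phi> x = (\<Phi> y - f y) + (f y - f x) - (\<Phi> x - f x)" by simp
        then have "norm (\<Phi> y - \<Phi> x) \<le> norm (\<Phi> y - f y) + norm (f y - f x) + norm (\<Phi> x - f x)"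
          using norm_triangle_ineq4[of "(\<Phi> y - f y) + (f y - f x)" "\<Phi> x - f x"]
            norm_triangle_ineq[of "\<Phi> y - f y" "f y - f x"] by simp
        then show ?thesis using f(2)[of y] f(2)[of x] d(2)[OF that] by (simp add: dist_norm)
      qed
      then show "\<exists>d>0. \<forall>x\<in>UNIV. \<forall>x'\<in>UNIV. dist x' x < d \<longrightarrow> dist (\<Phi> x') (\<Phi> x) < e" using d(1) by blast
    qed
    ultimately show ?thesis by (simp add: BUC_def)
  qed
  moreover have "\<exists>f\<in>K. sup_norm (\<Phi> - f) < e" if e: "e > 0" for e
  proof -
    obtain f where f: "f \<in> K" "\<And>x. norm (\<Phi> x - f x) \<le> e / 2" using ap[of "e / 2"] e by auto
    have "sup_norm (\<Phi> - f) \<le> e / 2" unfolding sup_norm_def by (rule cSUP_least) (use f(2) in auto)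
    then show ?thesis using f(1) e by force
  qed
  ultimately show ?thesis using K norm_closureI[of \<Phi> BUC K sup_norm] unfolding norm_closed_def by blast
qed

text \<open>A vector-valued integral obtained by hand. Parameter space is cut into countably many
  cells on which \<open>G\<close> is nearly constant uniformly in \<open>x\<close>; finitely many
  cells carry almost all the mass of \<open>k\<close>, and replacing \<open>G\<close> by its value
  at a sample point on each gives a finite linear combination of members of
  \<open>K\<close>.\<close>

lemma integral_mem_closed_subspace:
  fixes K :: "(complex ^ 'n::finite \<Rightarrow> complex) set" and G :: "'a::euclidean_space \<Rightarrow> complex ^ 'n \<Rightarrow> complex"
  assumes K: "norm_closed BUC sup_norm K" "cfun.subspace K"
    and k: "integrable lborel k" and GK: "\<And>q. G q \<in> K" and C: "\<And>q x. norm (G q x) \<le> C"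
    and cont: "\<And>e. e > 0 \<Longrightarrow> \<exists>d>0. \<forall>q q' x. dist q q' < d \<longrightarrow> norm (G q x - G q' x) \<le> e"
  shows "(\<lambda>x. LINT q|lborel. k q * G q x) \<in> K"
proof (rule uniform_limit_mem[OF K(1)])
  fix e :: real assume e: "e > 0"
  have C0: "C \<ge> 0" using C[of undefined undefined] norm_ge_zero order_trans by blast
  have [measurable]: "k \<in> borel_measurable borel" using k by auto
  have [measurable]: "(\<lambda>q. G q x) \<in> borel_measurable borel" for x
  proof (rule borel_measurable_continuous_onI, unfold continuous_on_iff, intro ballI allI impI)
    fix q :: 'a and e :: real assume "e > 0"
    then obtain d where d: "d > 0" "\<And>q q' x. dist q q' < d \<Longrightarrow> norm (G q x - G q' x) \<le> e / 2"
      using cont[of "e / 2"] by auto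
    have "dist (G q' x) (G q x) < e" if "dist q' q < d" for q'
      using d(2)[OF that, of x] \<open>e > 0\<close> by (simp add: dist_norm)
    then show "\<exists>d>0. \<forall>q'\<in>UNIV. dist q' q < d \<longrightarrow> dist (G q' x) (G q x) < e"
      using d(1) by blast
  qed
  define M where "M = (LINT q|lborel. norm (k q))"
  have M0: "M \<ge> 0" by (simp add: M_def)
  \<comment> \<open>Each of two errors gets \<open>e / 2\<close>: variation within cells costs at
    most \<open>r * M\<close>, and the mass outside the first \<open>N\<close> cells costs at most
    \<open>C * T N\<close>. The added 1 guards against \<open>M = 0\<close>.\<close>
  define r where "r = e / (2 * (M + 1))"
  have r: "r > 0" using e M0 by (simp add: r_def)
  obtain d where d: "d > 0" "\<And>q q' x. dist q q' < d \<Longrightarrow> norm (G q x - G q' x) \<le> r" using cont[OF r] by blast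
  obtain D :: "'a set" where D: "countable D" "\<And>X. open X \<Longrightarrow> X \<noteq> {} \<Longrightarrow> \<exists>y\<in>D. y \<in> X"
    using countable_dense_exists by blast
  have "D \<noteq> {}" using D(2)[of UNIV] by auto
  define a where "a = from_nat_into D"
  have cov: "\<exists>i. dist q (a i) < d" for q
  proof -
    obtain y where "y \<in> D" "y \<in> ball q d" using D(2)[of "ball q d"] d(1) by auto
    moreover obtain n where "from_nat_into D n = y" using from_nat_into_surj[OF D(1) \<open>y \<in> D\<close>] by blast
    ultimately show ?thesis unfolding a_def by (intro exI[of _ n]) simp
  qed
  \<comment> \<open>Taking the first ball that contains \<open>q\<close> makes the countable cover
    disjoint.\<close>
  define idx where "idx q = (LEAST i. dist q (a i) < d)" for q
  have idx: "dist q (a (idx q)) < d" for q unfolding idx_def using cov by (rule LeastI_ex)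
  have idx_eq: "{q. idx q = i} = ball (a i) d - (\<Union>j<i. ball (a j) d)" for i
  proof -
    have "idx q = i \<longleftrightarrow> dist q (a i) < d \<and> (\<forall>j<i. \<not> dist q (a j) < d)" for q
    proof
      assume "idx q = i" then show "dist q (a i) < d \<and> (\<forall>j<i. \<not> dist q (a j) < d)"
        using idx[of q] not_less_Least unfolding idx_def by blast
    next
      assume "dist q (a i) < d \<and> (\<forall>j<i. \<not> dist q (a j) < d)"
      then show "idx q = i" unfolding idx_def by (intro Least_equality) (auto simp: not_less[symmetric])
    qed
    then show ?thesis by (auto simp: dist_commute)
  qed
  have [measurable]: "{q. idx q = i} \<in> sets borel" for i unfolding idx_eq by measurable
  define ki where "ki i q = indicator {q. idx q = i} q *\<^sub>R k q" for i q
  have ki: "integrable lborel (ki i)" for i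
    unfolding ki_def using k by (intro integrable_mult_indicator) auto
  define T where "T N = (LINT q|lborel. (if idx q < N then 0 else norm (k q)))" for N
  have setN [measurable]: "{q. idx q < N} \<in> sets borel" for N
  proof -
    have "{q. idx q < N} = (\<Union>i\<in>{..<N}. {q. idx q = i})" by auto
    moreover have "(\<Union>i\<in>{..<N}. {q. idx q = i}) \<in> sets borel"
      by (intro sets.finite_UN finite_lessThan) simp
    ultimately show ?thesis by (rule ssubst)
  qed
  have mT [measurable]: "(\<lambda>q. if idx q < N then 0 else norm (k q)) \<in> borel_measurable borel" for N
  proof (rule measurable_If)
    show "{q \<in> space borel. idx q < N} \<in> sets borel" using setN[of N] by simp
  qed simp_all
  have iT: "integrable lborel (\<lambda>q. if idx q < N then 0 else norm (k q))" for N
    by (rule Bochner_Integration.integrable_bound[OF integrable_norm[OF k]]) auto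
  have "T \<longlonglongrightarrow> (LINT q::'a|lborel. (0::real))"
    unfolding T_def
  proof (rule integral_dominated_convergence[where w="\<lambda>q. norm (k q)"])
    show "AE q in lborel. (\<lambda>N. if idx q < N then 0 else norm (k q)) \<longlonglongrightarrow> 0"
    proof (rule AE_I2)
      fix q
      show "(\<lambda>N. if idx q < N then 0 else norm (k q)) \<longlonglongrightarrow> 0"
        by (rule tendsto_eventually) (use eventually_gt_at_top[of "idx q"] in eventually_elim, simp)
    qed
  qed (use k in auto)
  then have "T \<longlonglongrightarrow> 0" by simp
  moreover have "0 < e / (2 * (C + 1))" using e C0 by simp
  ultimately have "\<forall>\<^sub>F N in sequentially. T N < e / (2 * (C + 1))"
    by (rule order_tendstoD(2))
  then obtain N where N: "T N < e / (2 * (C + 1))" unfolding eventually_sequentially by blast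
  define f where "f n x = (\<Sum>i<n. integral\<^sup>L lborel (ki i) * G (a i) x)" for n x
  have "f n \<in> K" for n
  proof (induction n)
    case 0
    have "f 0 = 0" by (auto simp: f_def)
    then show ?case using cfun.subspace_0[OF K(2)] by metis
  next
    case (Suc n)
    have "f (Suc n) = f n + fun_scale (integral\<^sup>L lborel (ki n)) (G (a n))"
      by (auto simp: f_def fun_scale_def)
    then show ?case using cfun.subspace_add[OF K(2) Suc cfun.subspace_scale[OF K(2) GK]] by metis
  qed
  moreover have "norm ((LINT q|lborel. k q * G q x) - f N x) \<le> e" for x
  proof -
    have i1: "integrable lborel (\<lambda>q. k q * G q x)"
    proof (rule Bochner_Integration.integrable_bound[OF integrable_mult_right[OF integrable_norm[OF k], of C] _ AE_I2])
      show "norm (k q * G q x) \<le> norm (C * norm (k q))" for q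
        using mult_right_mono[OF C[of q x], of "norm (k q)"] C0 by (simp add: norm_mult mult.commute)
    qed measurable
    have i2: "integrable lborel (\<lambda>q. ki i q * G (a i) x)" for i
      by (rule integrable_mult_left[OF ki])
    have s: "(\<Sum>i<N. ki i q * G (a i) x) = (if idx q < N then k q * G (a (idx q)) x else 0)" for q
    proof -
      have "(\<Sum>i<N. ki i q * G (a i) x) = (\<Sum>i<N. if i = idx q then k q * G (a (idx q)) x else 0)"
        by (intro sum.cong) (auto simp: ki_def)
      then show ?thesis by (simp add: sum.delta)
    qed
    have "f N x = (LINT q|lborel. (\<Sum>i<N. ki i q * G (a i) x))"
      unfolding f_def using i2 ki by (subst Bochner_Integration.integral_sum) auto
    then have "(LINT q|lborel. k q * G q x) - f N x = (LINT q|lborel. k q * G q x - (\<Sum>i<N. ki i q * G (a i) x))"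
      using i1 i2 by (subst Bochner_Integration.integral_diff) auto
    also have "norm \<dots> \<le> (LINT q|lborel. r * norm (k q) + C * (if idx q < N then 0 else norm (k q)))"
    proof (rule Bochner_Integration.integral_norm_bound_integral)
      show "integrable lborel (\<lambda>q. k q * G q x - (\<Sum>i<N. ki i q * G (a i) x))"
        using i1 i2 by auto
      show "integrable lborel (\<lambda>q. r * norm (k q) + C * (if idx q < N then 0 else norm (k q)))"
        by (intro Bochner_Integration.integrable_add integrable_mult_right iT integrable_norm k)
      fix q
      show "norm (k q * G q x - (\<Sum>i<N. ki i q * G (a i) x)) \<le> r * norm (k q) + C * (if idx q < N then 0 else norm (k q))"
      proof (cases "idx q < N")
        case True
        then have "norm (k q * G q x - (\<Sum>i<N. ki i q * G (a i) x)) = norm (k q) * norm (G q x - G (a (idx q)) x)"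
          unfolding s by (simp add: norm_mult flip: right_diff_distrib)
        also have "\<dots> \<le> norm (k q) * r" by (intro mult_left_mono d(2) idx) auto
        finally show ?thesis using True by (simp add: mult.commute)
      next
        case False
        then have "norm (k q * G q x - (\<Sum>i<N. ki i q * G (a i) x)) = norm (k q) * norm (G q x)"
          unfolding s by (simp add: norm_mult)
        also have "\<dots> \<le> norm (k q) * C" by (intro mult_left_mono C) auto
        also have "\<dots> \<le> r * norm (k q) + C * norm (k q)" using r by (simp add: mult.commute)
        finally show ?thesis using False by simp
      qed
    qed
    also have "\<dots> = r * M + C * T N"
      unfolding M_def T_def using k iT by (subst Bochner_Integration.integral_add) auto
    also have "\<dots> \<le> e / 2 + e / 2"
    proof (rule add_mono)
      have "r * M \<le> r * (M + 1)" using r by simp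
      also have "\<dots> = e / 2" using M0 by (simp add: r_def field_simps add_nonneg_eq_0_iff)
      finally show "r * M \<le> e / 2" .
      have "C * T N \<le> (C + 1) * T N" by (intro mult_right_mono) (auto simp: T_def)
      also have "\<dots> \<le> (C + 1) * (e / (2 * (C + 1)))" using N C0 by (intro mult_left_mono) auto
      also have "\<dots> = e / 2" using C0 by (simp add: field_simps)
      finally show "C * T N \<le> e / 2" .
    qed
    finally show ?thesis by simp
  qed
  ultimately show "\<exists>f\<in>K. \<forall>x. norm ((LINT q|lborel. k q * G q x) - f x) \<le> e" by blast
qed

section \<open>Products of Toeplitz operators\<close>

text \<open>
  At \<open>a = 0\<close> this is the kernel of a product of Toeplitz operators; for \<open>a > 0\<close> it is the kernel
  produced by an averaged symbol. The quadratic form in the exponent, together with the weight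
  \<open>exp (- (norm y)\<^sup>2 / (2 * t))\<close>, stays negative definite uniformly in \<open>a \<in> {0..1}\<close>.
\<close>

definition twisted_gauss :: "real \<Rightarrow> real \<Rightarrow> complex ^ 'n::finite \<Rightarrow> complex ^ 'n \<Rightarrow> complex" where
  "twisted_gauss t a y u = exp ((- (of_real a * hdot y y) + of_real (1 + a) * hdot y u - hdot u u) / of_real t)"

lemma continuous_on_twisted_gauss [continuous_intros]:
  "t > 0 \<Longrightarrow> continuous_on S a \<Longrightarrow> continuous_on S f \<Longrightarrow> continuous_on S g \<Longrightarrow> continuous_on S (\<lambda>x. twisted_gauss t (a x) (f x) (g x))"
  unfolding twisted_gauss_def by (intro continuous_intros) auto

lemma twisted_gauss_bound:
  assumes t: "t > 0" and a: "0 \<le> a" "a \<le> 1"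
  shows "norm (twisted_gauss t a y u) * exp (- (norm y)\<^sup>2 / (2 * t)) \<le> exp (- (1 / (10 * t)) * (norm y)\<^sup>2) * exp (- (1 / (10 * t)) * (norm u)\<^sup>2)"
proof -
  let ?r = "norm y" and ?q = "norm u"
  have "Re (hdot y u) \<le> ?r * ?q" using complex_Re_le_cmod norm_hdot_le order_trans by blast
  then have "(1 + a) * Re (hdot y u) \<le> (1 + a) * (?r * ?q)" using a by (intro mult_left_mono) auto
  \<comment> \<open>After giving up 1/10 of decay in each variable, definiteness needs
    \<open>4 * (0.4 + a) * 0.9 - (1 + a)^2\<close>, that is \<open>0.44 + 1.6 * a - a^2\<close>, to
    be nonnegative on the unit interval. The square below comes from multiplying the form by
    3.6.\<close>
  moreover have "(1 + a) * (?r * ?q) \<le> (1/2 + a - 1/10) * ?r\<^sup>2 + (1 - 1/10) * ?q\<^sup>2"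
  proof -
    have "(0.44 + 1.6 * a - a\<^sup>2) \<ge> 0" using a power_decreasing[of 1 2 a] by (simp add: power2_eq_square) 
    then have "0 \<le> (0.44 + 1.6 * a - a\<^sup>2) * ?r\<^sup>2 + (1.8 * ?q - (1 + a) * ?r)\<^sup>2" by simp
    then show ?thesis by (simp add: power2_eq_square algebra_simps)
  qed
  ultimately have "- a * ?r\<^sup>2 + (1 + a) * Re (hdot y u) - ?q\<^sup>2 - ?r\<^sup>2 / 2 \<le> - (?r\<^sup>2 + ?q\<^sup>2) / 10"
    by (simp add: algebra_simps)
  then have "(- a * ?r\<^sup>2 + (1 + a) * Re (hdot y u) - ?q\<^sup>2 - ?r\<^sup>2 / 2) / t \<le> (- (?r\<^sup>2 + ?q\<^sup>2) / 10) / t"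
    using t by (intro divide_right_mono) auto
  moreover have "norm (twisted_gauss t a y u) * exp (- ?r\<^sup>2 / (2 * t)) = exp ((- a * ?r\<^sup>2 + (1 + a) * Re (hdot y u) - ?q\<^sup>2 - ?r\<^sup>2 / 2) / t)"
  proof -
    have "Re ((- (of_real a * hdot y y) + of_real (1 + a) * hdot y u - hdot u u) / of_real t) = (- a * ?r\<^sup>2 + (1 + a) * Re (hdot y u) - ?q\<^sup>2) / t"
      by (simp add: hdot_self Re_divide_of_real del: of_real_power of_real_add)
    then show ?thesis using t unfolding twisted_gauss_def norm_exp_eq_Re by (simp add: field_simps flip: exp_add)
  qed
  moreover have "exp (- (1 / (10 * t)) * ?r\<^sup>2) * exp (- (1 / (10 * t)) * ?q\<^sup>2) = exp ((- (?r\<^sup>2 + ?q\<^sup>2) / 10) / t)"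
    using t by (simp add: field_simps flip: exp_add)
  ultimately show ?thesis by simp
qed

lemma integrable_pair_convolution:
  fixes a g :: "'a::euclidean_space \<Rightarrow> complex"
  assumes a: "integrable lborel a" and g: "integrable lborel g"
  shows "integrable (lborel \<Otimes>\<^sub>M lborel) (\<lambda>(h, v). a h * g (v - h))"
proof (rule lborel_pair.Fubini_integrable)
  have m[measurable]: "a \<in> borel_measurable borel" "g \<in> borel_measurable borel" using a g by auto
  show "(\<lambda>(h, v). a h * g (v - h)) \<in> borel_measurable (lborel \<Otimes>\<^sub>M lborel)"
    by (simp add: case_prod_beta')
  have e: "(LINT v|lborel. norm (case (h, v) of (h, v) \<Rightarrow> a h * g (v - h))) = norm (a h) * (LINT v|lborel. norm (g v))" for h
    using lborel_integral_translate[of "\<lambda>v. norm (g v)" "- h"] by (simp add: norm_mult)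
  show "integrable lborel (\<lambda>h. LINT v|lborel. norm (case (h, v) of (h, v) \<Rightarrow> a h * g (v - h)))"
    unfolding e using a by (intro integrable_mult_left integrable_norm)
  show "AE h in lborel. integrable lborel (\<lambda>v. case (h, v) of (h, v) \<Rightarrow> a h * g (v - h))"
    using lborel_integrable_translate[OF m(2), of "- _"] g by auto
qed

lemma BUC_product_uniform:
  assumes \<phi>: "\<phi> \<in> BUC" and \<psi>: "\<psi> \<in> BUC" and e: "e > 0"
  shows "\<exists>d>0. \<forall>a a' b b'. dist a a' < d \<longrightarrow> dist b b' < d \<longrightarrow> norm (\<psi> a * \<phi> b - \<psi> a' * \<phi> b') \<le> e"
proof -
  obtain C where C: "0 \<le> C" "\<And>x. norm (\<phi> x) \<le> C" using BUC_bounded[OF \<phi>] by metis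
  obtain D where D: "0 \<le> D" "\<And>x. norm (\<psi> x) \<le> D" using BUC_bounded[OF \<psi>] by metis
  define r where "r = e / (C + D + 1)"
  have r: "r > 0" using e C(1) D(1) by (simp add: r_def)
  obtain d1 where d1: "d1 > 0" "\<And>x y. dist y x < d1 \<Longrightarrow> dist (\<phi> y) (\<phi> x) < r"
    using \<phi> r unfolding BUC_def uniformly_continuous_on_def by auto
  obtain d2 where d2: "d2 > 0" "\<And>x y. dist y x < d2 \<Longrightarrow> dist (\<psi> y) (\<psi> x) < r"
    using \<psi> r unfolding BUC_def uniformly_continuous_on_def by auto
  have "norm (\<psi> a * \<phi> b - \<psi> a' * \<phi> b') \<le> e" if "dist a a' < min d1 d2" "dist b b' < min d1 d2" for a a' b b'
  proof -
    have "\<psi> a * \<phi> b - \<psi> a' * \<phi> b' = \<psi> a * (\<phi> b - \<phi> b') + (\<psi> a - \<psi> a') * \<phi> b'" by (simp add: algebra_simps)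
    then have "norm (\<psi> a * \<phi> b - \<psi> a' * \<phi> b') \<le> norm (\<psi> a) * norm (\<phi> b - \<phi> b') + norm (\<psi> a - \<psi> a') * norm (\<phi> b')"
      by (metis norm_mult norm_triangle_ineq)
    also have "\<dots> \<le> D * r + r * C"
      using d1(2)[of b b'] d2(2)[of a a'] that r
      by (intro add_mono mult_mono C D) (auto simp: dist_norm)
    also have "\<dots> \<le> (C + D + 1) * r" using r by (simp add: algebra_simps)
    also have "\<dots> = e" using C(1) D(1) by (simp add: r_def)
    finally show ?thesis .
  qed
  then show ?thesis using d1(1) d2(1) by (intro exI[of _ "min d1 d2"]) auto
qed

lemma BUC_mult_shift:
  assumes "\<phi> \<in> BUC" "\<psi> \<in> BUC" "continuous_on S a" "continuous_on S b"
  shows "continuous_on S (\<lambda>q. \<psi> (a q) * \<phi> (b q))"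
  by (intro continuous_intros continuous_on_compose2[OF BUC_continuous[OF assms(1), of UNIV]]
    continuous_on_compose2[OF BUC_continuous[OF assms(2), of UNIV]] assms) auto

lemma toeplitz_comp_eq:
  fixes f :: "complex ^ 'n::finite \<Rightarrow> complex"
  assumes t: "t > 0" and p: "p > 1" and f: "f \<in> fock t p" and \<phi>: "\<phi> \<in> BUC" and \<psi>: "\<psi> \<in> BUC"
  shows "toeplitz t p \<phi> (toeplitz t p \<psi> f) z = (of_real (1 / (pi * t) ^ CARD('n)))\<^sup>2 *
    (LINT x|lborel. LINT u|lborel. f x * fock_exp t z x * (\<psi> x * \<phi> (x + u) * twisted_gauss t 0 (z - x) u))"
proof -
  let ?c = "complex_of_real (1 / (pi * t) ^ CARD('n))"
  let ?e = "\<lambda>r w. exp (0 * norm (z - w) - 1 / (r * t) * (norm (z - w))\<^sup>2)"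
  obtain C where C: "0 \<le> C" "\<And>x. norm (\<phi> x) \<le> C" using BUC_bounded[OF \<phi>] by metis
  obtain D where D: "0 \<le> D" "\<And>x. norm (\<psi> x) \<le> D" using BUC_bounded[OF \<psi>] by metis
  note cf = entire_continuous_on[OF fock_entire[OF f]]
  define k where "k = (\<lambda>(w, x). (\<psi> x * \<phi> w) * (f x * fock_exp t w x) * fock_exp t z w)"
  have ck: "continuous_on UNIV k"
    unfolding k_def case_prod_beta' using t
    by (intro continuous_intros BUC_mult_shift[OF \<phi> \<psi>] continuous_on_compose2[OF cf, of UNIV]) auto
  then have mk[measurable]: "k \<in> borel_measurable (lborel \<Otimes>\<^sub>M lborel)"
    by (simp add: lborel_prod borel_measurable_continuous_onI)
  have gf: "toeplitz t p \<psi> f \<in> fock t p" by (rule bounded_opsD(1)[OF toeplitz_bounded[OF t p \<psi>] f])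
  have ik: "integrable (lborel \<Otimes>\<^sub>M lborel) k"
  proof (rule integrable_pair_dominated[OF mk])
    show "integrable lborel (\<lambda>w. D * C * exp ((norm z)\<^sup>2 / (2 * t)) * ?e 4 w)"
    proof (rule integrable_mult_right)
      have "integrable lborel (\<lambda>w :: complex ^ 'n. exp (0 * norm w - 1 / (4 * t) * (norm w)\<^sup>2))"
        using t by (intro integrable_exp_linear_gauss) simp
      then show "integrable lborel (\<lambda>w. ?e 4 w)"
        by (subst lborel_integrable_reflect[where f="\<lambda>w :: complex ^ 'n. exp (0 * norm w - 1 / (4 * t) * (norm w)\<^sup>2)"]) simp_all
    qed
    show "integrable lborel (\<lambda>x. ?e 8 x * gauss_weighted t f x)"
      using t by (intro fock_gauss_integrable[OF t p f]) simp
    fix w x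
    \<comment> \<open>Used to dominate by a product of a function of \<open>w\<close> and one of
      \<open>x\<close>: half the decay in \<open>z - w\<close> is kept for \<open>w\<close>, and the
      rest, together with the decay in \<open>w - x\<close>, yields the rate
      \<open>1 / (8 * t)\<close> in \<open>z - x\<close>.\<close>
    have sq: "(norm (z - x))\<^sup>2 \<le> 2 * (norm (z - w))\<^sup>2 + 2 * (norm (w - x))\<^sup>2"
    proof -
      have "norm (z - x) \<le> norm (z - w) + norm (w - x)" using norm_triangle_ineq[of "z - w" "w - x"] by simp
      then have "(norm (z - x))\<^sup>2 \<le> (norm (z - w) + norm (w - x))\<^sup>2" by (intro power_mono) auto
      then show ?thesis using sum_squares_bound[of "norm (z - w)" "norm (w - x)"] by (simp add: power2_sum)
    qed
    have "norm (k (w, x)) = norm (\<psi> x) * norm (\<phi> w) * (exp ((norm z)\<^sup>2 / (2 * t)) * (exp (- (norm (w - x))\<^sup>2 / (2 * t)) * exp (- (norm (z - w))\<^sup>2 / (2 * t))) * gauss_weighted t f x)"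
      unfolding k_def prod.case norm_mult[of "_ * _" "fock_exp t z w"] norm_mult[of "\<psi> x * \<phi> w"] norm_mult_fock_exp[OF t] norm_fock_exp[OF t, of z w]
      by (simp add: norm_mult exp_minus)
    also have "\<dots> \<le> D * C * (exp ((norm z)\<^sup>2 / (2 * t)) * (?e 4 w * ?e 8 x) * gauss_weighted t f x)"
    proof -
      have "(norm (z - x))\<^sup>2 / (8 * t) \<le> (2 * (norm (z - w))\<^sup>2 + 2 * (norm (w - x))\<^sup>2) / (8 * t)"
        using t sq by (intro divide_right_mono) auto
      moreover have "(2 * (norm (z - w))\<^sup>2 + 2 * (norm (w - x))\<^sup>2) / (8 * t) = (norm (z - w))\<^sup>2 / (4 * t) + (norm (w - x))\<^sup>2 / (4 * t)"
        using t by (simp add: field_simps)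
      moreover have "(norm (w - x))\<^sup>2 / (4 * t) \<le> (norm (w - x))\<^sup>2 / (2 * t)" "(norm (z - w))\<^sup>2 / (2 * t) = 2 * ((norm (z - w))\<^sup>2 / (4 * t))"
        using t by (auto simp: field_simps)
      ultimately have "- (norm (w - x))\<^sup>2 / (2 * t) + - (norm (z - w))\<^sup>2 / (2 * t) \<le> - ((norm (z - w))\<^sup>2 / (4 * t)) - (norm (z - x))\<^sup>2 / (8 * t)"
        by linarith
      then have E: "exp (- (norm (w - x))\<^sup>2 / (2 * t)) * exp (- (norm (z - w))\<^sup>2 / (2 * t)) \<le> ?e 4 w * ?e 8 x"
        by (simp flip: exp_add)
      show ?thesis
        by (rule mult_mono[OF mult_mono[OF D(2) C(2) D(1) norm_ge_zero] mult_right_mono[OF mult_left_mono[OF E]]])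
          (auto simp: gauss_weighted_nonneg C D)
    qed
    finally show "norm (k (w, x)) \<le> D * C * exp ((norm z)\<^sup>2 / (2 * t)) * ?e 4 w * (?e 8 x * gauss_weighted t f x)"
      by (simp add: mult_ac)
  qed
  have "\<phi> w * toeplitz t p \<psi> f w * fock_exp t z w = ?c * (LINT x|lborel. k (w, x))" for w
  proof -
    have "(LINT x|lborel. k (w, x)) = (LINT x|lborel. (\<phi> w * fock_exp t z w) * (\<psi> x * f x * fock_exp t w x))"
      by (intro Bochner_Integration.integral_cong) (auto simp: k_def)
    also have "\<dots> = (\<phi> w * fock_exp t z w) * (LINT x|lborel. \<psi> x * f x * fock_exp t w x)" by (rule integral_mult_right_zero)
    finally show ?thesis unfolding toeplitz_eq[OF t f \<psi>] by (simp add: mult_ac)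
  qed
  then have "toeplitz t p \<phi> (toeplitz t p \<psi> f) z = ?c * (LINT w|lborel. ?c * (LINT x|lborel. k (w, x)))"
    unfolding toeplitz_eq[OF t gf \<phi>] by simp
  also have "\<dots> = ?c\<^sup>2 * (LINT w|lborel. LINT x|lborel. k (w, x))"
    by (simp only: integral_mult_right_zero power2_eq_square mult.assoc)
  also have "(LINT w|lborel. LINT x|lborel. k (w, x)) = (LINT x|lborel. LINT w|lborel. k (w, x))"
    using lborel_pair.Fubini_integral[of "\<lambda>w x. k (w, x)"] ik by simp
  also have "\<dots> = (LINT x|lborel. LINT u|lborel. k (u + x, x))"
  proof (rule Bochner_Integration.integral_cong[OF refl])
    fix x
    have "(\<lambda>w. k (w, x)) \<in> borel_measurable borel"
      by (intro borel_measurable_continuous_onI continuous_on_compose2[OF ck]) (auto intro!: continuous_intros)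
    then show "(LINT w|lborel. k (w, x)) = (LINT u|lborel. k (u + x, x))"
      by (rule lborel_integral_translate[symmetric])
  qed
  also have "\<dots> = (LINT x|lborel. LINT u|lborel. f x * fock_exp t z x * (\<psi> x * \<phi> (x + u) * twisted_gauss t 0 (z - x) u))"
  proof (intro Bochner_Integration.integral_cong refl)
    fix x u
    have "hdot (u + x - x) x / of_real t + hdot (z - (u + x)) (u + x) / of_real t =
       hdot (z - x) x / of_real t + (- (of_real 0 * hdot (z - x) (z - x)) + of_real (1 + 0) * hdot (z - x) u - hdot u u) / of_real t"
      unfolding add_divide_distrib[symmetric] by (simp add: hdot_simps)
    then have "fock_exp t (u + x) x * fock_exp t z (u + x) = fock_exp t z x * twisted_gauss t 0 (z - x) u"
      unfolding fock_exp_def twisted_gauss_def exp_add[symmetric] by (simp only:)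
    then show "k (u + x, x) = f x * fock_exp t z x * (\<psi> x * \<phi> (x + u) * twisted_gauss t 0 (z - x) u)"
      by (simp add: k_def add.commute mult_ac)
  qed
  finally show ?thesis .
qed

section \<open>The Gaussian weights that reproduce the product kernel\<close>

text \<open>Mathematically this is \<open>(pi * s) ^ CARD('n)\<close>. It is kept as an integral
  because it cancels against the same integral in \<open>gauss_reproducing\<close>.\<close>

definition gauss_total :: "real \<Rightarrow> 'n::finite itself \<Rightarrow> real" where
  "gauss_total s _ = (LINT h|lborel. exp (- (norm (h :: complex ^ 'n))\<^sup>2 / s))"

lemma gauss_total_pos:
  assumes s: "s > 0" shows "gauss_total s TYPE('n::finite) > 0"
proof -
  let ?g = "\<lambda>h :: complex ^ 'n. exp (- (norm h)\<^sup>2 / s)"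
  have i: "integrable lborel ?g"
    using integrable_exp_neg_norm_square[of "1 / s", where 'a="complex ^ 'n"] s by simp
  have "integral\<^sup>L lborel ?g \<noteq> 0"
  proof
    assume "integral\<^sup>L lborel ?g = 0"
    then have "AE h in lborel. ?g h = 0" using integral_nonneg_eq_0_iff_AE[OF i] by simp
    then have "AE h in (lborel :: (complex ^ 'n) measure). False" by simp
    then have "emeasure lborel (UNIV :: (complex ^ 'n) set) = 0"
      by (subst (asm) AE_iff_measurable[where N=UNIV]) auto
    then show False by simp
  qed
  moreover have "integral\<^sup>L lborel ?g \<ge> 0" by simp
  ultimately show ?thesis unfolding gauss_total_def by linarith
qed

text \<open>
  The term \<open>- hdot h u / s\<close> is chosen so that the reproducing formula for the Gaussian of width \<open>s\<close>
  turns it into the factor \<open>exp (hdot (z - v) u / t)\<close>.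
\<close>

definition shift_weight :: "real \<Rightarrow> real \<Rightarrow> complex ^ 'n::finite \<Rightarrow> complex ^ 'n \<Rightarrow> complex" where
  "shift_weight t s u h = exp (hdot h h / of_real t - (hdot h h + hdot h u) / of_real s) / of_real (gauss_total s TYPE('n))"

lemma continuous_on_shift_weight [continuous_intros]:
  "t > 0 \<Longrightarrow> s > 0 \<Longrightarrow> continuous_on S f \<Longrightarrow> continuous_on S g \<Longrightarrow> continuous_on S (\<lambda>x. shift_weight t s (f x) (g x))"
  for f g :: "'a::topological_space \<Rightarrow> complex ^ 'n::finite"
  unfolding shift_weight_def using gauss_total_pos[of s, where 'n='n]
  by (intro continuous_intros) auto

lemma norm_shift_weight_le:
  fixes u h :: "complex ^ 'n::finite"
  assumes t: "0 < s" "s < t"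
  shows "norm (shift_weight t s u h) \<le> exp (norm u / s * norm h - (1 / s - 1 / t) * (norm h)\<^sup>2) / gauss_total s TYPE('n)"
proof -
  have "\<bar>Re (hdot h u)\<bar> \<le> norm h * norm u" using abs_Re_le_cmod norm_hdot_le order_trans by blast
  then have "- Re (hdot h u) / s \<le> norm u / s * norm h" using t by (simp add: field_simps abs_le_iff)
  moreover have "Re (hdot h h / of_real t - (hdot h h + hdot h u) / of_real s) = - (1 / s - 1 / t) * (norm h)\<^sup>2 + - Re (hdot h u) / s"
    using t by (simp add: hdot_self Re_divide_of_real field_simps del: of_real_power)
  ultimately have "norm (exp (hdot h h / of_real t - (hdot h h + hdot h u) / of_real s)) \<le> exp (norm u / s * norm h - (1 / s - 1 / t) * (norm h)\<^sup>2)"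
    unfolding norm_exp_eq_Re exp_le_cancel_iff by linarith
  then show ?thesis unfolding shift_weight_def norm_divide using gauss_total_pos[OF t(1), where 'n='n]
    by (simp add: divide_right_mono)
qed

lemma shift_weight_integrable:
  fixes u :: "complex ^ 'n::finite"
  assumes t: "0 < s" "s < t"
  shows "integrable lborel (shift_weight t s u)"
proof (rule Bochner_Integration.integrable_bound[OF _ _ AE_I2])
  have d: "1 / s - 1 / t > 0" using t by (simp add: field_simps)
  show "integrable lborel (\<lambda>h :: complex ^ 'n. exp (norm u / s * norm h - (1 / s - 1 / t) * (norm h)\<^sup>2) / gauss_total s TYPE('n))"
    by (intro integrable_divide integrable_exp_linear_gauss d)
  show "shift_weight t s u \<in> borel_measurable lborel"
    using t by (auto intro!: borel_measurable_continuous_onI continuous_intros)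
  show "norm (shift_weight t s u h) \<le> norm (exp (norm u / s * norm h - (1 / s - 1 / t) * (norm h)\<^sup>2) / gauss_total s TYPE('n))" for h
    using norm_shift_weight_le[OF t, of u h] gauss_total_pos[OF t(1), where 'n='n] by simp
qed

text \<open>The term \<open>hdot h h / of_real t\<close> of the weight cancels
  \<open>- hdot h h\<close> in the exponent of \<open>fock_exp t z (v - h)\<close>. What is left is
  an entire function of \<open>h\<close>, one exponential linear in the conjugate of
  \<open>h\<close>, and a Gaussian of width \<open>s\<close>: exactly the input of
  \<open>gauss_reproducing\<close>.\<close>

lemma shift_weight_reproducing:
  fixes f :: "complex ^ 'n::finite \<Rightarrow> complex"
  assumes t: "0 < s" "s < t" and p: "p > 1" and f: "f \<in> fock t p"
  shows "(LINT h|lborel. shift_weight t s u h * (f (v - h) * fock_exp t z (v - h))) =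
    f (v + (s / t) *\<^sub>R (z - v)) * (fock_exp t z v * exp ((hdot (z - v) u - of_real (s / t) * hdot (z - v) v) / of_real t))"
proof -
  have t0: "t > 0" using t by simp
  let ?Z = "complex_of_real (gauss_total s TYPE('n))"
  \<comment> \<open>Chosen so that \<open>hdot a h / s\<close> is the antiholomorphic term
    \<open>- hdot (z - v) h / t\<close>.\<close>
  define a where "a = (- (s / t)) *\<^sub>R (z - v)"
  define G where "G h = exp ((- 1 / of_real s) * hdot h u) * exp ((1 / of_real t) * hdot h v) * f (v + (- 1) *\<^sub>R h)" for h
  have G: "entire G" unfolding G_def by (intro entire_mult entire_exp_hdot entire_affine fock_entire[OF f])
  define K where "K h = G h * exp (hdot a h / of_real s) * of_real (exp (- (norm h)\<^sup>2 / s))" for h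
  have e: "shift_weight t s u h * (f (v - h) * fock_exp t z (v - h)) = fock_exp t z v / ?Z * K h" for h
  proof -
    have g: "complex_of_real (exp (- (norm h)\<^sup>2 / s)) = exp (- hdot h h / of_real s)"
      by (simp add: hdot_self flip: exp_of_real)
    have "(hdot h h / of_real t - (hdot h h + hdot h u) / of_real s) + hdot (z - (v - h)) (v - h) / of_real t
       = hdot (z - v) v / of_real t + ((- 1 / of_real s) * hdot h u + (1 / of_real t) * hdot h v + hdot a h / of_real s + - hdot h h / of_real s)"
      using t t0 by (simp add: a_def hdot_simps field_simps)
    then have "exp (hdot h h / of_real t - (hdot h h + hdot h u) / of_real s) * fock_exp t z (v - h)
       = fock_exp t z v * (exp ((- 1 / of_real s) * hdot h u) * exp ((1 / of_real t) * hdot h v) * exp (hdot a h / of_real s) * exp (- hdot h h / of_real s))"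
      unfolding fock_exp_def exp_add[symmetric] by (simp only:)
    then show ?thesis unfolding shift_weight_def K_def G_def g by (simp add: mult_ac)
  qed
  have iK: "integrable lborel K"
  proof (rule Bochner_Integration.integrable_bound[OF _ _ AE_I2])
    \<comment> \<open>The second \<open>norm v / t\<close> comes from expanding
      \<open>(norm (v - h))^2 / (2 * t)\<close>, the growth allowed to \<open>f\<close>; its
      quadratic part lowers the rate \<open>1 / s\<close> to \<open>?d\<close>.\<close>
    let ?A = "norm u / s + norm v / t + norm a / s + norm v / t"
    let ?d = "1 / s - 1 / (2 * t)"
    let ?g = "\<lambda>w. exp (?A * norm (v - w) - ?d * (norm (v - w))\<^sup>2) * gauss_weighted t f w"
    have d: "?d > 0" using t by (simp add: field_simps)
    have ig: "integrable lborel ?g" by (rule fock_gauss_integrable[OF t0 p f d])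
    have "integrable lborel (\<lambda>h. ?g (v - h))"
      using ig lborel_integrable_reflect[OF borel_measurable_integrable[OF ig, simplified], of v] by simp
    then show "integrable lborel (\<lambda>h. exp ((norm v)\<^sup>2 / (2 * t)) * ?g (v - h))" by (rule integrable_mult_right)
    show "K \<in> borel_measurable lborel"
      unfolding K_def using t by (auto intro!: borel_measurable_continuous_onI continuous_intros entire_continuous_on[OF G])
    fix h
    have r: "\<bar>Re (hdot x y)\<bar> \<le> norm x * norm y" for x y :: "complex ^ 'n" using abs_Re_le_cmod norm_hdot_le order_trans by blast
    have nf: "norm (f (v - h)) = exp ((norm (v - h))\<^sup>2 / (2 * t)) * gauss_weighted t f (v - h)"
      by (simp add: gauss_weighted_def exp_minus)
    have "norm (K h) = exp (- Re (hdot h u) / s + Re (hdot h v) / t + Re (hdot a h) / s - (norm h)\<^sup>2 / s + (norm (v - h))\<^sup>2 / (2 * t)) * gauss_weighted t f (v - h)"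
    proof -
      have "Re ((- 1 / of_real s) * hdot h u) = - Re (hdot h u) / s" "Re ((1 / of_real t) * hdot h v) = Re (hdot h v) / t"
        "Re (hdot a h / of_real s) = Re (hdot a h) / s"
        by (simp_all add: Re_divide_of_real flip: of_real_minus)
      moreover have "norm (K h) = exp (Re ((- 1 / of_real s) * hdot h u)) * exp (Re ((1 / of_real t) * hdot h v)) * norm (f (v - h)) * exp (Re (hdot a h / of_real s)) * exp (- (norm h)\<^sup>2 / s)"
        unfolding K_def G_def norm_mult norm_exp_eq_Re by simp
      ultimately have "norm (K h) = exp (- Re (hdot h u) / s) * exp (Re (hdot h v) / t) * exp (Re (hdot a h) / s) * exp (- (norm h)\<^sup>2 / s) * exp ((norm (v - h))\<^sup>2 / (2 * t)) * gauss_weighted t f (v - h)"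
        by (simp only: nf mult_ac)
      then show ?thesis unfolding exp_add[symmetric] by simp
    qed
    also have "\<dots> \<le> exp ((norm v)\<^sup>2 / (2 * t) + (?A * norm h - ?d * (norm h)\<^sup>2)) * gauss_weighted t f (v - h)"
    proof (intro mult_right_mono gauss_weighted_nonneg, simp only: exp_le_cancel_iff)
      have "- Re (hdot h u) / s \<le> norm u / s * norm h" using r[of h u] t by (simp add: field_simps abs_le_iff)
      moreover have "Re (hdot h v) / t \<le> norm v / t * norm h" using r[of h v] t by (simp add: field_simps abs_le_iff)
      moreover have "Re (hdot a h) / s \<le> norm a / s * norm h" using r[of a h] t by (simp add: field_simps abs_le_iff)
      moreover have "(norm (v - h))\<^sup>2 / (2 * t) \<le> ((norm v)\<^sup>2 + (norm h)\<^sup>2 + 2 * (norm v * norm h)) / (2 * t)"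
        using r[of v h] t0 by (intro divide_right_mono) (auto simp: norm_diff_square abs_le_iff mult.commute)
      moreover have "((norm v)\<^sup>2 + (norm h)\<^sup>2 + 2 * (norm v * norm h)) / (2 * t) = (norm v)\<^sup>2 / (2 * t) + (norm h)\<^sup>2 / (2 * t) + norm v / t * norm h"
        using t0 by (simp add: field_simps)
      moreover have "?A * norm h - ?d * (norm h)\<^sup>2 = norm u / s * norm h + norm v / t * norm h + norm a / s * norm h + norm v / t * norm h - (norm h)\<^sup>2 / s + (norm h)\<^sup>2 / (2 * t)"
        by (simp add: algebra_simps)
      ultimately show "- Re (hdot h u) / s + Re (hdot h v) / t + Re (hdot a h) / s - (norm h)\<^sup>2 / s + (norm (v - h))\<^sup>2 / (2 * t) \<le> (norm v)\<^sup>2 / (2 * t) + (?A * norm h - ?d * (norm h)\<^sup>2)"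
        by linarith
    qed
    also have "\<dots> = exp ((norm v)\<^sup>2 / (2 * t)) * ?g (v - h)" by (simp add: exp_add)
    finally show "norm (K h) \<le> norm (exp ((norm v)\<^sup>2 / (2 * t)) * ?g (v - h))" by (simp add: abs_mult gauss_weighted_nonneg)
  qed
  have "(LINT h|lborel. shift_weight t s u h * (f (v - h) * fock_exp t z (v - h))) = fock_exp t z v / ?Z * (G a * ?Z)"
    unfolding e integral_mult_right_zero K_def gauss_reproducing[OF G t(1) iK[unfolded K_def]] gauss_total_def ..
  also have "\<dots> = fock_exp t z v * G a" using gauss_total_pos[OF t(1), where 'n='n] by simp
  also have "G a = f (v + (s / t) *\<^sub>R (z - v)) * exp ((hdot (z - v) u - of_real (s / t) * hdot (z - v) v) / of_real t)"
  proof -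
    have "v + (- 1) *\<^sub>R a = v + (s / t) *\<^sub>R (z - v)" by (simp add: a_def)
    moreover have "(- 1 / of_real s) * hdot a u + (1 / of_real t) * hdot a v = (hdot (z - v) u - of_real (s / t) * hdot (z - v) v) / of_real t"
      using t t0 by (simp add: a_def hdot_simps field_simps)
    ultimately show ?thesis unfolding G_def exp_add[symmetric] by (simp only: mult.commute)
  qed
  finally show ?thesis by (simp add: mult_ac)
qed

section \<open>Toeplitz operators with averaged symbols\<close>

text \<open>The variables \<open>u\<close> and \<open>h\<close> are packed into one pair so that the
  averaged symbol is a single integral, as \<open>integral_mem_closed_subspace\<close>
  expects.\<close>

definition conv_kernel :: "real \<Rightarrow> real \<Rightarrow> real \<Rightarrow> (complex ^ 'n::finite) \<times> (complex ^ 'n) \<Rightarrow> complex" where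
  "conv_kernel t s R = (\<lambda>(u, h). (indicator (cball 0 R) u * exp (- hdot u u / of_real t)) * shift_weight t s u h)"

lemma norm_indicator_complex: "norm (indicator A x :: complex) = indicator A x"
  by (simp add: indicator_def)

lemma norm_exp_neg_hdot_self: "norm (exp (- hdot u u / of_real t)) = exp (- (norm u)\<^sup>2 / t)"
  by (simp add: hdot_self Re_divide_of_real del: of_real_power)

text \<open>On the ball the linear rate \<open>norm u / s\<close> is at most \<open>R / s\<close>,
  and \<open>s < t\<close> keeps the Gaussian rate \<open>1 / s - 1 / t\<close> positive.\<close>

lemma conv_kernel_integrable:
  assumes t: "0 < s" "s < t" and R: "0 \<le> R"
  shows "integrable lborel (conv_kernel t s R :: (complex ^ 'n::finite) \<times> (complex ^ 'n) \<Rightarrow> complex)"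
  unfolding lborel_prod[symmetric]
proof (rule integrable_pair_dominated)
  let ?Z = "gauss_total s TYPE('n)"
  have t0: "t > 0" using t by simp
  have "conv_kernel t s R = (\<lambda>q :: (complex ^ 'n) \<times> (complex ^ 'n). indicator (cball 0 R) (fst q) * (exp (- hdot (fst q) (fst q) / of_real t) * shift_weight t s (fst q) (snd q)))"
    by (auto simp: conv_kernel_def)
  moreover have "(\<lambda>q :: (complex ^ 'n) \<times> (complex ^ 'n). exp (- hdot (fst q) (fst q) / of_real t) * shift_weight t s (fst q) (snd q)) \<in> borel_measurable (lborel \<Otimes>\<^sub>M lborel)"
    unfolding lborel_prod using t by (auto intro!: borel_measurable_continuous_onI continuous_intros)
  moreover have "(\<lambda>q :: (complex ^ 'n) \<times> (complex ^ 'n). indicator (cball 0 R) (fst q) :: complex) \<in> borel_measurable (lborel \<Otimes>\<^sub>M lborel)"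
    by (intro measurable_compose[OF measurable_fst] borel_measurable_indicator) simp
  ultimately show "conv_kernel t s R \<in> borel_measurable (lborel \<Otimes>\<^sub>M (lborel :: (complex ^ 'n) measure))"
    by (simp only: borel_measurable_times)
  show "integrable lborel (indicator (cball 0 R) :: complex ^ 'n \<Rightarrow> real)"
    using emeasure_lborel_cball_finite[of "0 :: complex ^ 'n" R] by (intro integrable_real_indicator) auto
  show "integrable lborel (\<lambda>h :: complex ^ 'n. exp (R / s * norm h - (1 / s - 1 / t) * (norm h)\<^sup>2) / ?Z)"
    using t by (intro integrable_divide integrable_exp_linear_gauss) (simp add: field_simps)
  fix u h :: "complex ^ 'n"
  show "norm (conv_kernel t s R (u, h)) \<le> indicator (cball 0 R) u * (exp (R / s * norm h - (1 / s - 1 / t) * (norm h)\<^sup>2) / ?Z)"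
  proof (cases "u \<in> cball 0 R")
    case True
    then have u: "norm u \<le> R" by simp
    have "norm (exp (- hdot u u / of_real t)) \<le> 1" unfolding norm_exp_neg_hdot_self using t0 by simp
    moreover have "norm (shift_weight t s u h) \<le> exp (R / s * norm h - (1 / s - 1 / t) * (norm h)\<^sup>2) / ?Z"
    proof (rule order_trans[OF norm_shift_weight_le[OF t]])
      have "norm u / s * norm h \<le> R / s * norm h" using u t by (intro mult_right_mono divide_right_mono) auto
      then show "exp (norm u / s * norm h - (1 / s - 1 / t) * (norm h)\<^sup>2) / ?Z \<le> exp (R / s * norm h - (1 / s - 1 / t) * (norm h)\<^sup>2) / ?Z"
        using gauss_total_pos[OF t(1), where 'n='n] by (intro divide_right_mono) auto
    qed
    ultimately have "norm (exp (- hdot u u / of_real t)) * norm (shift_weight t s u h) \<le> 1 * (exp (R / s * norm h - (1 / s - 1 / t) * (norm h)\<^sup>2) / ?Z)"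
      by (intro mult_mono) auto
    then show ?thesis using True by (simp add: conv_kernel_def norm_mult)
  qed (simp add: conv_kernel_def)
qed

text \<open>The parameters \<open>r\<close>, \<open>a\<close> and \<open>S\<close> let one statement
  serve both operators: \<open>r = 1\<close>, \<open>a = 0\<close>, \<open>S = UNIV\<close> for the
  product, a Jacobian and a ball for the averaged symbol.\<close>

lemma twisted_gauss_symbol_integrable:
  fixes f :: "complex ^ 'n::finite \<Rightarrow> complex"
  assumes t: "t > 0" and p: "p > 1" and f: "f \<in> fock t p" and \<phi>: "\<phi> \<in> BUC" and \<psi>: "\<psi> \<in> BUC"
    and a: "0 \<le> a" "a \<le> 1" and S: "S \<in> sets borel"
  shows "integrable (lborel \<Otimes>\<^sub>M lborel) (\<lambda>(x, u). f x * fock_exp t z x * (of_real r * indicator S u *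
      (\<psi> (x - a *\<^sub>R (z - x)) * \<phi> (x - a *\<^sub>R (z - x) + u)) * twisted_gauss t a (z - x) u))"
    (is "integrable _ ?k")
proof -
  obtain C where C: "0 \<le> C" "\<And>x. norm (\<phi> x) \<le> C" using BUC_bounded[OF \<phi>] by metis
  obtain D where D: "0 \<le> D" "\<And>x. norm (\<psi> x) \<le> D" using BUC_bounded[OF \<psi>] by metis
  note cf = entire_continuous_on[OF fock_entire[OF f]]
  show ?thesis
  proof (rule integrable_pair_dominated)
    have "?k = (\<lambda>q. indicator S (snd q) * (f (fst q) * fock_exp t z (fst q) * (of_real r *
        (\<psi> (fst q - a *\<^sub>R (z - fst q)) * \<phi> (fst q - a *\<^sub>R (z - fst q) + snd q)) * twisted_gauss t a (z - fst q) (snd q))))"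
      by (auto simp: mult_ac)
    moreover have "(\<lambda>q. f (fst q) * fock_exp t z (fst q) * (of_real r *
        (\<psi> (fst q - a *\<^sub>R (z - fst q)) * \<phi> (fst q - a *\<^sub>R (z - fst q) + snd q)) * twisted_gauss t a (z - fst q) (snd q)))
        \<in> borel_measurable (lborel \<Otimes>\<^sub>M lborel)"
      unfolding lborel_prod using t
      by (auto intro!: borel_measurable_continuous_onI continuous_intros BUC_mult_shift[OF \<phi> \<psi>] continuous_on_compose2[OF cf, of UNIV])
    moreover have "(\<lambda>q :: (complex ^ 'n) \<times> (complex ^ 'n). indicator S (snd q) :: complex) \<in> borel_measurable (lborel \<Otimes>\<^sub>M lborel)"
      by (intro measurable_compose[OF measurable_snd] borel_measurable_indicator) (simp add: S)
    ultimately show "?k \<in> borel_measurable (lborel \<Otimes>\<^sub>M lborel)" by (simp only: borel_measurable_times)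
    show "integrable lborel (\<lambda>x. \<bar>r\<bar> * (D * C) * exp ((norm z)\<^sup>2 / (2 * t)) * (exp (0 * norm (z - x) - 1 / (10 * t) * (norm (z - x))\<^sup>2) * gauss_weighted t f x))"
      using t by (intro integrable_mult_right fock_gauss_integrable[OF t p f]) simp
    show "integrable lborel (\<lambda>u :: complex ^ 'n. exp (- (1 / (10 * t)) * (norm u)\<^sup>2))"
      using t by (intro integrable_exp_neg_norm_square) simp
    fix x u
    let ?T = "norm (twisted_gauss t a (z - x) u)"
    have CD: "norm (\<psi> x * \<phi> y) \<le> D * C" for x y
      unfolding norm_mult by (intro mult_mono C D) auto
    have "norm (?k (x, u)) = norm (f x * fock_exp t z x) * (\<bar>r\<bar> * indicator S u *
       norm (\<psi> (x - a *\<^sub>R (z - x)) * \<phi> (x - a *\<^sub>R (z - x) + u)) * ?T)"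
      unfolding prod.case norm_mult norm_indicator_complex norm_of_real by simp
    also have "\<dots> \<le> norm (f x * fock_exp t z x) * (\<bar>r\<bar> * 1 * (D * C) * ?T)"
      by (intro mult_left_mono mult_right_mono mult_mono CD) (auto simp: indicator_def C D)
    also have "\<dots> = \<bar>r\<bar> * (D * C) * exp ((norm z)\<^sup>2 / (2 * t)) * gauss_weighted t f x * (?T * exp (- (norm (z - x))\<^sup>2 / (2 * t)))"
      unfolding norm_mult_fock_exp[OF t] by (simp add: mult_ac)
    also have "\<dots> \<le> \<bar>r\<bar> * (D * C) * exp ((norm z)\<^sup>2 / (2 * t)) * gauss_weighted t f x * (exp (- (1 / (10 * t)) * (norm (z - x))\<^sup>2) * exp (- (1 / (10 * t)) * (norm u)\<^sup>2))"
      using C D by (intro mult_left_mono twisted_gauss_bound[OF t a]) (auto simp: gauss_weighted_nonneg)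
    finally show "norm (?k (x, u)) \<le> \<bar>r\<bar> * (D * C) * exp ((norm z)\<^sup>2 / (2 * t)) * (exp (0 * norm (z - x) - 1 / (10 * t) * (norm (z - x))\<^sup>2) * gauss_weighted t f x) * exp (- (1 / (10 * t)) * (norm u)\<^sup>2)"
      by (simp add: mult_ac)
  qed
qed

text \<open>
  With \<open>s = t * a / (1 + a)\<close>, the substitution \<open>v = x - a *\<^sub>R (z - x)\<close> turns the argument
  \<open>v + (s / t) *\<^sub>R (z - v)\<close> of \<open>f\<close> in the reproducing formula into \<open>x\<close>.
\<close>

lemma toeplitz_conv_eq:
  fixes f :: "complex ^ 'n::finite \<Rightarrow> complex"
  assumes t: "t > 0" and p: "p > 1" and f: "f \<in> fock t p" and \<phi>: "\<phi> \<in> BUC" and \<psi>: "\<psi> \<in> BUC"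
    and a: "0 < a" "a \<le> 1" and R: "0 \<le> R" and s: "s = t * a / (1 + a)"
    and \<Phi>: "\<Phi> \<in> BUC" "\<And>v. \<Phi> v = (LINT q|lborel. (of_real (1 / (pi * t) ^ CARD('n)) * conv_kernel t s R q) * (\<psi> (v + snd q) * \<phi> (v + snd q + fst q)))"
  shows "toeplitz t p \<Phi> f z = (of_real (1 / (pi * t) ^ CARD('n)))\<^sup>2 *
    (LINT x|lborel. LINT u|lborel. f x * fock_exp t z x * (of_real ((1 + a) ^ DIM(complex ^ 'n)) * indicator (cball 0 R) u *
      (\<psi> (x - a *\<^sub>R (z - x)) * \<phi> (x - a *\<^sub>R (z - x) + u)) * twisted_gauss t a (z - x) u))"
proof -
  let ?c = "complex_of_real (1 / (pi * t) ^ CARD('n))"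
  let ?D = "DIM(complex ^ 'n)"
  have s0: "0 < s" "s < t" using a t by (auto simp: s field_simps)
  have st: "s / t = a / (1 + a)" using t by (simp add: s)
  obtain C where C: "0 \<le> C" "\<And>x. norm (\<phi> x) \<le> C" using BUC_bounded[OF \<phi>] by metis
  obtain D where D: "0 \<le> D" "\<And>x. norm (\<psi> x) \<le> D" using BUC_bounded[OF \<psi>] by metis
  have CD: "norm (\<psi> x * \<phi> y) \<le> D * C" for x y
    unfolding norm_mult by (intro mult_mono C D) auto
  note cf = entire_continuous_on[OF fock_entire[OF f]]
  note kap = conv_kernel_integrable[OF s0 R, where 'n='n]
  define g where "g v = f v * fock_exp t z v" for v
  have ig: "integrable lborel g" unfolding g_def by (rule fock_exp_integrable[OF t p f])
  have cg: "continuous_on S g" for S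
    unfolding g_def using t by (intro continuous_intros cf) auto
  define P where "P u x = \<psi> x * \<phi> (x + u)" for u x
  define A where "A u = indicator (cball 0 R) u * exp (- hdot u u / complex_of_real t)" for u :: "complex ^ 'n"
  let ?w = "shift_weight t s :: complex ^ 'n \<Rightarrow> _"
  define k1 where "k1 = (\<lambda>(q, v). conv_kernel t s R q * (P (fst q) (v + snd q) * g v))"
  have ik1: "integrable (lborel \<Otimes>\<^sub>M lborel) k1"
  proof (rule integrable_pair_dominated)
    have "(\<lambda>q :: ((complex ^ 'n) \<times> (complex ^ 'n)) \<times> (complex ^ 'n). P (fst (fst q)) (snd q + snd (fst q)) * g (snd q)) \<in> borel_measurable (lborel \<Otimes>\<^sub>M lborel)"
      unfolding lborel_prod P_def
      by (auto intro!: borel_measurable_continuous_onI continuous_intros BUC_mult_shift[OF \<phi> \<psi>] continuous_on_compose2[OF cg, of UNIV])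
    moreover have "(\<lambda>q :: ((complex ^ 'n) \<times> (complex ^ 'n)) \<times> (complex ^ 'n). conv_kernel t s R (fst q)) \<in> borel_measurable (lborel \<Otimes>\<^sub>M lborel)"
      using borel_measurable_integrable[OF kap] by (intro measurable_compose[OF measurable_fst]) simp
    ultimately show "k1 \<in> borel_measurable (lborel \<Otimes>\<^sub>M lborel)"
      unfolding k1_def case_prod_beta' by (rule borel_measurable_times[rotated])
    show "integrable lborel (\<lambda>q :: (complex ^ 'n) \<times> (complex ^ 'n). D * C * norm (conv_kernel t s R q))"
      by (intro integrable_mult_right integrable_norm kap)
    show "integrable lborel (\<lambda>v. norm (g v))" by (intro integrable_norm ig)
    fix q v
    have "norm (P (fst q) (v + snd q)) * (norm (conv_kernel t s R q) * norm (g v)) \<le> D * C * (norm (conv_kernel t s R q) * norm (g v))"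
      unfolding P_def by (intro mult_right_mono CD) auto
    then show "norm (k1 (q, v)) \<le> D * C * norm (conv_kernel t s R q) * norm (g v)"
      by (simp add: k1_def norm_mult mult_ac)
  qed
  have "\<Phi> v * f v * fock_exp t z v = ?c * (LINT q|lborel. k1 (q, v))" for v
  proof -
    have "(LINT q|lborel. k1 (q, v)) = (LINT q|lborel. g v * (conv_kernel t s R q * (\<psi> (v + snd q) * \<phi> (v + snd q + fst q))))"
      by (simp add: k1_def P_def mult_ac)
    also have "\<dots> = g v * (LINT q|lborel. conv_kernel t s R q * (\<psi> (v + snd q) * \<phi> (v + snd q + fst q)))"
      by (rule integral_mult_right_zero)
    finally show ?thesis unfolding \<Phi>(2) by (simp only: mult.assoc integral_mult_right_zero g_def) (simp add: mult_ac)
  qed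
  then have "toeplitz t p \<Phi> f z = ?c * (LINT v|lborel. ?c * (LINT q|lborel. k1 (q, v)))"
    unfolding toeplitz_eq[OF t f \<Phi>(1)] by simp
  also have "\<dots> = ?c\<^sup>2 * (LINT v|lborel. LINT q|lborel. k1 (q, v))"
    by (simp only: integral_mult_right_zero power2_eq_square mult.assoc)
  also have "(LINT v|lborel. LINT q|lborel. k1 (q, v)) = (LINT q|lborel. LINT v|lborel. k1 (q, v))"
    using lborel_pair.Fubini_integral[of "\<lambda>q v. k1 (q, v)"] ik1 by simp
  also have "\<dots> = (LINT u|lborel. LINT h|lborel. LINT v|lborel. k1 ((u, h), v))"
  proof -
    have "integrable (lborel \<Otimes>\<^sub>M lborel) (\<lambda>q. LINT v|lborel. k1 (q, v))"
      using lborel_pair.integrable_fst'[OF ik1] by (simp add: lborel_prod)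
    from lborel_pair.integral_fst'[OF this] show ?thesis by (simp add: lborel_prod)
  qed
  also have "\<dots> = (LINT u|lborel. LINT x|lborel. f x * fock_exp t z x * (of_real ((1 + a) ^ ?D) * indicator (cball 0 R) u *
      (\<psi> (x - a *\<^sub>R (z - x)) * \<phi> (x - a *\<^sub>R (z - x) + u)) * twisted_gauss t a (z - x) u))"
  proof (rule Bochner_Integration.integral_cong[OF refl])
    fix u :: "complex ^ 'n"
    \<comment> \<open>After \<open>v\<close> is replaced by \<open>v - h\<close> the symbols no
      longer depend on \<open>h\<close>, and the \<open>h\<close>-integral meets only
      \<open>g\<close>, where the reproducing formula evaluates it.\<close>
    define k3 where "k3 = (\<lambda>(h, v). A u * (P u v * (?w u h * g (v - h))))"
    have "(LINT v|lborel. k1 ((u, h), v)) = (LINT v|lborel. k3 (h, v))" for h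
    proof -
      have "(\<lambda>v. k3 (h, v)) \<in> borel_measurable borel"
        unfolding k3_def prod.case P_def
        by (intro borel_measurable_continuous_onI continuous_intros BUC_mult_shift[OF \<phi> \<psi>] continuous_on_compose2[OF cg, of UNIV]) auto
      from lborel_integral_translate[OF this, of h]
      show ?thesis by (simp add: k1_def k3_def conv_kernel_def A_def mult_ac)
    qed
    then have "(LINT h|lborel. LINT v|lborel. k1 ((u, h), v)) = (LINT h|lborel. LINT v|lborel. k3 (h, v))" by simp
    also have "\<dots> = (LINT v|lborel. LINT h|lborel. k3 (h, v))"
    proof -
      have iw: "integrable (lborel \<Otimes>\<^sub>M lborel) (\<lambda>(h, v). ?w u h * g (v - h))"
        by (rule integrable_pair_convolution[OF shift_weight_integrable[OF s0] ig])
      have "integrable (lborel \<Otimes>\<^sub>M lborel) k3"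
      proof (rule Bochner_Integration.integrable_bound[OF integrable_mult_right[OF integrable_norm[OF iw], of "norm (A u) * (D * C)"] _ AE_I2])
        show "k3 \<in> borel_measurable (lborel \<Otimes>\<^sub>M lborel)"
          unfolding k3_def case_prod_beta' lborel_prod P_def using s0 t
          by (auto intro!: borel_measurable_continuous_onI continuous_intros BUC_mult_shift[OF \<phi> \<psi>] continuous_on_compose2[OF cg, of UNIV])
        fix q :: "(complex ^ 'n) \<times> (complex ^ 'n)"
        obtain h v where q: "q = (h, v)" by (cases q)
        have "norm (A u) * (norm (P u v) * norm (?w u h * g (v - h))) \<le> norm (A u) * ((D * C) * norm (?w u h * g (v - h)))"
          unfolding P_def by (intro mult_left_mono mult_right_mono CD) auto
        then show "norm (k3 q) \<le> norm (norm (A u) * (D * C) * norm (case q of (h, v) \<Rightarrow> ?w u h * g (v - h)))"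
          using C D by (simp add: q k3_def norm_mult abs_mult mult_ac)
      qed
      then show ?thesis using lborel_pair.Fubini_integral[of "\<lambda>h v. k3 (h, v)"] by simp
    qed
    also have "\<dots> = (LINT v|lborel. A u * (P u v * (f (v + (s / t) *\<^sub>R (z - v)) * (fock_exp t z v * exp ((hdot (z - v) u - of_real (s / t) * hdot (z - v) v) / of_real t)))))"
      unfolding k3_def prod.case integral_mult_right_zero g_def shift_weight_reproducing[OF s0 p f] ..
    also have "\<dots> = \<bar>1 + a\<bar> ^ ?D *\<^sub>R (LINT x|lborel. f x * fock_exp t z x * (indicator (cball 0 R) u *
      (\<psi> (x - a *\<^sub>R (z - x)) * \<phi> (x - a *\<^sub>R (z - x) + u)) * twisted_gauss t a (z - x) u))"
    proof (subst lborel_integral_affine[of "1 + a" _ "- a *\<^sub>R z"])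
      show "1 + a \<noteq> 0" using a by simp
      show "(\<lambda>v. A u * (P u v * (f (v + (s / t) *\<^sub>R (z - v)) * (fock_exp t z v * exp ((hdot (z - v) u - of_real (s / t) * hdot (z - v) v) / of_real t))))) \<in> borel_measurable borel"
        unfolding P_def using t
        by (intro borel_measurable_continuous_onI continuous_intros BUC_mult_shift[OF \<phi> \<psi>] continuous_on_compose2[OF cf, of UNIV]) auto
      show "\<bar>1 + a\<bar> ^ ?D *\<^sub>R (LINT x|lborel. (\<lambda>v. A u * (P u v * (f (v + (s / t) *\<^sub>R (z - v)) * (fock_exp t z v * exp ((hdot (z - v) u - of_real (s / t) * hdot (z - v) v) / of_real t))))) (- a *\<^sub>R z + (1 + a) *\<^sub>R x)) =
         \<bar>1 + a\<bar> ^ ?D *\<^sub>R (LINT x|lborel. f x * fock_exp t z x * (indicator (cball 0 R) u *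
      (\<psi> (x - a *\<^sub>R (z - x)) * \<phi> (x - a *\<^sub>R (z - x) + u)) * twisted_gauss t a (z - x) u))"
      proof (intro arg_cong[where f="\<lambda>x. \<bar>1 + a\<bar> ^ ?D *\<^sub>R x"] Bochner_Integration.integral_cong refl)
        fix x
        let ?v = "- a *\<^sub>R z + (1 + a) *\<^sub>R x"
        have v: "?v = x - a *\<^sub>R (z - x)" by (simp add: algebra_simps)
        have zv: "z - ?v = (1 + a) *\<^sub>R (z - x)" by (simp add: algebra_simps)
        have "(s / t) *\<^sub>R (z - ?v) = a *\<^sub>R (z - x)" unfolding zv st using a by simp
        then have fx: "?v + (s / t) *\<^sub>R (z - ?v) = x" unfolding v by simp
        \<comment> \<open>Since \<open>1 - s / t = 1 / (1 + a)\<close>, this factor undoes the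
          dilation in \<open>z - ?v\<close>. Expanding \<open>?v\<close> then yields the exponent of
          \<open>fock_exp t z x\<close> and the term \<open>- a * hdot y y\<close> of
          \<open>twisted_gauss\<close>, with \<open>y = z - x\<close>.\<close>
        have "hdot (z - ?v) ?v - of_real (s / t) * hdot (z - ?v) ?v = hdot (z - x) ?v"
        proof -
          have "(1 - complex_of_real (s / t)) * of_real (1 + a) = 1"
          proof -
            have "(1 - s / t) * (1 + a) = 1" unfolding st using a by (simp add: field_simps)
            then show ?thesis by (metis of_real_1 of_real_diff of_real_mult)
          qed
          moreover have "hdot (z - ?v) ?v - of_real (s / t) * hdot (z - ?v) ?v = (1 - complex_of_real (s / t)) * of_real (1 + a) * hdot (z - x) ?v"
            by (simp only: zv hdot_simps(9) left_diff_distrib mult_1_left mult.assoc)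
          ultimately show ?thesis by simp
        qed
        also have "\<dots> = hdot (z - x) x - of_real a * hdot (z - x) (z - x)"
          unfolding v by (simp add: hdot_simps algebra_simps)
        finally have "- hdot u u / of_real t + (hdot (z - ?v) ?v / of_real t + (hdot (z - ?v) u - of_real (s / t) * hdot (z - ?v) ?v) / of_real t)
          = hdot (z - x) x / of_real t + (- (of_real a * hdot (z - x) (z - x)) + of_real (1 + a) * hdot (z - x) u - hdot u u) / of_real t"
          unfolding add_divide_distrib[symmetric] zv hdot_simps(9) by (simp add: algebra_simps)
        then have "exp (- hdot u u / of_real t) * (fock_exp t z ?v * exp ((hdot (z - ?v) u - of_real (s / t) * hdot (z - ?v) ?v) / of_real t))
          = fock_exp t z x * twisted_gauss t a (z - x) u"
          unfolding fock_exp_def twisted_gauss_def exp_add[symmetric] by (simp only:)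
        then have "A u * (P u ?v * (f x * (fock_exp t z ?v * exp ((hdot (z - ?v) u - of_real (s / t) * hdot (z - ?v) ?v) / of_real t))))
          = indicator (cball 0 R) u * P u ?v * f x * (fock_exp t z x * twisted_gauss t a (z - x) u)"
          unfolding A_def by (simp only: mult.assoc mult.left_commute)
        then show "A u * (P u ?v * (f (?v + (s / t) *\<^sub>R (z - ?v)) * (fock_exp t z ?v * exp ((hdot (z - ?v) u - of_real (s / t) * hdot (z - ?v) ?v) / of_real t))))
          = f x * fock_exp t z x * (indicator (cball 0 R) u * (\<psi> (x - a *\<^sub>R (z - x)) * \<phi> (x - a *\<^sub>R (z - x) + u)) * twisted_gauss t a (z - x) u)"
          unfolding fx by (rule trans) (simp only: P_def v mult_ac)
      qed
    qed
    also have "\<dots> = (LINT x|lborel. f x * fock_exp t z x * (of_real ((1 + a) ^ ?D) * indicator (cball 0 R) u *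
      (\<psi> (x - a *\<^sub>R (z - x)) * \<phi> (x - a *\<^sub>R (z - x) + u)) * twisted_gauss t a (z - x) u))"
      using a unfolding integral_scaleR_right[symmetric] by (simp add: scaleR_conv_of_real mult_ac)
    finally show "(LINT h|lborel. LINT v|lborel. k1 ((u, h), v)) = \<dots>" .
  qed
  also have "\<dots> = (LINT x|lborel. LINT u|lborel. f x * fock_exp t z x * (of_real ((1 + a) ^ ?D) * indicator (cball 0 R) u *
      (\<psi> (x - a *\<^sub>R (z - x)) * \<phi> (x - a *\<^sub>R (z - x) + u)) * twisted_gauss t a (z - x) u))"
    using lborel_pair.Fubini_integral[of "\<lambda>x u. f x * fock_exp t z x * (of_real ((1 + a) ^ ?D) * indicator (cball 0 R) u *
      (\<psi> (x - a *\<^sub>R (z - x)) * \<phi> (x - a *\<^sub>R (z - x) + u)) * twisted_gauss t a (z - x) u)"]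
      twisted_gauss_symbol_integrable[OF t p f \<phi> \<psi> _ a(2), of "cball 0 R" z "(1 + a) ^ ?D"] a
    by (simp del: of_real_power)
  finally show ?thesis .
qed

section \<open>Norm estimate and the main theorem\<close>

text \<open>
  Here \<open>B\<close> bounds the products \<open>\<psi> x * \<phi> (x + u)\<close>, and \<open>\<epsilon> + L * r\<close> bounds their variation over
  distance \<open>r\<close>; unlike the modulus of continuity, this affine bound is trivially measurable.
\<close>

definition diff_kernel ::
  "real \<Rightarrow> real \<Rightarrow> real \<Rightarrow> real \<Rightarrow> real \<Rightarrow> real \<Rightarrow> complex ^ 'n::finite \<Rightarrow> complex ^ 'n \<Rightarrow> real" where
  "diff_kernel t B \<epsilon> L a R y u = exp (- (norm y)\<^sup>2 / (2 * t)) *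
     (B * norm (twisted_gauss t 0 y u - of_real ((1 + a) ^ DIM(complex ^ 'n)) * indicator (cball 0 R) u * twisted_gauss t a y u)
      + (1 + a) ^ DIM(complex ^ 'n) * norm (twisted_gauss t a y u) * (\<epsilon> + L * (a * norm y)))"

lemma diff_kernel_measurable:
  assumes t: "t > 0"
  shows "(\<lambda>q. diff_kernel t B \<epsilon> L a R (fst q) (snd q)) \<in> borel_measurable (lborel \<Otimes>\<^sub>M lborel)"
proof -
  have [measurable]: "(\<lambda>q. twisted_gauss t a (fst q) (snd q)) \<in> borel_measurable (borel :: ((complex ^ 'n::finite) \<times> (complex ^ 'n)) measure)" for a
    using t by (intro borel_measurable_continuous_onI continuous_intros) auto
  have [measurable]: "(\<lambda>q :: (complex ^ 'n) \<times> (complex ^ 'n). indicator (cball 0 R) (snd q) :: complex) \<in> borel_measurable borel"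
    unfolding borel_prod[symmetric]
    by (intro measurable_compose[OF measurable_snd] borel_measurable_indicator) simp
  have [measurable]: "(\<lambda>q. norm (fst q)) \<in> borel_measurable (borel :: ((complex ^ 'n) \<times> (complex ^ 'n)) measure)"
    by (intro borel_measurable_continuous_onI continuous_intros)
  show ?thesis unfolding diff_kernel_def lborel_prod measurable_lborel1 by measurable
qed

text \<open>The majorant is free of \<open>a\<close> and \<open>R\<close>, as dominated convergence
  requires. The factor \<open>exp (norm y)\<close> absorbs both the constant
  \<open>\<epsilon>\<close> and the term linear in \<open>norm y\<close>.\<close>

lemma
  fixes y u :: "complex ^ 'n::finite"
  assumes t: "t > 0" and a: "0 \<le> a" "a \<le> 1" and B: "0 \<le> B" and e: "0 \<le> \<epsilon>" "0 \<le> L"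
  shows diff_kernel_nonneg: "0 \<le> diff_kernel t B \<epsilon> L a R y u"
    and diff_kernel_le: "diff_kernel t B \<epsilon> L a R y u \<le> (B * (1 + 2 ^ DIM(complex ^ 'n)) + 2 ^ DIM(complex ^ 'n) * (\<epsilon> + L)) *
      exp (1 * norm y - 1 / (10 * t) * (norm y)\<^sup>2) * exp (- (1 / (10 * t)) * (norm u)\<^sup>2)"
proof -
  let ?D = "DIM(complex ^ 'n)" and ?w = "exp (- (norm y)\<^sup>2 / (2 * t))"
  let ?M = "(1 + a) ^ ?D"
  let ?E = "exp (- (1 / (10 * t)) * (norm y)\<^sup>2) * exp (- (1 / (10 * t)) * (norm u)\<^sup>2)"
  let ?n0 = "norm (twisted_gauss t 0 y u)" and ?na = "norm (twisted_gauss t a y u)"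
  show "0 \<le> diff_kernel t B \<epsilon> L a R y u"
    unfolding diff_kernel_def using a B e by (intro mult_nonneg_nonneg add_nonneg_nonneg) auto
  have M: "0 \<le> ?M" "?M \<le> 2 ^ ?D" using a by (auto intro!: power_mono)
  have n0: "?n0 * ?w \<le> ?E" and na: "?na * ?w \<le> ?E" using twisted_gauss_bound[OF t, of 0 y u] twisted_gauss_bound[OF t a, of y u] by simp_all
  have ey: "1 \<le> exp (norm y)" "norm y \<le> exp (norm y)"
    using exp_ge_add_one_self[of "norm y"] norm_ge_zero[of y] by linarith+
  have tri: "norm (twisted_gauss t 0 y u - of_real ?M * indicator (cball 0 R) u * twisted_gauss t a y u) \<le> ?n0 + ?M * ?na"
  proof (rule order_trans[OF norm_triangle_ineq4 add_left_mono])
    have "norm (of_real ?M * indicator (cball 0 R) u * twisted_gauss t a y u) = ?M * indicator (cball 0 R) u * ?na"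
      using M unfolding norm_mult norm_of_real norm_indicator_complex by simp
    also have "\<dots> \<le> ?M * 1 * ?na" using M by (intro mult_right_mono mult_left_mono) (auto simp: indicator_def)
    finally show "norm (of_real ?M * indicator (cball 0 R) u * twisted_gauss t a y u) \<le> ?M * ?na" by simp
  qed
  have "\<epsilon> + L * (a * norm y) \<le> \<epsilon> * exp (norm y) + L * (1 * exp (norm y))"
    using a e ey mult_left_mono[OF ey(1) e(1)] by (intro add_mono mult_left_mono mult_mono) auto
  then have lin: "\<epsilon> + L * (a * norm y) \<le> (\<epsilon> + L) * exp (norm y)" by (simp add: distrib_right)
  have "diff_kernel t B \<epsilon> L a R y u \<le> ?w * (B * (?n0 + ?M * ?na) + ?M * ?na * ((\<epsilon> + L) * exp (norm y)))"
    unfolding diff_kernel_def using B M by (intro mult_left_mono add_mono tri lin) auto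
  also have "\<dots> = B * (?n0 * ?w) + B * (?M * (?na * ?w)) + ?M * ((?na * ?w) * ((\<epsilon> + L) * exp (norm y)))"
    by (simp add: algebra_simps)
  also have "\<dots> \<le> B * (exp (norm y) * ?E) + B * (2 ^ ?D * (exp (norm y) * ?E)) + 2 ^ ?D * (?E * ((\<epsilon> + L) * exp (norm y)))"
  proof -
    have "?E \<le> exp (norm y) * ?E" using mult_right_mono[OF ey(1), of ?E] by simp
    then have e0: "?n0 * ?w \<le> exp (norm y) * ?E" and ea: "?na * ?w \<le> exp (norm y) * ?E" using n0 na by linarith+
    have "?M * (?na * ?w) \<le> 2 ^ ?D * (exp (norm y) * ?E)" by (rule mult_mono[OF M(2) ea]) simp_all
    moreover have "?M * ((?na * ?w) * ((\<epsilon> + L) * exp (norm y))) \<le> 2 ^ ?D * (?E * ((\<epsilon> + L) * exp (norm y)))"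
      by (rule mult_mono[OF M(2) mult_right_mono[OF na]]) (use e in simp_all)
    ultimately show ?thesis by (intro add_mono mult_left_mono[OF e0 B] mult_left_mono[OF _ B])
  qed
  also have "\<dots> = (B * (1 + 2 ^ ?D) + 2 ^ ?D * (\<epsilon> + L)) * (exp (norm y) * exp (- (1 / (10 * t)) * (norm y)\<^sup>2)) * exp (- (1 / (10 * t)) * (norm u)\<^sup>2)"
    by (simp add: algebra_simps)
  also have "exp (norm y) * exp (- (1 / (10 * t)) * (norm y)\<^sup>2) = exp (1 * norm y - 1 / (10 * t) * (norm y)\<^sup>2)"
    by (simp add: exp_add[symmetric])
  finally show "diff_kernel t B \<epsilon> L a R y u \<le> (B * (1 + 2 ^ ?D) + 2 ^ ?D * (\<epsilon> + L)) *
      exp (1 * norm y - 1 / (10 * t) * (norm y)\<^sup>2) * exp (- (1 / (10 * t)) * (norm u)\<^sup>2)" .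
qed

lemma diff_kernel_integrable:
  assumes t: "t > 0" and a: "0 \<le> a" "a \<le> 1" and B: "0 \<le> B" and e: "0 \<le> \<epsilon>" "0 \<le> L"
  shows "integrable (lborel \<Otimes>\<^sub>M lborel) (\<lambda>(y :: complex ^ 'n::finite, u). diff_kernel t B \<epsilon> L a R y u)"
proof (rule integrable_pair_dominated)
  show "(\<lambda>(y :: complex ^ 'n, u). diff_kernel t B \<epsilon> L a R y u) \<in> borel_measurable (lborel \<Otimes>\<^sub>M lborel)"
    using diff_kernel_measurable[OF t] by (simp add: case_prod_beta')
  show "integrable lborel (\<lambda>y :: complex ^ 'n. (B * (1 + 2 ^ DIM(complex ^ 'n)) + 2 ^ DIM(complex ^ 'n) * (\<epsilon> + L)) *
      exp (1 * norm y - 1 / (10 * t) * (norm y)\<^sup>2))"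
    using t by (intro integrable_mult_right integrable_exp_linear_gauss) simp
  show "integrable lborel (\<lambda>u :: complex ^ 'n. exp (- (1 / (10 * t)) * (norm u)\<^sup>2))"
    using t by (intro integrable_exp_neg_norm_square) simp
  show "norm (case (y, u) of (y, u) \<Rightarrow> diff_kernel t B \<epsilon> L a R y u) \<le> (B * (1 + 2 ^ DIM(complex ^ 'n)) + 2 ^ DIM(complex ^ 'n) * (\<epsilon> + L)) *
      exp (1 * norm y - 1 / (10 * t) * (norm y)\<^sup>2) * exp (- (1 / (10 * t)) * (norm u)\<^sup>2)" for y u :: "complex ^ 'n"
    using diff_kernel_le[OF t a B e, of R y u] diff_kernel_nonneg[OF t a B e, of R y u] by simp
qed

text \<open>Both operators have been written with the common factor
  \<open>f x * fock_exp t z x\<close>, so they can be subtracted under one integral. Integrating out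
  \<open>u\<close> leaves a convolution kernel in \<open>z - x\<close>.\<close>

lemma toeplitz_comp_diff_norm_le:
  fixes \<phi> \<psi> :: "complex ^ 'n::finite \<Rightarrow> complex"
  assumes t: "t > 0" and p: "p > 1" and \<phi>: "\<phi> \<in> BUC" and \<psi>: "\<psi> \<in> BUC"
    and a: "0 < a" "a \<le> 1" and R: "0 \<le> R" and s: "s = t * a / (1 + a)"
    and \<Phi>: "\<Phi> \<in> BUC" "\<And>v. \<Phi> v = (LINT q|lborel. (of_real (1 / (pi * t) ^ CARD('n)) * conv_kernel t s R q) * (\<psi> (v + snd q) * \<phi> (v + snd q + fst q)))"
    and B: "0 \<le> B" "\<And>x y. norm (\<psi> x * \<phi> y) \<le> B" and e: "0 \<le> \<epsilon>" "0 \<le> L"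
    and L: "\<And>u x x'. norm (\<psi> x * \<phi> (x + u) - \<psi> x' * \<phi> (x' + u)) \<le> \<epsilon> + L * norm (x - x')"
  shows "op_norm t p ((toeplitz t p \<phi> \<circ> toeplitz t p \<psi>) - toeplitz t p \<Phi>) \<le>
    (1 / (pi * t) ^ CARD('n))\<^sup>2 * integral\<^sup>L (lborel \<Otimes>\<^sub>M lborel) (\<lambda>(y :: complex ^ 'n, u). diff_kernel t B \<epsilon> L a R y u)"
proof -
  let ?N = "1 / (pi * t) ^ CARD('n)"
  let ?D = "DIM(complex ^ 'n)"
  let ?Q = "diff_kernel t B \<epsilon> L a R :: complex ^ 'n \<Rightarrow> _"
  let ?M = "(1 + a) ^ ?D"
  have a': "0 \<le> a" using a by simp
  note Qint = diff_kernel_integrable[OF t a' a(2) B(1) e, of R, where 'n='n]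
  note Q0 = diff_kernel_nonneg[OF t a' a(2) B(1) e]
  let ?K = "B * (1 + 2 ^ ?D) + 2 ^ ?D * (\<epsilon> + L)"
  have K0: "0 \<le> ?K" using B e by simp
  define H where "H y = ?N\<^sup>2 * (LINT u|lborel. ?Q y u)" for y
  have iH: "integrable lborel H" unfolding H_def
    using lborel_pair.integrable_fst'[OF Qint] by (intro integrable_mult_right) simp
  have intH: "integral\<^sup>L lborel H = ?N\<^sup>2 * integral\<^sup>L (lborel \<Otimes>\<^sub>M lborel) (\<lambda>(y, u). ?Q y u)"
    unfolding H_def integral_mult_right_zero using lborel_pair.integral_fst'[OF Qint] by simp
  have H0: "0 \<le> H y" for y unfolding H_def by (intro mult_nonneg_nonneg Bochner_Integration.integral_nonneg Q0) simp
  have iG: "integrable lborel (\<lambda>u :: complex ^ 'n. exp (- (1 / (10 * t)) * (norm u)\<^sup>2))"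
    using t by (intro integrable_exp_neg_norm_square) simp
  let ?G = "LINT u|lborel. exp (- (1 / (10 * t)) * (norm (u :: complex ^ 'n))\<^sup>2)"
  \<comment> \<open>The uniform bound on the kernel demanded by Young's inequality.\<close>
  have HB: "H y \<le> ?N\<^sup>2 * (?K * exp (1\<^sup>2 / (2 * (1 / (10 * t)))) * ?G)" for y
    unfolding H_def
  proof (intro mult_left_mono)
    let ?c = "?K * exp (1 * norm y - 1 / (10 * t) * (norm y)\<^sup>2)"
    have m: "(\<lambda>u. ?Q y u) \<in> borel_measurable lborel"
    proof -
      have "Pair y \<in> lborel \<rightarrow>\<^sub>M lborel \<Otimes>\<^sub>M (lborel :: (complex ^ 'n) measure)"
        by (rule measurable_Pair1') simp
      from measurable_compose[OF this diff_kernel_measurable[OF t, of B \<epsilon> L a R]] show ?thesis by simp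
    qed
    have "(LINT u|lborel. ?Q y u) \<le> (LINT u|lborel. ?c * exp (- (1 / (10 * t)) * (norm (u :: complex ^ 'n))\<^sup>2))"
    proof (rule integral_mono)
      show i: "integrable lborel (\<lambda>u :: complex ^ 'n. ?c * exp (- (1 / (10 * t)) * (norm u)\<^sup>2))"
        by (intro integrable_mult_right iG)
      show "integrable lborel (\<lambda>u. ?Q y u)"
      proof (rule Bochner_Integration.integrable_bound[OF i m AE_I2])
        show "norm (?Q y u) \<le> norm (?c * exp (- (1 / (10 * t)) * (norm u)\<^sup>2))" for u
          using order_trans[OF diff_kernel_le[OF t a' a(2) B(1) e, of R y u] abs_ge_self] Q0[of R y u] by simp
      qed
      show "?Q y u \<le> ?c * exp (- (1 / (10 * t)) * (norm u)\<^sup>2)" for u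
        by (rule diff_kernel_le[OF t a' a(2) B(1) e])
    qed
    also have "\<dots> = ?c * ?G" by (rule integral_mult_right_zero)
    also have "\<dots> \<le> ?K * exp (1\<^sup>2 / (2 * (1 / (10 * t)))) * ?G"
      using t K0 by (intro mult_right_mono mult_left_mono exp_linear_gauss_le) auto
    finally show "(LINT u|lborel. ?Q y u) \<le> ?K * exp (1\<^sup>2 / (2 * (1 / (10 * t)))) * ?G" .
  qed simp
  show ?thesis unfolding intH[symmetric]
  proof (rule op_norm_le)
    show "0 \<le> integral\<^sup>L lborel H" using H0 by simp
    fix f :: "complex ^ 'n \<Rightarrow> complex" assume f: "f \<in> fock t p"
    let ?g = "((toeplitz t p \<phi> \<circ> toeplitz t p \<psi>) - toeplitz t p \<Phi>) f"
    have "(toeplitz t p \<phi> \<circ> toeplitz t p \<psi>) - toeplitz t p \<Phi> \<in> bounded_ops t p"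
      by (intro bounded_ops_diff[OF t p] bounded_ops_comp[OF p] toeplitz_bounded[OF t p] \<phi> \<psi> \<Phi>)
    then have eg: "entire ?g" using f bounded_opsD(1) fock_entire by blast
    show "fock_norm t p ?g \<le> integral\<^sup>L lborel H * fock_norm t p f"
    proof (rule fock_kernel_norm_le[OF t p f eg iH H0 HB])
      fix z
      define k0 where "k0 = (\<lambda>(x, u). f x * fock_exp t z x * (\<psi> x * \<phi> (x + u) * twisted_gauss t 0 (z - x) u))"
      define k2 where "k2 = (\<lambda>(x, u). f x * fock_exp t z x * (of_real ?M * indicator (cball 0 R) u *
        (\<psi> (x - a *\<^sub>R (z - x)) * \<phi> (x - a *\<^sub>R (z - x) + u)) * twisted_gauss t a (z - x) u))"
      have i0: "integrable (lborel \<Otimes>\<^sub>M lborel) k0"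
        using twisted_gauss_symbol_integrable[OF t p f \<phi> \<psi> _ _ _ , of 0 UNIV z 1] by (simp add: k0_def)
      have i2: "integrable (lborel \<Otimes>\<^sub>M lborel) k2"
        unfolding k2_def by (rule twisted_gauss_symbol_integrable[OF t p f \<phi> \<psi> a' a(2)]) simp
      let ?c = "complex_of_real ?N"
      let ?h = "\<lambda>(x, u). exp ((norm z)\<^sup>2 / (2 * t)) * (gauss_weighted t f x * ?Q (z - x) u)"
      have ih: "integrable (lborel \<Otimes>\<^sub>M lborel) ?h"
      proof (rule integrable_pair_dominated)
        have 1: "(\<lambda>q. (z - fst q, snd q)) \<in> lborel \<Otimes>\<^sub>M lborel \<rightarrow>\<^sub>M lborel \<Otimes>\<^sub>M (lborel :: (complex ^ 'n) measure)"
          by measurable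
        have 2: "(\<lambda>q :: (complex ^ 'n) \<times> (complex ^ 'n). ?Q (z - fst q) (snd q)) \<in> borel_measurable (lborel \<Otimes>\<^sub>M lborel)"
          using measurable_compose[OF 1 diff_kernel_measurable[OF t, of B \<epsilon> L a R]] by simp
        have 3: "(\<lambda>q :: (complex ^ 'n) \<times> (complex ^ 'n). gauss_weighted t f (fst q)) \<in> borel_measurable (lborel \<Otimes>\<^sub>M lborel)"
          using gauss_weighted_borel[OF fock_entire[OF f]] by (intro measurable_compose[OF measurable_fst]) simp
        show "?h \<in> borel_measurable (lborel \<Otimes>\<^sub>M lborel)"
          unfolding case_prod_beta' by (intro borel_measurable_times borel_measurable_const 2 3)
        show "integrable lborel (\<lambda>x. exp ((norm z)\<^sup>2 / (2 * t)) * ?K * (exp (1 * norm (z - x) - 1 / (10 * t) * (norm (z - x))\<^sup>2) * gauss_weighted t f x))"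
          using t by (intro integrable_mult_right fock_gauss_integrable[OF t p f]) simp
        show "integrable lborel (\<lambda>u :: complex ^ 'n. exp (- (1 / (10 * t)) * (norm u)\<^sup>2))" by (rule iG)
        fix x u :: "complex ^ 'n"
        have "norm (?h (x, u)) = exp ((norm z)\<^sup>2 / (2 * t)) * (gauss_weighted t f x * ?Q (z - x) u)"
          using Q0[of R "z - x" u] by (simp add: abs_mult gauss_weighted_nonneg)
        also have "\<dots> \<le> exp ((norm z)\<^sup>2 / (2 * t)) * (gauss_weighted t f x * (?K *
          exp (1 * norm (z - x) - 1 / (10 * t) * (norm (z - x))\<^sup>2) * exp (- (1 / (10 * t)) * (norm u)\<^sup>2)))"
          by (intro mult_left_mono diff_kernel_le[OF t a' a(2) B(1) e] gauss_weighted_nonneg) simp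
        finally show "norm (?h (x, u)) \<le> exp ((norm z)\<^sup>2 / (2 * t)) * ?K * (exp (1 * norm (z - x) - 1 / (10 * t) * (norm (z - x))\<^sup>2) * gauss_weighted t f x) * exp (- (1 / (10 * t)) * (norm u)\<^sup>2)"
          by (simp only: mult_ac)
      qed
      have le: "norm (k0 q - k2 q) \<le> ?h q" for q
      proof -
        obtain x u where q: "q = (x, u)" by (cases q)
        let ?y = "z - x"
        let ?x = "x - a *\<^sub>R (z - x)"
        let ?b = "of_real ?M * indicator (cball 0 R) u * twisted_gauss t a ?y u"
        \<comment> \<open>Splits the error into a change of kernel with symbols fixed and a change
          of symbols with kernel fixed; the latter shifts both arguments by
          \<open>a *\<^sub>R (z - x)\<close>.\<close>
        have "k0 q - k2 q = (f x * fock_exp t z x) * ((\<psi> x * \<phi> (x + u)) * (twisted_gauss t 0 ?y u - ?b) + ?b * (\<psi> x * \<phi> (x + u) - \<psi> ?x * \<phi> (?x + u)))"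
          by (simp add: q k0_def k2_def algebra_simps)
        then have "norm (k0 q - k2 q) = norm (f x * fock_exp t z x) * norm ((\<psi> x * \<phi> (x + u)) * (twisted_gauss t 0 ?y u - ?b) + ?b * (\<psi> x * \<phi> (x + u) - \<psi> ?x * \<phi> (?x + u)))"
          by (simp only: norm_mult)
        also have "\<dots> \<le> norm (f x * fock_exp t z x) * (B * norm (twisted_gauss t 0 ?y u - ?b) + ?M * norm (twisted_gauss t a ?y u) * (\<epsilon> + L * (a * norm ?y)))"
        proof (intro mult_left_mono norm_ge_zero order_trans[OF norm_triangle_ineq] add_mono)
          show "norm ((\<psi> x * \<phi> (x + u)) * (twisted_gauss t 0 ?y u - ?b)) \<le> B * norm (twisted_gauss t 0 ?y u - ?b)"
            unfolding norm_mult[of "\<psi> x * \<phi> (x + u)"] by (intro mult_right_mono B) auto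
          have M: "0 \<le> ?M" using a by simp
          have b: "norm ?b \<le> ?M * norm (twisted_gauss t a ?y u)"
          proof -
            have "norm ?b = ?M * indicator (cball 0 R) u * norm (twisted_gauss t a ?y u)"
              using M unfolding norm_mult norm_of_real norm_indicator_complex by simp
            also have "\<dots> \<le> ?M * 1 * norm (twisted_gauss t a ?y u)"
              using M by (intro mult_right_mono mult_left_mono) (auto simp: indicator_def)
            finally show ?thesis by simp
          qed
          have l: "norm (\<psi> x * \<phi> (x + u) - \<psi> ?x * \<phi> (?x + u)) \<le> \<epsilon> + L * (a * norm ?y)"
            using L[of x u ?x] a by simp
          show "norm (?b * (\<psi> x * \<phi> (x + u) - \<psi> ?x * \<phi> (?x + u))) \<le> ?M * norm (twisted_gauss t a ?y u) * (\<epsilon> + L * (a * norm ?y))"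
            unfolding norm_mult[of ?b] using M by (intro mult_mono b l) auto
        qed
        also have "\<dots> = ?h q"
          unfolding norm_mult_fock_exp[OF t] by (simp add: q diff_kernel_def mult_ac)
        finally show ?thesis .
      qed
      have "?g z = ?c\<^sup>2 * (LINT x|lborel. LINT u|lborel. k0 (x, u)) - ?c\<^sup>2 * (LINT x|lborel. LINT u|lborel. k2 (x, u))"
        using toeplitz_comp_eq[OF t p f \<phi> \<psi>, of z] toeplitz_conv_eq[OF t p f \<phi> \<psi> a R s \<Phi>, of z]
        by (simp only: k0_def k2_def prod.case fun_diff_def o_apply)
      also have "\<dots> = ?c\<^sup>2 * (LINT q|(lborel \<Otimes>\<^sub>M lborel). k0 q - k2 q)"
        unfolding lborel_pair.integral_fst'[OF i0] lborel_pair.integral_fst'[OF i2] Bochner_Integration.integral_diff[OF i0 i2]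
        by (simp only: right_diff_distrib)
      finally have "norm (?g z) = ?N\<^sup>2 * norm (LINT q|(lborel \<Otimes>\<^sub>M lborel). k0 q - k2 q)"
        using t by (simp add: norm_mult norm_power norm_divide)
      also have "\<dots> \<le> ?N\<^sup>2 * integral\<^sup>L (lborel \<Otimes>\<^sub>M lborel) ?h"
        using i0 i2 ih le by (intro mult_left_mono Bochner_Integration.integral_norm_bound_integral Bochner_Integration.integrable_diff) auto
      also have "integral\<^sup>L (lborel \<Otimes>\<^sub>M lborel) ?h = (LINT x|lborel. LINT u|lborel. exp ((norm z)\<^sup>2 / (2 * t)) * (gauss_weighted t f x * ?Q (z - x) u))"
        using lborel_pair.integral_fst'[OF ih] by simp
      also have "?N\<^sup>2 * \<dots> = exp ((norm z)\<^sup>2 / (2 * t)) * (LINT w|lborel. H (z - w) * gauss_weighted t f w)"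
      proof -
        have "(LINT w|lborel. H (z - w) * gauss_weighted t f w) = (LINT w|lborel. ?N\<^sup>2 * (gauss_weighted t f w * (LINT u|lborel. ?Q (z - w) u)))"
          by (simp only: H_def mult_ac)
        then have H: "(LINT w|lborel. H (z - w) * gauss_weighted t f w) = ?N\<^sup>2 * (LINT w|lborel. gauss_weighted t f w * (LINT u|lborel. ?Q (z - w) u))"
          by (simp only: integral_mult_right_zero)
        show ?thesis unfolding H integral_mult_right_zero by (rule mult.left_commute)
      qed
      finally show "norm (?g z) \<le> exp ((norm z)\<^sup>2 / (2 * t)) * (LINT w|lborel. H (z - w) * gauss_weighted t f w)" .
    qed
  qed
qed

text \<open>The premise asks only that \<open>K\<close> contain the products of translates. It
  therefore covers the algebra, and equally an ideal that contains one of the two factors.\<close>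

lemma toeplitz_comp_approx:
  fixes \<phi> \<psi> :: "complex ^ 'n::finite \<Rightarrow> complex" and K :: "(complex ^ 'n \<Rightarrow> complex) set"
  assumes t: "t > 0" and p: "p > 1" and \<phi>: "\<phi> \<in> BUC" and \<psi>: "\<psi> \<in> BUC"
    and K: "norm_closed BUC sup_norm K" "cfun.subspace K"
    and prod: "\<And>h k. (\<lambda>x. \<psi> (x + h) * \<phi> (x + k)) \<in> K" and e: "e > 0"
  shows "\<exists>\<Phi>\<in>K. op_norm t p ((toeplitz t p \<phi> \<circ> toeplitz t p \<psi>) - toeplitz t p \<Phi>) < e"
proof -
  let ?N = "1 / (pi * t) ^ CARD('n)"
  let ?D = "DIM(complex ^ 'n)"
  obtain C where C: "0 \<le> C" "\<And>x. norm (\<phi> x) \<le> C" using BUC_bounded[OF \<phi>] by metis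
  obtain D where D: "0 \<le> D" "\<And>x. norm (\<psi> x) \<le> D" using BUC_bounded[OF \<psi>] by metis
  define B where "B = D * C"
  have B: "0 \<le> B" "norm (\<psi> x * \<phi> y) \<le> B" for x y
    unfolding B_def norm_mult using C D by (auto intro!: mult_mono)
  let ?w = "\<lambda>(y :: complex ^ 'n, u). exp (- (norm y)\<^sup>2 / (2 * t)) * norm (twisted_gauss t 0 y u)"
  define W where "W = integral\<^sup>L (lborel \<Otimes>\<^sub>M lborel) ?w"
  have W0: "0 \<le> W" unfolding W_def by (intro Bochner_Integration.integral_nonneg) (auto simp: case_prod_beta')
  \<comment> \<open>The oscillation allowance stays fixed in the limit, where the bound becomes
    \<open>?N\<^sup>2 * (\<epsilon> * W)\<close>; this choice puts it below
    \<open>e\<close>.\<close>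
  define \<epsilon> where "\<epsilon> = e / (?N\<^sup>2 * W + 1)"
  have den: "?N\<^sup>2 * W + 1 > 0" using W0 by (intro add_nonneg_pos mult_nonneg_nonneg) auto
  have \<epsilon>: "\<epsilon> > 0" "?N\<^sup>2 * (\<epsilon> * W) < e"
  proof -
    show pos: "\<epsilon> > 0" using e den by (simp add: \<epsilon>_def)
    have "e = \<epsilon> * (?N\<^sup>2 * W + 1)" using den by (simp add: \<epsilon>_def)
    then show "?N\<^sup>2 * (\<epsilon> * W) < e" using pos by (simp add: algebra_simps)
  qed
  obtain d where d: "d > 0" "\<And>a a' b b'. dist a a' < d \<Longrightarrow> dist b b' < d \<Longrightarrow> norm (\<psi> a * \<phi> b - \<psi> a' * \<phi> b') \<le> \<epsilon>"
    using BUC_product_uniform[OF \<phi> \<psi> \<epsilon>(1)] by blast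
  \<comment> \<open>Beyond distance \<open>d\<close> the trivial variation bound
    \<open>2 * B\<close> equals \<open>L * d\<close>, so the affine bound holds there too.\<close>
  define L where "L = 2 * B / d"
  have L0: "0 \<le> L" using B d(1) by (simp add: L_def)
  have L: "norm (\<psi> x * \<phi> (x + u) - \<psi> x' * \<phi> (x' + u)) \<le> \<epsilon> + L * norm (x - x')" for u x x'
  proof (cases "dist x x' < d")
    case True
    then show ?thesis using d(2)[of x x' "x + u" "x' + u"] L0 by (simp add: dist_norm add_increasing2)
  next
    case False
    have "norm (\<psi> x * \<phi> (x + u) - \<psi> x' * \<phi> (x' + u)) \<le> B + B"
      by (rule order_trans[OF norm_triangle_ineq4 add_mono[OF B(2) B(2)]])
    also have "\<dots> = L * d" using d(1) by (simp add: L_def)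
    also have "\<dots> \<le> L * norm (x - x')" using False L0 by (intro mult_left_mono) (auto simp: dist_norm)
    finally show ?thesis using \<epsilon>(1) by linarith
  qed
  \<comment> \<open>One index drives both limits: width parameter \<open>a k\<close> and cutoff
    radius \<open>real k\<close>.\<close>
  define a where "a k = 1 / real (Suc k)" for k
  have a: "0 < a k" "a k \<le> 1" for k by (auto simp: a_def)
  have a0: "a \<longlonglongrightarrow> 0" unfolding a_def using LIMSEQ_inverse_real_of_nat by (simp add: inverse_eq_divide)
  let ?Q = "\<lambda>k (y :: complex ^ 'n, u). diff_kernel t B \<epsilon> L (a k) (real k) y u"
  have "(\<lambda>k. integral\<^sup>L (lborel \<Otimes>\<^sub>M lborel) (?Q k)) \<longlonglongrightarrow> integral\<^sup>L (lborel \<Otimes>\<^sub>M lborel) (\<lambda>q. \<epsilon> * ?w q)"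
  proof (rule integral_dominated_convergence[where w="\<lambda>(y :: complex ^ 'n, u). (B * (1 + 2 ^ ?D) + 2 ^ ?D * (\<epsilon> + L)) *
      exp (1 * norm y - 1 / (10 * t) * (norm y)\<^sup>2) * exp (- (1 / (10 * t)) * (norm (u :: complex ^ 'n))\<^sup>2)"])
    show "(\<lambda>q. \<epsilon> * ?w q) \<in> borel_measurable (lborel \<Otimes>\<^sub>M lborel)"
      unfolding lborel_prod case_prod_beta' using t
      by (auto intro!: borel_measurable_continuous_onI continuous_intros)
    show "?Q k \<in> borel_measurable (lborel \<Otimes>\<^sub>M lborel)" for k
      using diff_kernel_measurable[OF t] by (simp add: case_prod_beta')
    show "integrable (lborel \<Otimes>\<^sub>M lborel) (\<lambda>(y :: complex ^ 'n, u). (B * (1 + 2 ^ ?D) + 2 ^ ?D * (\<epsilon> + L)) *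
      exp (1 * norm y - 1 / (10 * t) * (norm y)\<^sup>2) * exp (- (1 / (10 * t)) * (norm (u :: complex ^ 'n))\<^sup>2))"
      (is "integrable _ ?W")
    proof (rule integrable_pair_dominated)
      show "?W \<in> borel_measurable (lborel \<Otimes>\<^sub>M lborel)"
        unfolding lborel_prod case_prod_beta' using t by (auto intro!: borel_measurable_continuous_onI continuous_intros)
      show "integrable lborel (\<lambda>y :: complex ^ 'n. (B * (1 + 2 ^ ?D) + 2 ^ ?D * (\<epsilon> + L)) * exp (1 * norm y - 1 / (10 * t) * (norm y)\<^sup>2))"
        using t by (intro integrable_mult_right integrable_exp_linear_gauss) simp
      show "integrable lborel (\<lambda>u :: complex ^ 'n. exp (- (1 / (10 * t)) * (norm u)\<^sup>2))"
        using t by (intro integrable_exp_neg_norm_square) simp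
      have "0 \<le> B * (1 + 2 ^ ?D) + 2 ^ ?D * (\<epsilon> + L)" using B(1) \<epsilon>(1) L0 by simp
      then show "norm (?W (y, u)) \<le> (B * (1 + 2 ^ ?D) + 2 ^ ?D * (\<epsilon> + L)) * exp (1 * norm y - 1 / (10 * t) * (norm y)\<^sup>2) * exp (- (1 / (10 * t)) * (norm u)\<^sup>2)" for y u
        unfolding prod.case real_norm_def by (subst abs_of_nonneg) (intro mult_nonneg_nonneg, assumption, simp_all)
    qed
    show "AE q in lborel \<Otimes>\<^sub>M lborel. norm (?Q k q) \<le> ?W q" for k
    proof (rule AE_I2)
      fix q :: "(complex ^ 'n) \<times> (complex ^ 'n)"
      show "norm (?Q k q) \<le> ?W q"
        using diff_kernel_le[OF t _ a(2) B(1) _ L0, of k \<epsilon> "real k" "fst q" "snd q"]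
          diff_kernel_nonneg[OF t _ a(2) B(1) _ L0, of k \<epsilon> "real k" "fst q" "snd q"] a(1)[of k] \<epsilon>(1)
        by (simp add: case_prod_beta')
    qed
    show "AE q in lborel \<Otimes>\<^sub>M lborel. (\<lambda>k. ?Q k q) \<longlonglongrightarrow> \<epsilon> * ?w q"
    proof (rule AE_I2)
      fix q :: "(complex ^ 'n) \<times> (complex ^ 'n)"
      obtain y u where q: "q = (y, u)" by (cases q)
      have tg: "(\<lambda>k. twisted_gauss t (a k) y u) \<longlonglongrightarrow> twisted_gauss t 0 y u"
        unfolding twisted_gauss_def using t by (intro tendsto_intros a0) auto
      have ind: "(\<lambda>k. indicator (cball 0 (real k)) u :: complex) \<longlonglongrightarrow> 1"
      proof (rule tendsto_eventually)
        obtain m where m: "norm u \<le> real m" using real_arch_simple by blast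
        show "\<forall>\<^sub>F k in sequentially. indicator (cball 0 (real k)) u = (1 :: complex)"
          using eventually_ge_at_top[of m] by eventually_elim (use m in \<open>simp add: indicator_def\<close>)
      qed
      have "(\<lambda>k. diff_kernel t B \<epsilon> L (a k) (real k) y u) \<longlonglongrightarrow> exp (- (norm y)\<^sup>2 / (2 * t)) *
        (B * norm (twisted_gauss t 0 y u - of_real ((1 + 0) ^ ?D) * 1 * twisted_gauss t 0 y u)
         + (1 + 0) ^ ?D * norm (twisted_gauss t 0 y u) * (\<epsilon> + L * (0 * norm y)))"
        unfolding diff_kernel_def by (intro tendsto_intros tg ind a0)
      then show "(\<lambda>k. ?Q k q) \<longlonglongrightarrow> \<epsilon> * ?w q" by (simp add: q mult_ac)
    qed
  qed
  also have "integral\<^sup>L (lborel \<Otimes>\<^sub>M lborel) (\<lambda>q. \<epsilon> * ?w q) = \<epsilon> * W" unfolding W_def by (rule integral_mult_right_zero)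
  finally have "(\<lambda>k. ?N\<^sup>2 * integral\<^sup>L (lborel \<Otimes>\<^sub>M lborel) (?Q k)) \<longlonglongrightarrow> ?N\<^sup>2 * (\<epsilon> * W)"
    by (rule tendsto_mult_left)
  then have "\<forall>\<^sub>F k in sequentially. ?N\<^sup>2 * integral\<^sup>L (lborel \<Otimes>\<^sub>M lborel) (?Q k) < e"
    by (rule order_tendstoD(2)[OF _ \<epsilon>(2)])
  then obtain k where k: "?N\<^sup>2 * integral\<^sup>L (lborel \<Otimes>\<^sub>M lborel) (?Q k) < e"
    unfolding eventually_sequentially by blast
  define s where "s = t * a k / (1 + a k)"
  have s0: "0 < s" "s < t" using a[of k] t by (auto simp: s_def field_simps)
  define G where "G q v = \<psi> (v + snd q) * \<phi> (v + snd q + fst q)" for q :: "(complex ^ 'n) \<times> (complex ^ 'n)" and v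
  define \<Phi> where "\<Phi> v = (LINT q|lborel. (of_real ?N * conv_kernel t s (real k) q) * G q v)" for v
  have \<Phi>K: "\<Phi> \<in> K"
    unfolding \<Phi>_def
  proof (rule integral_mem_closed_subspace[OF K, where C=B])
    show "integrable lborel (\<lambda>q :: (complex ^ 'n) \<times> (complex ^ 'n). of_real ?N * conv_kernel t s (real k) q)"
      by (intro integrable_mult_right conv_kernel_integrable[OF s0]) simp
    show "G q \<in> K" for q
      using prod[of "snd q" "snd q + fst q"] by (simp add: G_def[abs_def] add.assoc)
    show "norm (G q x) \<le> B" for q x unfolding G_def by (rule B)
    fix e :: real assume "e > 0"
    then obtain d where d: "d > 0" "\<And>a a' b b'. dist a a' < d \<Longrightarrow> dist b b' < d \<Longrightarrow> norm (\<psi> a * \<phi> b - \<psi> a' * \<phi> b') \<le> e"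
      using BUC_product_uniform[OF \<phi> \<psi>] by blast
    \<comment> \<open>Half of \<open>d\<close>, because the argument of the second symbol moves with
      both components of \<open>q\<close>.\<close>
    have "norm (G q x - G q' x) \<le> e" if "dist q q' < d / 2" for q q' x
      unfolding G_def
    proof (rule d(2))
      have f: "dist (fst q) (fst q') < d / 2" "dist (snd q) (snd q') < d / 2"
        using that dist_fst_le[of q q'] dist_snd_le[of q q'] by linarith+
      then show "dist (x + snd q) (x + snd q') < d" using d(1) by simp
      have "dist (x + snd q + fst q) (x + snd q' + fst q') \<le> dist (x + snd q) (x + snd q') + dist (fst q) (fst q')"
        by (rule dist_triangle_add)
      then show "dist (x + snd q + fst q) (x + snd q' + fst q') < d" using f by simp
    qed
    then show "\<exists>d>0. \<forall>q q' x. dist q q' < d \<longrightarrow> norm (G q x - G q' x) \<le> e"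
      using d(1) by (intro exI[of _ "d / 2"]) auto
  qed
  have "\<Phi> \<in> BUC" using \<Phi>K K(1) by (auto simp: norm_closed_def)
  have "op_norm t p ((toeplitz t p \<phi> \<circ> toeplitz t p \<psi>) - toeplitz t p \<Phi>) \<le> ?N\<^sup>2 * integral\<^sup>L (lborel \<Otimes>\<^sub>M lborel) (?Q k)"
    by (rule toeplitz_comp_diff_norm_le[OF t p \<phi> \<psi> a _ s_def \<open>\<Phi> \<in> BUC\<close> \<Phi>_def[unfolded G_def] B _ L0 L])
      (use \<epsilon>(1) in simp_all)
  then show ?thesis using k \<Phi>K by (intro bexI[of _ \<Phi>]) auto
qed

section \<open>From pairs of symbols to algebras and ideals\<close>

lemma toeplitz_comp_mem_lin:
  fixes K :: "(complex ^ 'n::finite \<Rightarrow> complex) set"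
  assumes t: "t > 0" and p: "p > 1" and \<phi>: "\<phi> \<in> BUC" and \<psi>: "\<psi> \<in> BUC"
    and K: "norm_closed BUC sup_norm K" "cfun.subspace K"
    and prod: "\<And>h k. (\<lambda>x. \<psi> (x + h) * \<phi> (x + k)) \<in> K"
  shows "toeplitz t p \<phi> \<circ> toeplitz t p \<psi> \<in> toeplitz_lin t p K"
  unfolding toeplitz_lin_def
proof (rule norm_closureI)
  show "toeplitz t p \<phi> \<circ> toeplitz t p \<psi> \<in> bounded_ops t p"
    by (intro bounded_ops_comp[OF p] toeplitz_bounded[OF t p] \<phi> \<psi>)
  fix e :: real assume "e > 0"
  from toeplitz_comp_approx[OF t p \<phi> \<psi> K prod this]
  show "\<exists>Y\<in>cop.span (toeplitz t p ` K). op_norm t p ((toeplitz t p \<phi> \<circ> toeplitz t p \<psi>) - Y) < e"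
    by (blast intro: cop.span_base)
qed

lemma toeplitz_image_bounded:
  "t > 0 \<Longrightarrow> p > 1 \<Longrightarrow> K \<subseteq> BUC \<Longrightarrow> toeplitz t p ` K \<subseteq> bounded_ops t p"
  using toeplitz_bounded by blast

lemma toeplitz_lin_closed:
  assumes t: "t > 0" and p: "p > 1" and K: "K \<subseteq> BUC"
  shows "norm_closed (bounded_ops t p) (op_norm t p) (toeplitz_lin t p K)" "cop.subspace (toeplitz_lin t p K)"
    "toeplitz t p ` K \<subseteq> toeplitz_lin t p K"
proof -
  have S: "cop.span (toeplitz t p ` K) \<subseteq> bounded_ops t p"
    by (rule cop.span_minimal[OF toeplitz_image_bounded[OF assms] bounded_ops_subspace[OF t p]])
  show "norm_closed (bounded_ops t p) (op_norm t p) (toeplitz_lin t p K)"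
    unfolding toeplitz_lin_def by (rule op_closure_closed[OF t p S])
  show "cop.subspace (toeplitz_lin t p K)"
    unfolding toeplitz_lin_def by (rule op_closure_subspace[OF t p S cop.subspace_span])
  show "toeplitz t p ` K \<subseteq> toeplitz_lin t p K"
    unfolding toeplitz_lin_def using op_closure_superset[OF S] cop.span_superset by blast
qed

text \<open>Stated for two families and a target so that it serves three times: with all three equal
  to the algebra, and with an ideal as target and as the right or left family.\<close>

lemma toeplitz_lin_comp:
  assumes t: "t > 0" and p: "p > 1" and J: "J \<subseteq> BUC" "translation_invariant J" "J' \<subseteq> BUC" "translation_invariant J'"
    and K: "norm_closed BUC sup_norm K" "cfun.subspace K"
    and prod: "\<And>f g. f \<in> J \<Longrightarrow> g \<in> J' \<Longrightarrow> f * g \<in> K"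
    and A: "A \<in> toeplitz_lin t p J" and B: "B \<in> toeplitz_lin t p J'"
  shows "A \<circ> B \<in> toeplitz_lin t p K"
proof (rule op_closure_comp[OF t p toeplitz_image_bounded[OF t p J(1)] toeplitz_image_bounded[OF t p J(3)]])
  have KB: "K \<subseteq> BUC" using K(1) by (simp add: norm_closed_def)
  show "norm_closed (bounded_ops t p) (op_norm t p) (toeplitz_lin t p K)" "cop.subspace (toeplitz_lin t p K)"
    using toeplitz_lin_closed[OF t p KB] by auto
  show "A \<in> norm_closure (bounded_ops t p) (op_norm t p) (cop.span (toeplitz t p ` J))"
    "B \<in> norm_closure (bounded_ops t p) (op_norm t p) (cop.span (toeplitz t p ` J'))"
    using A B by (simp_all add: toeplitz_lin_def)
  fix X Y assume "X \<in> toeplitz t p ` J" "Y \<in> toeplitz t p ` J'"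
  then obtain \<phi> \<psi> where *: "\<phi> \<in> J" "\<psi> \<in> J'" "X = toeplitz t p \<phi>" "Y = toeplitz t p \<psi>" by blast
  have "(\<lambda>x. \<psi> (x + h) * \<phi> (x + k)) \<in> K" for h k
  proof -
    have "(\<lambda>x. \<phi> (x + k)) * (\<lambda>x. \<psi> (x + h)) \<in> K"
      using * J by (intro prod) (auto simp: translation_invariant_def)
    then show ?thesis by (simp add: times_fun_def mult.commute)
  qed
  then show "X \<circ> Y \<in> toeplitz_lin t p K"
    using * J K by (auto intro!: toeplitz_comp_mem_lin[OF t p])
qed

lemma toeplitz_algebra_eq_lin:
  assumes t: "t > 0" and p: "p > 1" and J: "closed_subalgebra_BUC J" "translation_invariant J"
  shows "toeplitz_algebra t p J = toeplitz_lin t p J"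
proof
  have JB: "J \<subseteq> BUC" and K: "norm_closed BUC sup_norm J" "cfun.subspace J" and mul: "\<And>f g. f \<in> J \<Longrightarrow> g \<in> J \<Longrightarrow> f * g \<in> J"
    using J(1) by (auto simp: closed_subalgebra_BUC_def norm_closed_def)
  note cl = toeplitz_lin_closed[OF t p JB]
  have "closed_op_subalgebra t p (toeplitz_lin t p J)"
    using cl toeplitz_lin_comp[OF t p JB J(2) JB J(2) K mul] by (simp add: closed_op_subalgebra_def)
  then show "toeplitz_algebra t p J \<subseteq> toeplitz_lin t p J"
    unfolding toeplitz_algebra_def using cl(3) by (intro hull_minimal) auto
  show "toeplitz_lin t p J \<subseteq> toeplitz_algebra t p J"
    unfolding toeplitz_algebra_def hull_def
  proof (rule Inter_greatest)
    fix S assume "S \<in> {S. closed_op_subalgebra t p S \<and> toeplitz t p ` J \<subseteq> S}"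
    then have S: "norm_closed (bounded_ops t p) (op_norm t p) S" "cop.subspace S" "toeplitz t p ` J \<subseteq> S"
      by (auto simp: closed_op_subalgebra_def)
    have "cop.span (toeplitz t p ` J) \<subseteq> S" by (rule cop.span_minimal[OF S(3,2)])
    then have "toeplitz_lin t p J \<subseteq> norm_closure (bounded_ops t p) (op_norm t p) S"
      unfolding toeplitz_lin_def norm_closure_def by blast
    then show "toeplitz_lin t p J \<subseteq> S" using S(1) by (auto simp: norm_closed_def)
  qed
qed

theorem theorem2p1:
  fixes t p :: real and J :: "((complex ^ 'n::finite) \<Rightarrow> complex) set"
  assumes "t > 0" and "1 < p"
    and "closed_subalgebra_BUC J" and "translation_invariant J"
  shows "toeplitz_algebra t p J = toeplitz_lin t p J \<and>
    (\<forall>J\<^sub>1. closed_ideal_of J\<^sub>1 J \<and> translation_invariant J\<^sub>1 \<longrightarrow>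
       two_sided_op_ideal (toeplitz_algebra t p J\<^sub>1) (toeplitz_algebra t p J))"
proof (intro conjI allI impI)
  show eq: "toeplitz_algebra t p J = toeplitz_lin t p J"
    by (rule toeplitz_algebra_eq_lin[OF assms])
  fix J\<^sub>1 assume J1: "closed_ideal_of J\<^sub>1 J \<and> translation_invariant J\<^sub>1"
  have JB: "J \<subseteq> BUC" and cJ: "norm_closure BUC sup_norm J \<subseteq> J"
    using assms(3) by (auto simp: closed_subalgebra_BUC_def norm_closed_def)
  have J1J: "J\<^sub>1 \<subseteq> J" and c1: "norm_closure J sup_norm J\<^sub>1 \<subseteq> J\<^sub>1" and s1: "cfun.subspace J\<^sub>1"
    and mul: "\<And>f g. f \<in> J \<Longrightarrow> g \<in> J\<^sub>1 \<Longrightarrow> f * g \<in> J\<^sub>1" and tr: "translation_invariant J\<^sub>1"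
    using J1 by (auto simp: closed_ideal_of_def norm_closed_def)
  have J1B: "J\<^sub>1 \<subseteq> BUC" using J1J JB by blast
  \<comment> \<open>The ideal is closed only relative to \<open>J\<^sub>1\<close>'s ambient algebra
    \<open>J\<close>; closedness of \<open>J\<close> in \<open>BUC\<close> carries this over to
    \<open>BUC\<close>.\<close>
  have "norm_closure BUC sup_norm J\<^sub>1 \<subseteq> J"
    using cJ J1J unfolding norm_closure_def by blast
  then have "norm_closure BUC sup_norm J\<^sub>1 \<subseteq> J\<^sub>1"
    using c1 unfolding norm_closure_def by blast
  then have K: "norm_closed BUC sup_norm J\<^sub>1" using J1B by (simp add: norm_closed_def)
  have mul': "f * g \<in> J\<^sub>1" if "f \<in> J\<^sub>1" "g \<in> J" for f g
    using mul[OF that(2,1)] by (simp add: mult.commute)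
  \<comment> \<open>An ideal is itself a subalgebra, so the first claim identifies its Toeplitz
    algebra with a closed span as well.\<close>
  have "closed_subalgebra_BUC J\<^sub>1"
    using K s1 mul J1J by (auto simp: closed_subalgebra_BUC_def)
  then have eq1: "toeplitz_algebra t p J\<^sub>1 = toeplitz_lin t p J\<^sub>1"
    by (rule toeplitz_algebra_eq_lin[OF assms(1,2) _ tr])
  note cl = toeplitz_lin_closed[OF assms(1,2) J1B]
  have "toeplitz_lin t p J\<^sub>1 \<subseteq> toeplitz_lin t p J"
    using cop.span_mono[OF image_mono[OF J1J, of "toeplitz t p"]]
    unfolding toeplitz_lin_def norm_closure_def by blast
  then show "two_sided_op_ideal (toeplitz_algebra t p J\<^sub>1) (toeplitz_algebra t p J)"
    unfolding two_sided_op_ideal_def eq eq1 using cl(2)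
      toeplitz_lin_comp[OF assms(1,2) JB assms(4) J1B tr K s1 mul]
      toeplitz_lin_comp[OF assms(1,2) J1B tr JB assms(4) K s1 mul'] by blast
qed

end
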